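(* Let $\Omega$ be a bounded open set in $\mathbb R^n$, $n\geq2$. Let $A$ and $B$ be Young functions such that $$\|\nabla\mathbf u\|_{L^B(\Omega,\mathbb R^{n\times n})}\leq C\|\mathcal E\mathbf u\|_{L^A(\Omega,\mathbb R^{n\times n})}$$ for some constant $C$ and every $\mathbf u\in W^{1,1}_0(\Omega,\mathbb R^n)\cap E^A_0(\Omega,\mathbb R^n)$. Then there exist constants $c>0$ and $t_0\geq0$ such that $$t\int_{t_0}^t \frac{B(s)}{s^2}\,ds \leq A(ct)\quad\text{and}\quad t\int_{t_0}^t \frac{\widetilde A(s)}{s^2}\,ds \leq \widetilde B(ct)\qquad\text{for } t\geq t_0.$$
   Context: A Young function is a convex, left-continuous function $A:[0,\infty)\to[0,\infty]$ with $A(0)=0$, not identically $0$ nor $\infty$; $\widetilde A(t)=\sup\{rt-A(r):r\geq0\}$. $L^A$ is the Orlicz space with Luxemburg norm $\|u\|_{L^A(\Omega)}=\inf\{\lambda>0:\int_\Omega A(|u|/\lambda)dx\leq1\}$ (Euclidean norm for vector/matrix values). $\mathcal E\mathbf u=\frac12(\nabla\mathbf u+(\nabla\mathbf u)^T)$ (distributional); $E^A(\Omega,\mathbb R^n)$ is the space of $\mathbf u\in L^A(\Omega,\mathbb R^n)$ with $\mathcal E\mathbf u\in L^A(\Omega,\mathbb R^{n\times n})$, and $E^A_0(\Omega,\mathbb R^n)$ those whose extension by zero outside $\Omega$ lies in $E^A(\mathbb R^n,\mathbb R^n)$. $W^{1,1}_0(\Omega,\mathbb R^n)$ is the usual Sobolev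 space with zero boundary values. *)

theory Defs
  imports "HOL-Analysis.Analysis"
begin

text \<open>A Young function is represented as A :: real => ennreal; only its values on
  [0,inf) are relevant. Values in ennreal allow the value infinity.\<close>

definition young_function :: "(real \<Rightarrow> ennreal) \<Rightarrow> bool" where
  "young_function A \<longleftrightarrow>
     A 0 = 0 \<and>
     (\<forall>x y l. 0 \<le> x \<longrightarrow> 0 \<le> y \<longrightarrow> 0 \<le> l \<longrightarrow> l \<le> 1 \<longrightarrow>
        A (l * x + (1 - l) * y) \<le> ennreal l * A x + ennreal (1 - l) * A y) \<and>
     (\<forall>t>0. (A \<longlongrightarrow> A t) (at_left t)) \<and>
     (\<exists>t>0. A t \<noteq> 0) \<and>
     (\<exists>t>0. A t \<noteq> \<infinity>)"

text \<open>Young conjugate: sup over r >= 0 of (r t - A r); truncated subtraction in ennreal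
  is harmless since the value r = 0 already contributes 0.\<close>
definition young_conj :: "(real \<Rightarrow> ennreal) \<Rightarrow> real \<Rightarrow> ennreal" where
  "young_conj A t = (SUP r\<in>{0..}. ennreal (r * t) - A r)"

definition orlicz_norm :: "(real \<Rightarrow> ennreal) \<Rightarrow> 'a set \<Rightarrow> ('a::euclidean_space \<Rightarrow> 'b::real_normed_vector) \<Rightarrow> ennreal" where
  "orlicz_norm A U f =
     Inf {ennreal l | l. l > 0 \<and> (\<integral>\<^sup>+ x\<in>U. A (norm (f x) / l) \<partial>lebesgue) \<le> 1}"

definition in_orlicz :: "(real \<Rightarrow> ennreal) \<Rightarrow> 'a set \<Rightarrow> ('a::euclidean_space \<Rightarrow> 'b::{real_normed_vector, second_countable_topology}) \<Rightarrow> bool" where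
  "in_orlicz A U f \<longleftrightarrow> set_borel_measurable lebesgue U f \<and> orlicz_norm A U f < \<infinity>"

primrec Ck :: "nat \<Rightarrow> ('a::euclidean_space \<Rightarrow> real) \<Rightarrow> bool" where
  "Ck 0 f = continuous_on UNIV f"
| "Ck (Suc k) f = (continuous_on UNIV f \<and> (\<forall>x. f differentiable (at x)) \<and>
                   (\<forall>v. Ck k (\<lambda>x. frechet_derivative f (at x) v)))"

definition smooth_fun :: "('a::euclidean_space \<Rightarrow> real) \<Rightarrow> bool" where
  "smooth_fun f \<longleftrightarrow> (\<forall>k. Ck k f)"

definition test_fun :: "'a set \<Rightarrow> ('a::euclidean_space \<Rightarrow> real) \<Rightarrow> bool" where
  "test_fun U \<phi> \<longleftrightarrow> smooth_fun \<phi> \<and> compact (closure {x. \<phi> x \<noteq> 0})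
                     \<and> closure {x. \<phi> x \<noteq> 0} \<subseteq> U"

definition pd :: "(real^'n \<Rightarrow> real) \<Rightarrow> 'n \<Rightarrow> real^'n \<Rightarrow> real" where
  "pd \<phi> j x = frechet_derivative \<phi> (at x) (axis j 1)"

definition jac :: "(real^'n \<Rightarrow> real^'n) \<Rightarrow> real^'n \<Rightarrow> real^'n^'n" where
  "jac \<phi> x = (\<chi> i j. pd (\<lambda>y. \<phi> y $ i) j x)"

definition loc_int :: "'a set \<Rightarrow> ('a::euclidean_space \<Rightarrow> real) \<Rightarrow> bool" where
  "loc_int U f \<longleftrightarrow> (\<forall>K. compact K \<and> K \<subseteq> U \<longrightarrow> set_integrable lebesgue K f)"

definition weak_grad :: "(real^'n) set \<Rightarrow> (real^'n \<Rightarrow> real^'n) \<Rightarrow> (real^'n \<Rightarrow> real^'n^'n) \<Rightarrow> bool" where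
  "weak_grad U u G \<longleftrightarrow>
     (\<forall>i. loc_int U (\<lambda>x. u x $ i)) \<and> (\<forall>i j. loc_int U (\<lambda>x. G x $ i $ j)) \<and>
     (\<forall>\<phi>. test_fun U \<phi> \<longrightarrow> (\<forall>i j.
        (LINT x:U|lebesgue. u x $ i * pd \<phi> j x) = - (LINT x:U|lebesgue. G x $ i $ j * \<phi> x)))"

definition weak_symgrad :: "(real^'n) set \<Rightarrow> (real^'n \<Rightarrow> real^'n) \<Rightarrow> (real^'n \<Rightarrow> real^'n^'n) \<Rightarrow> bool" where
  "weak_symgrad U u E \<longleftrightarrow>
     (\<forall>i. loc_int U (\<lambda>x. u x $ i)) \<and> (\<forall>i j. loc_int U (\<lambda>x. E x $ i $ j)) \<and>
     (\<forall>\<phi>. test_fun U \<phi> \<longrightarrow> (\<forall>i j.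
        (LINT x:U|lebesgue. u x $ i * pd \<phi> j x + u x $ j * pd \<phi> i x)
          = - 2 * (LINT x:U|lebesgue. E x $ i $ j * \<phi> x)))"

definition in_EA :: "(real \<Rightarrow> ennreal) \<Rightarrow> (real^'n) set \<Rightarrow> (real^'n \<Rightarrow> real^'n) \<Rightarrow> bool" where
  "in_EA A U u \<longleftrightarrow> in_orlicz A U u \<and> (\<exists>E. weak_symgrad U u E \<and> in_orlicz A U E)"

definition in_EA0 :: "(real \<Rightarrow> ennreal) \<Rightarrow> (real^'n) set \<Rightarrow> (real^'n \<Rightarrow> real^'n) \<Rightarrow> bool" where
  "in_EA0 A U u \<longleftrightarrow> in_EA A UNIV (\<lambda>x. if x \<in> U then u x else 0)"

definition in_W11 :: "(real^'n) set \<Rightarrow> (real^'n \<Rightarrow> real^'n) \<Rightarrow> (real^'n \<Rightarrow> real^'n^'n) \<Rightarrow> bool" where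
  "in_W11 U u G \<longleftrightarrow> set_integrable lebesgue U u \<and> set_integrable lebesgue U G \<and> weak_grad U u G"

definition in_W110 :: "(real^'n) set \<Rightarrow> (real^'n \<Rightarrow> real^'n) \<Rightarrow> (real^'n \<Rightarrow> real^'n^'n) \<Rightarrow> bool" where
  "in_W110 U u G \<longleftrightarrow> in_W11 U u G \<and>
     (\<exists>\<phi>s :: nat \<Rightarrow> real^'n \<Rightarrow> real^'n.
        (\<forall>k i. test_fun U (\<lambda>x. \<phi>s k x $ i)) \<and>
        (\<forall>k. set_integrable lebesgue U (\<lambda>x. norm (\<phi>s k x - u x) + norm (jac (\<phi>s k) x - G x))) \<and>
        (\<lambda>k. LINT x:U|lebesgue. norm (\<phi>s k x - u x) + norm (jac (\<phi>s k) x - G x)) \<longlonglongrightarrow> 0)"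

end

theory Submission
  imports Defs
begin

text \<open>Both inequalities are read off from smooth test fields whose gradients follow finite staircase
  laminates in a plane spanned by two off-diagonal entries \<open>(a, b)\<close>. The matrices
  \<open>a e\<^sub>p\<otimes>e\<^sub>q\<close> and \<open>b e\<^sub>q\<otimes>e\<^sub>p\<close> have rank one, so
  each coordinate may be split independently by adding a fine oscillation, while the symmetric part
  only sees \<open>a + b\<close>.

  Starting from \<open>(s, s)\<close> and splitting towards \<open>(2s, 2s)\<close> leaves behind purely skew
  gradients of size \<open>s\<close> on a fixed fraction of the set and halves the measure that remains. The
  symmetric gradient thus concentrates at height \<open>t\<close> on measure of order \<open>1/t\<close> while the
  skew part has the tail \<open>1/s\<close> for \<open>s \<le> t\<close>; this yields the inequality for
  \<open>B\<close> and \<open>A\<close>.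

  Starting from \<open>(a, -a)\<close> and continuing with \<open>(a + g, -a - g)\<close> on a quarter of the
  set costs a symmetric gradient of size \<open>g\<close>. With \<open>g = g\<^sub>k\<close> nearly optimal in the
  definition of the conjugate of \<open>A\<close> at geometrically growing heights, Young's inequality for
  \<open>B\<close> on the innermost set yields the inequality for the conjugates.\<close>

text \<open>Everything is tested through modulars: a field is scaled so that the
  \<open>A\<close>-modular of its symmetric gradient is at most 1, and the hypothesis then bounds a
  \<open>B\<close>-modular of the full gradient by 1. No doubling condition is available, so
  constants can only be absorbed into arguments by convexity. The remaining free parameter is the
  volume of the region in \<Omega> that carries the field. It is tuned to t: of order t / A(ct) for
  the first inequality, and t divided by the conjugate of \<open>B\<close> at ct for the second. It
  fits into \<Omega> for large c because both functions grow at least linearly. A smooth field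
  attains a laminate only up to a transition set. In the concentrating rounds this set has bounded
  height and arbitrarily small measure, so the rounds are almost free for \<open>A\<close> and the
  peak may spend the budget. The skew rounds have a genuine cost, charged with weight 4^-j. Sampling
  the conjugate at heights t0 4^(j+1) makes weight times height constant, so the linear gains add up
  to exactly the size of the final skew gradient.\<close>

abbreviation vol :: "'a::euclidean_space set \<Rightarrow> real" where
  "vol \<equiv> measure lebesgue"

section \<open>Smooth functions\<close>

text \<open>\<open>Ck\<close> refers to \<open>frechet_derivative\<close>, a value obtained by
  choice. Derivatives are unique here, so an explicit derivative may take its place, and each
  closure property below reduces to exhibiting one.\<close>

lemma Ck_SucI:
  assumes "\<And>x. (f has_derivative f' x) (at x)" and "\<And>v. Ck k (\<lambda>x. f' x v)"
  shows "Ck (Suc k) f"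
proof -
  have "frechet_derivative f (at x) = f' x" for x
    using frechet_derivative_at[OF assms(1)] by simp
  moreover have "continuous_on UNIV f"
    by (rule has_derivative_continuous_on, rule has_derivative_at_withinI, rule assms(1))
  ultimately show ?thesis
    using assms by (auto simp: differentiable_def)
qed

lemma Ck_SucD:
  assumes "Ck (Suc k) f"
  shows "(f has_derivative frechet_derivative f (at x)) (at x)" "Ck k (\<lambda>x. frechet_derivative f (at x) v)"
  using assms by (auto simp: frechet_derivative_works)

lemma Ck_Suc_imp: "Ck (Suc k) f \<Longrightarrow> Ck k f"
proof (induction k arbitrary: f)
  case (Suc k)
  show ?case
    by (rule Ck_SucI[OF Ck_SucD(1)[OF Suc.prems]]) (rule Suc.IH, rule Ck_SucD(2)[OF Suc.prems])
qed simp

lemma Ck_const [simp]: "Ck k (\<lambda>x. c)"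
proof (induction k arbitrary: c)
  case (Suc k)
  show ?case by (rule Ck_SucI[where f' = "\<lambda>_ _. 0"]) (auto intro: Suc)
qed simp

lemma Ck_add: "Ck k f \<Longrightarrow> Ck k g \<Longrightarrow> Ck k (\<lambda>x. f x + g x)"
proof (induction k arbitrary: f g)
  case 0
  then show ?case by (simp add: continuous_on_add)
next
  case (Suc k)
  show ?case
    by (rule Ck_SucI[OF has_derivative_add[OF Ck_SucD(1)[OF Suc.prems(1)] Ck_SucD(1)[OF Suc.prems(2)]]])
       (intro Suc.IH Ck_SucD(2) Suc.prems)
qed

lemma Ck_mult: "Ck k f \<Longrightarrow> Ck k g \<Longrightarrow> Ck k (\<lambda>x. f x * g x)"
proof (induction k arbitrary: f g)
  case 0
  then show ?case by (simp add: continuous_on_mult)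
next
  case (Suc k)
  show ?case
    by (rule Ck_SucI[OF has_derivative_mult[OF Ck_SucD(1)[OF Suc.prems(1)] Ck_SucD(1)[OF Suc.prems(2)]]])
       (intro Ck_add Suc.IH Ck_SucD(2) Suc.prems Ck_Suc_imp)
qed

text \<open>The inner derivative is the constant map \<open>L\<close>, so a directional derivative
  of the composition is again a composition with the same affine map. The induction therefore closes
  without a general chain rule for \<open>Ck\<close>.\<close>

lemma Ck_compose_affine:
  assumes "bounded_linear L"
  shows "Ck k f \<Longrightarrow> Ck k (\<lambda>x. f (L x + d))"
proof (induction k arbitrary: f)
  case 0
  have "continuous_on UNIV (\<lambda>x. L x + d)"
    using assms by (simp add: continuous_on_add linear_continuous_on)
  then show ?case
    using continuous_on_compose2[of UNIV f UNIV "\<lambda>x. L x + d"] 0 by simp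
next
  case (Suc k)
  have L: "((\<lambda>x. L x + d) has_derivative L) (at x)" for x
    using has_derivative_add[OF bounded_linear_imp_has_derivative[OF assms] has_derivative_const] by simp
  have "((\<lambda>x. f (L x + d)) has_derivative (\<lambda>v. frechet_derivative f (at (L x + d)) (L v))) (at x)" for x
    using has_derivative_compose[OF L Ck_SucD(1)[OF Suc.prems]] .
  then show ?case
    by (rule Ck_SucI) (rule Suc.IH, rule Ck_SucD(2)[OF Suc.prems])
qed

lemma Ck_real_SucI:
  fixes f :: "real \<Rightarrow> real"
  assumes "\<And>x. (f has_real_derivative f' x) (at x)" and "Ck k f'"
  shows "Ck (Suc k) f"
  by (rule Ck_SucI[OF assms(1)[unfolded has_field_derivative_def]]) (intro Ck_mult assms Ck_const)

lemma smooth_const: "smooth_fun (\<lambda>x. c)"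
  by (simp add: smooth_fun_def)

lemma smooth_add: "smooth_fun f \<Longrightarrow> smooth_fun g \<Longrightarrow> smooth_fun (\<lambda>x. f x + g x)"
  by (simp add: smooth_fun_def Ck_add)

lemma smooth_mult: "smooth_fun f \<Longrightarrow> smooth_fun g \<Longrightarrow> smooth_fun (\<lambda>x. f x * g x)"
  by (simp add: smooth_fun_def Ck_mult)

lemma smooth_compose_affine: "bounded_linear L \<Longrightarrow> smooth_fun f \<Longrightarrow> smooth_fun (\<lambda>x. f (L x + d))"
  by (simp add: smooth_fun_def Ck_compose_affine)

lemma smooth_compose_scale:
  fixes f :: "real \<Rightarrow> real"
  shows "smooth_fun f \<Longrightarrow> smooth_fun (\<lambda>x. f (c * x + d))"
  by (rule smooth_compose_affine) (auto intro: bounded_linear_intros)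

lemma smooth_sum: "(\<And>i. i \<in> I \<Longrightarrow> smooth_fun (f i)) \<Longrightarrow> smooth_fun (\<lambda>x. \<Sum>i\<in>I. f i x)"
  by (induction I rule: infinite_finite_induct) (auto intro: smooth_add smooth_const)

lemma smooth_prod: "(\<And>i. i \<in> I \<Longrightarrow> smooth_fun (f i)) \<Longrightarrow> smooth_fun (\<lambda>x. \<Prod>i\<in>I. f i x)"
  by (induction I rule: infinite_finite_induct) (auto intro: smooth_mult smooth_const)

lemma smooth_antiderivative:
  fixes f :: "real \<Rightarrow> real"
  assumes "\<And>x. (f has_real_derivative f' x) (at x)" and "smooth_fun f'"
  shows "smooth_fun f"
  unfolding smooth_fun_def
proof
  fix k
  show "Ck k f"
    using Ck_Suc_imp Ck_real_SucI assms unfolding smooth_fun_def by blast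
qed

lemma smooth_continuous: "smooth_fun f \<Longrightarrow> continuous_on UNIV f"
  unfolding smooth_fun_def by (metis Ck.simps(1))

lemma smooth_has_derivative: "smooth_fun f \<Longrightarrow> (f has_derivative frechet_derivative f (at x)) (at x)"
  unfolding smooth_fun_def using Ck_SucD(1) by blast

lemma smooth_frechet_derivative: "smooth_fun f \<Longrightarrow> smooth_fun (\<lambda>x. frechet_derivative f (at x) v)"
  unfolding smooth_fun_def using Ck_SucD(2) by blast

section \<open>Smooth profiles of one variable: step, tent and plateau\<close>

lemma exp_neg_inverse_tendsto:
  "((\<lambda>x. (1/x)^n * exp (-1/x)) \<longlongrightarrow> (0::real)) (at_right 0)"
proof -
  have "((\<lambda>y. y^n / exp y) \<longlongrightarrow> (0::real)) at_top"
    by (rule tendsto_power_div_exp_0)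
  then have "((\<lambda>x. (inverse x)^n / exp (inverse x)) \<longlongrightarrow> (0::real)) (at_right 0)"
    by (rule filterlim_compose) (rule filterlim_inverse_at_top_right)
  then show ?thesis
    by (simp add: exp_minus divide_inverse)
qed

text \<open>The case n = 0 is the classical flat function exp(-1/x). The powers of 1/x make the
  family closed under differentiation up to linear combinations, so a single induction proves all
  members smooth.\<close>

definition flat :: "nat \<Rightarrow> real \<Rightarrow> real" where
  "flat n x = (if 0 < x then (1/x)^n * exp (-1/x) else 0)"

lemma flat_has_derivative:
  "(flat n has_real_derivative flat (n+2) x - n * flat (n+1) x) (at x)"
proof -
  consider "x > 0" | "x < 0" | "x = 0" by linarith
  then show ?thesis
  proof cases
    case 1
    have "((\<lambda>x. (1/x)^n * exp (-1/x)) has_real_derivative flat (n+2) x - n * flat (n+1) x) (at x)"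
      using 1
      apply (auto intro!: derivative_eq_intros simp: flat_def)
      apply (cases n)
       apply (auto simp: field_simps power2_eq_square)
      done
    then show ?thesis
      by (rule DERIV_cong_ev[OF refl _ refl, THEN iffD1, rotated])
         (use 1 in \<open>auto simp: flat_def eventually_nhds intro!: exI[of _ "{0<..}"]\<close>)
  next
    case 2
    have "((\<lambda>x. 0) has_real_derivative flat (n+2) x - n * flat (n+1) x) (at x)"
      using 2 by (auto simp: flat_def)
    then show ?thesis
      by (rule DERIV_cong_ev[OF refl _ refl, THEN iffD1, rotated])
         (use 2 in \<open>auto simp: flat_def eventually_nhds intro!: exI[of _ "{..<0}"]\<close>)
  next
    case 3
    \<comment> \<open>At 0 the claimed derivative is 0. From the left the quotient vanishes; from
      the right it is the next member of the family, which tends to 0.\<close>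
    have "((\<lambda>h. (flat n h - flat n 0) / (h - 0)) \<longlongrightarrow> 0) (at 0)"
      unfolding filterlim_at_split
    proof
      show "((\<lambda>h. (flat n h - flat n 0) / (h - 0)) \<longlongrightarrow> 0) (at_left 0)"
        by (rule tendsto_eventually) (auto simp: flat_def eventually_at intro!: exI[of _ 1])
      have "\<forall>\<^sub>F h in at_right 0. (1/h)^(Suc n) * exp (-1/h) = (flat n h - flat n 0) / (h - 0)"
        by (auto simp: flat_def eventually_at intro!: exI[of _ 1])
      then show "((\<lambda>h. (flat n h - flat n 0) / (h - 0)) \<longlongrightarrow> 0) (at_right 0)"
        by (rule Lim_transform_eventually[OF exp_neg_inverse_tendsto[of "Suc n"]])
    qed
    then show ?thesis
      using 3 by (simp add: has_field_derivative_iff flat_def)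
  qed
qed

lemma Ck_flat: "Ck k (flat n)"
proof (induction k arbitrary: n)
  case 0
  show ?case
    unfolding Ck.simps by (rule DERIV_continuous_on, rule flat_has_derivative)
next
  case (Suc k)
  have "Ck k (\<lambda>x. flat (n+2) x + (- n) * flat (n+1) x)"
    by (intro Ck_add Ck_mult Suc Ck_const)
  then show ?case
    by (intro Ck_real_SucI[OF flat_has_derivative]) auto
qed

lemma real_antiderivative:
  fixes f :: "real \<Rightarrow> real"
  assumes "continuous_on UNIV f"
  shows "\<exists>F. (\<forall>x. (F has_real_derivative f x) (at x)) \<and> F 0 = 0"
proof -
  have "\<exists>F. \<forall>x. (-\<infinity>::ereal) < ereal x \<longrightarrow> ereal x < \<infinity> \<longrightarrow> (F has_vector_derivative f x) (at x)"
    using assms by (intro einterval_antiderivative) (auto simp: continuous_on_eq_continuous_at)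
  then obtain F where F: "\<And>x. (F has_real_derivative f x) (at x)"
    by (auto simp: has_real_derivative_iff_has_vector_derivative)
  show ?thesis
    by (rule exI[of _ "\<lambda>x. F x - F 0"]) (auto intro!: derivative_eq_intros F)
qed

lemma DERIV_zero_between:
  fixes F :: "real \<Rightarrow> real"
  assumes F: "\<And>x. (F has_real_derivative f x) (at x)" and "a \<le> b"
    and "\<And>x. a < x \<Longrightarrow> x < b \<Longrightarrow> f x = 0"
  shows "F a = F b"
proof (cases "a = b")
  case False
  have "continuous_on {a..b} F"
    by (rule DERIV_continuous_on) (rule has_field_derivative_at_within[OF F])
  moreover have "DERIV F x :> 0" if "a < x" "x < b" for x
    using F[of x] assms(3)[OF that] by simp
  ultimately show ?thesis
    using DERIV_isconst_end[of a b F] False \<open>a \<le> b\<close> by simp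
qed simp

text \<open>\<sigma> is the normalised antiderivative of a bump living on the unit interval, and
  \<Sigma> integrates once more, giving a smoothed positive part. The shift \<open>c\<close> of its
  linear part stays implicit because it cancels in the tent built from \<Sigma>.\<close>

lemma smooth_step_exists:
  obtains \<sigma> \<Sigma> :: "real \<Rightarrow> real" and c :: real
  where "smooth_fun \<sigma>" "smooth_fun \<Sigma>" "\<And>x. (\<Sigma> has_real_derivative \<sigma> x) (at x)"
    "\<And>x. x \<le> 0 \<Longrightarrow> \<sigma> x = 0" "\<And>x. 1 \<le> x \<Longrightarrow> \<sigma> x = 1" "\<And>x. 0 \<le> \<sigma> x" "\<And>x. \<sigma> x \<le> 1"
    "\<And>x. x \<le> 0 \<Longrightarrow> \<Sigma> x = 0" "\<And>x. 1 \<le> x \<Longrightarrow> \<Sigma> x = x - c"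
proof -
  define b where "b x = flat 0 x * flat 0 ((-1) * x + 1)" for x
  have "smooth_fun (flat 0)"
    by (simp add: smooth_fun_def Ck_flat)
  then have sb: "smooth_fun b"
    unfolding b_def[abs_def] by (intro smooth_mult smooth_compose_scale[of "flat 0"])
  have b0: "b x = 0" if "x \<le> 0 \<or> 1 \<le> x" for x
    using that by (auto simp: b_def flat_def)
  have bge: "b x \<ge> 0" for x by (auto simp: b_def flat_def)
  have bpos: "b x > 0" if "0 < x" "x < 1" for x using that by (auto simp: b_def flat_def)
  obtain F where F: "\<And>x. (F has_real_derivative b x) (at x)" "F 0 = 0"
    using real_antiderivative[OF smooth_continuous[OF sb]] by auto
  have mono: "F x \<le> F y" if "x \<le> y" for x y
    by (rule DERIV_nonneg_imp_nondecreasing[OF that]) (use F(1) bge in auto)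
  have le0: "F x = F 0" if "x \<le> 0" for x
    by (rule DERIV_zero_between[OF F(1) that]) (simp add: b0)
  have ge1: "F x = F 1" if "1 \<le> x" for x
    by (rule DERIV_zero_between[OF F(1) that, symmetric]) (simp add: b0)
  have pos: "\<exists>y. DERIV F x :> y \<and> 0 < y" if "1/4 \<le> x" "x \<le> 3/4" for x
    by (intro exI[of _ "b x"] conjI F(1) bpos) (use that in linarith)+
  have "F (1/4) < F (3/4)"
    by (rule DERIV_pos_imp_increasing[OF _ pos]) auto
  then have F1: "F 1 > 0"
    using mono[of "3/4" 1] mono[of 0 "1/4"] F(2) by simp
  define s where "s x = F x / F 1" for x
  have sd: "(s has_real_derivative b x / F 1) (at x)" for x
    unfolding s_def using F1 by (auto intro!: derivative_eq_intros F(1))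
  have ss: "smooth_fun s"
    by (rule smooth_antiderivative[OF sd])
       (use smooth_mult[OF sb smooth_const[of "1/F 1"]] in simp)
  have s0: "s x = 0" if "x \<le> 0" for x using le0[OF that] F(2) by (simp add: s_def)
  have s1: "s x = 1" if "1 \<le> x" for x using ge1[OF that] F1 by (simp add: s_def)
  have sge: "0 \<le> s x" for x
    using mono[of 0 x] le0[of x] F(2) F1 by (cases "x \<le> 0") (auto simp: s_def)
  have sle: "s x \<le> 1" for x
    using mono[of x 1] ge1[of x] F1 by (cases "x \<le> 1") (auto simp: s_def)
  obtain S where S: "\<And>x. (S has_real_derivative s x) (at x)" "S 0 = 0"
    using real_antiderivative[OF smooth_continuous[OF ss]] by auto
  have S0: "S x = 0" if "x \<le> 0" for x
    using DERIV_zero_between[OF S(1) that] s0 S(2) by simp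
  have d: "((\<lambda>x. S x - x) has_real_derivative s y - 1) (at y)" for y
    by (auto intro!: derivative_eq_intros S)
  have S1: "S x = x - (1 - S 1)" if "1 \<le> x" for x
    using DERIV_zero_between[OF d that] s1 by simp
  show thesis
    by (rule that[OF ss smooth_antiderivative[OF S(1) ss] S(1) s0 s1 sge sle S0 S1])
qed

text \<open>The slope is a combination of three smoothed steps of width \<eta>, starting at \<eta>,
  at the kink \<open>r\<close> and at 1 - 2\<eta>. Zero values at both ends force the areas under
  the two slopes to balance; this fixes \<open>r\<close> and is why slope \<beta> occupies the
  fraction \<theta> of the interval.\<close>

lemma tent_exists:
  fixes \<alpha> \<beta> \<eta> \<theta> r :: real
  assumes "0 < \<alpha>" "0 < \<beta>" "0 < \<eta>" and \<theta>: "\<theta> = \<alpha> / (\<alpha> + \<beta>)"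
    and "\<eta> \<le> \<theta> * (1 - 3 * \<eta>)" "\<eta> \<le> (1 - \<theta>) * (1 - 3 * \<eta>)"
    and r_def: "r = \<eta> + (1 - \<theta>) * (1 - 3 * \<eta>)"
  obtains g g' :: "real \<Rightarrow> real" where "smooth_fun g"
    "\<And>y. (g has_real_derivative g' y) (at y)"
    "\<And>y. y \<le> \<eta> \<or> 1 - \<eta> \<le> y \<Longrightarrow> g y = 0"
    "\<And>y. -\<alpha> \<le> g' y" "\<And>y. g' y \<le> \<beta>"
    "\<And>y. 2 * \<eta> \<le> y \<Longrightarrow> y \<le> r \<Longrightarrow> g' y = - \<alpha>"
    "\<And>y. r + \<eta> \<le> y \<Longrightarrow> y \<le> 1 - 2 * \<eta> \<Longrightarrow> g' y = \<beta>"
proof -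
  obtain \<sigma> \<Sigma> c where s: "smooth_fun \<sigma>" "smooth_fun \<Sigma>" "\<And>x. (\<Sigma> has_real_derivative \<sigma> x) (at x)"
    "\<And>x. x \<le> 0 \<Longrightarrow> \<sigma> x = 0" "\<And>x. 1 \<le> x \<Longrightarrow> \<sigma> x = 1" "\<And>x. 0 \<le> \<sigma> x" "\<And>x. \<sigma> x \<le> 1"
    "\<And>x. x \<le> 0 \<Longrightarrow> \<Sigma> x = 0" "\<And>x. 1 \<le> x \<Longrightarrow> \<Sigma> x = x - (c::real)"
    by (rule smooth_step_exists) (rule that)
  define p where "p = \<eta>"
  define q where "q = 1 - 2 * \<eta>"
  have pr: "p + \<eta> \<le> r" and rq: "r + \<eta> \<le> q" and balance: "\<alpha> * p - (\<alpha> + \<beta>) * r + \<beta> * q = 0"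
    using assms(5,6) assms(1,2) by (auto simp: p_def q_def r_def \<theta> field_simps)
  define Z where "Z a y = \<sigma> ((1/\<eta>) * y + (-a/\<eta>))" for a y
  define Y where "Y a y = \<Sigma> ((1/\<eta>) * y + (-a/\<eta>))" for a y
  define g where "g y = (-\<alpha>*\<eta>) * Y p y + (((\<alpha>+\<beta>)*\<eta>) * Y r y + (-\<beta>*\<eta>) * Y q y)" for y
  define g' where "g' y = (-\<alpha>) * Z p y + ((\<alpha>+\<beta>) * Z r y + (-\<beta>) * Z q y)" for y
  have arg: "(1/\<eta>) * y + (-a/\<eta>) = (y - a)/\<eta>" for y a
    by (simp add: diff_divide_distrib)
  have Z0: "Z a y = 0" and Y0: "Y a y = 0" if "y \<le> a" for a y
    using \<open>0 < \<eta>\<close> that s(4)[of "(y - a)/\<eta>"] s(8)[of "(y - a)/\<eta>"]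
    unfolding Z_def Y_def arg by (auto simp: divide_nonpos_pos)
  have Z1: "Z a y = 1" and Y1: "\<eta> * Y a y = y - a - \<eta> * c" if "a + \<eta> \<le> y" for a y
  proof -
    have "1 \<le> (y - a)/\<eta>"
      using \<open>0 < \<eta>\<close> that by (simp add: field_simps)
    then have "Z a y = 1" "Y a y = (y - a)/\<eta> - c"
      using s(5)[of "(y - a)/\<eta>"] s(9)[of "(y - a)/\<eta>"] unfolding Z_def Y_def arg by auto
    then show "Z a y = 1" "\<eta> * Y a y = y - a - \<eta> * c"
      using \<open>0 < \<eta>\<close> by (auto simp: field_simps)
  qed
  have Zb: "0 \<le> Z a y" "Z a y \<le> 1" for a y
    by (simp_all add: Z_def s(6,7))
  have Ys: "smooth_fun (Y a)" for a
    unfolding Y_def[abs_def] by (intro smooth_compose_scale s(2))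
  have Yd: "(Y a has_real_derivative Z a y * (1/\<eta>)) (at y)" for a y
    unfolding Z_def Y_def[abs_def]
    by (rule DERIV_chain2[OF s(3)]) (use \<open>0 < \<eta>\<close> in \<open>auto intro!: derivative_eq_intros\<close>)
  have "p \<le> r" "r \<le> q" "p + \<eta> \<le> q"
    using pr rq \<open>0 < \<eta>\<close> by auto
  have bnd: "-\<alpha> \<le> g' y \<and> g' y \<le> \<beta>" for y
  proof -
    have b: "0 \<le> \<alpha> * Z p y" "\<alpha> * Z p y \<le> \<alpha>" "0 \<le> (\<alpha>+\<beta>) * Z r y" "(\<alpha>+\<beta>) * Z r y \<le> \<alpha>+\<beta>"
        "0 \<le> \<beta> * Z q y" "\<beta> * Z q y \<le> \<beta>"
      using Zb \<open>0 < \<alpha>\<close> \<open>0 < \<beta>\<close> mult_left_le[of "Z p y" \<alpha>] mult_left_le[of "Z r y" "\<alpha>+\<beta>"]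
        mult_left_le[of "Z q y" \<beta>] by simp_all
    consider "y \<le> r" | "r \<le> y" "y \<le> q" | "q \<le> y" by linarith
    then show ?thesis
    proof cases
      case 1
      then have "g' y = - (\<alpha> * Z p y)"
        using \<open>r \<le> q\<close> by (simp add: g'_def Z0)
      then show ?thesis using b \<open>0 < \<alpha>\<close> \<open>0 < \<beta>\<close> by linarith
    next
      case 2
      then have "g' y = - \<alpha> + (\<alpha> + \<beta>) * Z r y"
        using pr by (simp add: g'_def Z0 Z1)
      then show ?thesis using b by linarith
    next
      case 3
      then have "g' y = \<beta> - \<beta> * Z q y"
        using rq pr \<open>0 < \<eta>\<close> by (simp add: g'_def Z1)
      then show ?thesis using b \<open>0 < \<alpha>\<close> \<open>0 < \<beta>\<close> by linarith
    qed
  qed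
  show thesis
  proof (rule that)
    show "smooth_fun g"
      unfolding g_def[abs_def] by (intro smooth_add smooth_mult smooth_const Ys)
    show "(g has_real_derivative g' y) (at y)" for y
      unfolding g_def[abs_def] g'_def
      by (rule DERIV_cong, (rule DERIV_add DERIV_cmult Yd)+) (use \<open>0 < \<eta>\<close> in \<open>simp add: field_simps\<close>)
    show "g y = 0" if "y \<le> \<eta> \<or> 1 - \<eta> \<le> y" for y
    proof (cases "y \<le> \<eta>")
      case True
      then show ?thesis
        using \<open>p \<le> r\<close> \<open>r \<le> q\<close> by (simp add: g_def Y0 p_def)
    next
      case False
      then have y: "p + \<eta> \<le> y" "r + \<eta> \<le> y" "q + \<eta> \<le> y"
        using pr rq \<open>0 < \<eta>\<close> that by (auto simp: p_def q_def)
      have "g y = - \<alpha> * (\<eta> * Y p y) + ((\<alpha> + \<beta>) * (\<eta> * Y r y) - \<beta> * (\<eta> * Y q y))"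
        by (simp add: g_def)
      \<comment> \<open>Both \<open>y\<close> and the shift \<open>c\<close> drop out, since the
        coefficients -\<alpha>, \<alpha> + \<beta> and -\<beta> add up to 0.\<close>
      also have "\<dots> = \<alpha> * p - (\<alpha> + \<beta>) * r + \<beta> * q"
        unfolding Y1[OF y(1)] Y1[OF y(2)] Y1[OF y(3)] by (simp add: algebra_simps)
      finally show ?thesis using balance by simp
    qed
    show "-\<alpha> \<le> g' y" "g' y \<le> \<beta>" for y using bnd by auto
    show "g' y = -\<alpha>" if "2 * \<eta> \<le> y" "y \<le> r" for y
      using that \<open>r \<le> q\<close> by (simp add: g'_def Z0 Z1 p_def)
    show "g' y = \<beta>" if "r + \<eta> \<le> y" "y \<le> 1 - 2 * \<eta>" for y
      using that pr \<open>0 < \<eta>\<close> by (simp add: g'_def Z0 Z1 q_def)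
  qed
qed

text \<open>An increasing step times a reflected one. The bound \<open>D\<close> comes from
  compactness only; its size does not matter because the thinness of the model box will absorb
  it.\<close>

lemma cutoff_exists:
  fixes \<eta> :: real
  assumes "0 < \<eta>"
  obtains c c' :: "real \<Rightarrow> real" and D :: real where "smooth_fun c" "\<And>y. (c has_real_derivative c' y) (at y)"
    "\<And>y. y \<le> \<eta> \<or> 1 - \<eta> \<le> y \<Longrightarrow> c y = 0" "\<And>y. 0 \<le> c y" "\<And>y. c y \<le> 1"
    "\<And>y. 2 * \<eta> \<le> y \<Longrightarrow> y \<le> 1 - 2 * \<eta> \<Longrightarrow> c y = 1"
    "\<And>y. 2 * \<eta> < y \<Longrightarrow> y < 1 - 2 * \<eta> \<Longrightarrow> c' y = 0" "\<And>y. \<bar>c' y\<bar> \<le> D" "0 < D"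
proof -
  obtain \<sigma> \<Sigma> k where s: "smooth_fun \<sigma>" "smooth_fun \<Sigma>" "\<And>x. (\<Sigma> has_real_derivative \<sigma> x) (at x)"
    "\<And>x. x \<le> 0 \<Longrightarrow> \<sigma> x = 0" "\<And>x. 1 \<le> x \<Longrightarrow> \<sigma> x = 1" "\<And>x. 0 \<le> \<sigma> x" "\<And>x. \<sigma> x \<le> 1"
    "\<And>x. x \<le> 0 \<Longrightarrow> \<Sigma> x = 0" "\<And>x. 1 \<le> x \<Longrightarrow> \<Sigma> x = x - (k::real)"
    by (rule smooth_step_exists) (rule that)
  define c where "c y = \<sigma> ((1/\<eta>) * y + (-1)) * \<sigma> ((-1/\<eta>) * y + (1/\<eta> - 1))" for y
  have sc: "smooth_fun c"
    unfolding c_def[abs_def] by (intro smooth_mult smooth_compose_scale[OF s(1)])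
  define c' where "c' y = frechet_derivative c (at y) 1" for y
  have d: "(c has_real_derivative c' y) (at y)" for y
  proof (rule has_derivative_imp_has_field_derivative[OF smooth_has_derivative[OF sc]])
    have "linear (frechet_derivative c (at y))"
      using has_derivative_linear[OF smooth_has_derivative[OF sc]] .
    then show "x * c' y = frechet_derivative c (at y) x" for x
      using linear_cmul[of "frechet_derivative c (at y)" x 1] by (simp add: c'_def)
  qed
  have arg: "(1/\<eta>) * y + (-1) = (y - \<eta>) / \<eta>" "(-1/\<eta>) * y + (1/\<eta> - 1) = (1 - \<eta> - y) / \<eta>" for y
    using assms by (auto simp: field_simps)
  have c0: "c y = 0" if "y \<le> \<eta> \<or> 1 - \<eta> \<le> y" for y
  proof -
    have "(y - \<eta>) / \<eta> \<le> 0 \<or> (1 - \<eta> - y) / \<eta> \<le> 0"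
      using that assms by (auto simp: divide_nonpos_pos)
    then show ?thesis unfolding c_def arg using s(4) by auto
  qed
  have c1: "c y = 1" if "2 * \<eta> \<le> y" "y \<le> 1 - 2 * \<eta>" for y
  proof -
    have "1 \<le> (y - \<eta>) / \<eta>" "1 \<le> (1 - \<eta> - y) / \<eta>"
      using that assms by (auto simp: le_divide_eq)
    then show ?thesis unfolding c_def arg by (simp add: s(5))
  qed
  have c'z: "c' y = 0" if "open U" "y \<in> U" "\<And>z. z \<in> U \<Longrightarrow> c z = a" for y a U
  proof -
    have "(c has_real_derivative 0) (at y)"
      by (rule has_field_derivative_transform_within_open[OF DERIV_const[of a] that(1,2)]) (simp add: that(3))
    then show ?thesis using d DERIV_unique by blast
  qed
  have "continuous_on {0..1} c'"
    using smooth_continuous[OF smooth_frechet_derivative[OF sc]] unfolding c'_def[abs_def]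
    by (rule continuous_on_subset) simp
  then have "bounded (c' ` {0..1})"
    by (intro compact_imp_bounded compact_continuous_image) auto
  then obtain D where D: "0 < D" "\<And>y. y \<in> {0..1} \<Longrightarrow> \<bar>c' y\<bar> \<le> D"
    unfolding bounded_pos by auto
  have "\<bar>c' y\<bar> \<le> D" for y
  proof (cases "y \<in> {0..1}")
    case False
    then have "c' y = 0"
      using assms by (intro c'z[of "{..<0} \<union> {1<..}" y 0]) (auto intro!: c0)
    then show ?thesis using D by simp
  qed (simp add: D)
  moreover have "c' y = 0" if "2 * \<eta> < y" "y < 1 - 2 * \<eta>" for y
    by (rule c'z[of "{2*\<eta><..<1-2*\<eta>}" y 1]) (use that c1 in auto)
  moreover have "0 \<le> c y" "c y \<le> 1" for y
    using s(6,7) by (auto simp: c_def mult_le_one)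
  ultimately show thesis
    using that[OF sc d c0 _ _ c1] D(1) by blast
qed

section \<open>Test functions and partial derivatives\<close>

lemma pd_eq: "(f has_derivative D) (at x) \<Longrightarrow> pd f j x = D (axis j 1)"
  using frechet_derivative_at[of f D x] by (simp add: pd_def)

lemma test_funI:
  assumes "smooth_fun \<phi>" "compact K" "K \<subseteq> U" "\<And>x. x \<notin> K \<Longrightarrow> \<phi> x = 0"
  shows "test_fun U \<phi>"
proof -
  have "closure {x. \<phi> x \<noteq> 0} \<subseteq> K"
    using assms by (intro closure_minimal compact_imp_closed) auto
  then show ?thesis
    unfolding test_fun_def using assms compact_closure bounded_subset compact_imp_bounded
    by (metis (no_types, lifting) bounded_closure closed_closure compact_eq_bounded_closed order_trans)
qed

lemma test_fun_support:
  assumes "test_fun U \<phi>"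
  obtains K where "compact K" "K \<subseteq> U" "\<And>x. x \<notin> K \<Longrightarrow> \<phi> x = 0"
  using assms closure_subset[of "{x. \<phi> x \<noteq> 0}"] unfolding test_fun_def by blast

lemma test_fun_smooth: "test_fun U \<phi> \<Longrightarrow> smooth_fun \<phi>"
  by (simp add: test_fun_def)

lemma test_fun_mono: "test_fun U \<phi> \<Longrightarrow> U \<subseteq> V \<Longrightarrow> test_fun V \<phi>"
  by (auto simp: test_fun_def)

lemma test_fun_zero: "test_fun U (\<lambda>x. 0)"
  by (rule test_funI[of _ "{}"]) (auto simp: smooth_const)

lemma test_fun_add:
  assumes "test_fun U f" "test_fun U g"
  shows "test_fun U (\<lambda>x. f x + g x)"
proof -
  obtain K where K: "compact K" "K \<subseteq> U" "\<And>x. x \<notin> K \<Longrightarrow> f x = 0"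
    using test_fun_support[OF assms(1)] by blast
  obtain L where L: "compact L" "L \<subseteq> U" "\<And>x. x \<notin> L \<Longrightarrow> g x = 0"
    using test_fun_support[OF assms(2)] by blast
  show ?thesis
    by (rule test_funI[of _ "K \<union> L"])
       (use K L in \<open>auto intro!: compact_Un smooth_add assms[THEN test_fun_smooth]\<close>)
qed

lemma test_fun_sum: "(\<And>i. i \<in> I \<Longrightarrow> test_fun U (f i)) \<Longrightarrow> test_fun U (\<lambda>x. \<Sum>i\<in>I. f i x)"
  by (induction I rule: infinite_finite_induct) (auto intro: test_fun_add test_fun_zero)

lemma smooth_pd: "smooth_fun f \<Longrightarrow> smooth_fun (pd f j)"
  unfolding pd_def[abs_def] by (rule smooth_frechet_derivative)

lemma pd_const: "pd (\<lambda>x. c) j x = 0"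
  by (rule pd_eq[OF has_derivative_const, THEN trans]) simp

lemma pd_add: "smooth_fun f \<Longrightarrow> smooth_fun g \<Longrightarrow> pd (\<lambda>x. f x + g x) j x = pd f j x + pd g j x"
  using pd_eq[OF has_derivative_add[OF smooth_has_derivative smooth_has_derivative]]
  by (simp add: pd_def)

lemma pd_sum: "(\<And>i. i \<in> I \<Longrightarrow> smooth_fun (f i)) \<Longrightarrow> pd (\<lambda>x. \<Sum>i\<in>I. f i x) j x = (\<Sum>i\<in>I. pd (f i) j x)"
  by (induction I rule: infinite_finite_induct) (auto simp: pd_add smooth_sum pd_const)

lemma pd_cong_open:
  assumes "open V" "x \<in> V" "\<And>y. y \<in> V \<Longrightarrow> f y = g y" "smooth_fun g"
  shows "pd f j x = pd g j x"
proof -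
  have "(f has_derivative frechet_derivative g (at x)) (at x)"
    by (rule has_derivative_transform_within_open[OF smooth_has_derivative[OF assms(4)] assms(1,2)])
       (simp add: assms(3))
  then show ?thesis
    by (simp add: pd_eq pd_def[of g])
qed

lemma pd_outside:
  assumes "test_fun U \<phi>" "x \<notin> U"
  shows "pd \<phi> j x = 0"
proof -
  obtain K where K: "compact K" "K \<subseteq> U" "\<And>x. x \<notin> K \<Longrightarrow> \<phi> x = 0"
    using test_fun_support[OF assms(1)] by blast
  have "pd \<phi> j x = pd (\<lambda>x. 0) j x"
    by (rule pd_cong_open[of "- K"]) (use K assms in \<open>auto simp: smooth_const intro: compact_imp_closed\<close>)
  then show ?thesis by (simp add: pd_const)
qed

lemma test_fun_pd: 
  assumes "test_fun U \<phi>" shows "test_fun U (pd \<phi> j)"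
proof -
  obtain K where K: "compact K" "K \<subseteq> U" "\<And>x. x \<notin> K \<Longrightarrow> \<phi> x = 0"
    using test_fun_support[OF assms(1)] by blast
  then have "test_fun K \<phi>"
    using assms test_fun_smooth by (intro test_funI[of _ K]) auto
  then show ?thesis
    by (intro test_funI[OF smooth_pd K(1,2)]) (auto intro: test_fun_smooth pd_outside)
qed

lemma pd_prod:
  fixes h h' :: "'n::finite \<Rightarrow> real \<Rightarrow> real"
  assumes "\<And>l y. (h l has_real_derivative h' l y) (at y)"
  shows "pd (\<lambda>x. \<Prod>l\<in>UNIV. h l (x $ l)) k x = h' k (x $ k) * (\<Prod>l\<in>UNIV - {k}. h l (x $ l))"
proof -
  have "((\<lambda>x. h l (x $ l)) has_derivative (\<lambda>v. h' l (x $ l) * (v $ l))) (at x)" for l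
    by (rule has_derivative_compose[OF bounded_linear_imp_has_derivative[OF bounded_linear_vec_nth]])
       (use assms in \<open>simp add: has_field_derivative_def\<close>)
  then have "((\<lambda>x. \<Prod>l\<in>UNIV. h l (x $ l)) has_derivative
      (\<lambda>v. \<Sum>l\<in>UNIV. h' l (x $ l) * (v $ l) * (\<Prod>m\<in>UNIV - {l}. h m (x $ m)))) (at x)"
    by (intro has_derivative_prod)
  from pd_eq[OF this] show ?thesis
    by (simp add: axis_def if_distrib[of "\<lambda>y. _ * y * _"] cong: if_cong)
qed

lemma smooth_coord:
  assumes "smooth_fun (h::real \<Rightarrow> real)" shows "smooth_fun (\<lambda>x::real^'n. h (x $ l))"
  using smooth_compose_affine[OF bounded_linear_vec_nth[of l] assms, of 0] by simp

text \<open>The prefactor \<open>r\<close> compensates the inner derivative, so a homothetic copy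
  takes exactly the gradient values of the original. This allows one model to be used at all
  scales.\<close>

lemma pd_compose_scale:
  assumes "smooth_fun f" "r \<noteq> 0"
  shows "pd (\<lambda>x. r * f ((x - a) /\<^sub>R r)) j x = pd f j ((x - a) /\<^sub>R r)"
proof -
  have "((\<lambda>x. (x - a) /\<^sub>R r) has_derivative (\<lambda>v. v /\<^sub>R r)) (at x)"
    by (auto intro!: derivative_eq_intros)
  from has_derivative_compose[OF this smooth_has_derivative[OF assms(1)]]
  have "((\<lambda>x. r * f ((x - a) /\<^sub>R r)) has_derivative
      (\<lambda>v. r * frechet_derivative f (at ((x - a) /\<^sub>R r)) (v /\<^sub>R r))) (at x)"
    by (rule has_derivative_mult_right)
  from pd_eq[OF this] show ?thesis
    using linear_cmul[OF has_derivative_linear[OF smooth_has_derivative[OF assms(1)]]] assms(2)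
    by (simp add: pd_def)
qed

lemma smooth_compose_scaleR:
  "smooth_fun f \<Longrightarrow> smooth_fun (\<lambda>x. r * f ((x - a) /\<^sub>R r))"
  using smooth_mult[OF smooth_const smooth_compose_affine[of "\<lambda>x. x /\<^sub>R r" f "- (a /\<^sub>R r)"], of r]
  by (simp add: bounded_linear_scaleR_right scaleR_diff_right)

section \<open>The oscillating model on a thin box\<close>

lemma measure_box_cart:
  fixes a b :: "real^'n"
  assumes "\<And>i. a $ i \<le> b $ i"
  shows "vol (box a b) = (\<Prod>i\<in>UNIV. b $ i - a $ i)"
proof -
  have "vol (box a b) = measure lborel (cbox a b)"
    by (simp add: measure_completion measure_lborel_box_eq measure_lborel_cbox_eq)
  also have "\<dots> = (\<Prod>i\<in>UNIV. b $ i - a $ i)"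
    using assms by (intro content_cbox_cart) (auto simp: interval_ne_empty_cart)
  finally show ?thesis .
qed

text \<open>Every condition holds strictly in the limit \<eta> to 0 from the right, hence all hold
  together for some \<eta>. The two conditions without the power are obtained as the case of
  exponent 0. In the application \<open>k\<close> counts the transversal directions, each of which
  loses 4\<eta> to the cutoff.\<close>

lemma model_parameters_exist:
  fixes \<theta> \<epsilon> :: real
  assumes "0 < \<theta>" "\<theta> < 1" "0 < \<epsilon>"
  obtains \<eta> where "0 < \<eta>" "4 * \<eta> < 1" "\<eta> \<le> \<theta> * (1 - 3 * \<eta>)" "\<eta> \<le> (1 - \<theta>) * (1 - 3 * \<eta>)"
    "(1 - \<epsilon>) * \<theta> \<le> (\<theta> * (1 - 3 * \<eta>) - \<eta>) * (1 - 4 * \<eta>) ^ k"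
    "(1 - \<epsilon>) * (1 - \<theta>) \<le> ((1 - \<theta>) * (1 - 3 * \<eta>) - \<eta>) * (1 - 4 * \<eta>) ^ k"
proof -
  have lim: "((\<lambda>\<eta>. (t * (1 - 3 * \<eta>) - \<eta>) * (1 - 4 * \<eta>) ^ m) \<longlongrightarrow> (t * (1 - 3 * 0) - 0) * (1 - 4 * 0) ^ m) (at_right 0)"
    for t :: real and m
    by (intro tendsto_intros)
  have ev: "\<forall>\<^sub>F \<eta> in at_right 0. s < (t * (1 - 3 * \<eta>) - \<eta>) * (1 - 4 * \<eta>) ^ m" if "s < t" for s t :: real and m
    by (rule order_tendstoD(1)[OF lim]) (use that in simp)
  have l: "(1 - \<epsilon>) * t < t" if "0 < t" for t :: real
    using that assms by (simp add: algebra_simps)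
  have "\<forall>\<^sub>F \<eta> in at_right 0. \<eta> < 1/4 \<and> 0 < \<eta> \<and>
      (1 - \<epsilon>) * \<theta> < (\<theta> * (1 - 3 * \<eta>) - \<eta>) * (1 - 4 * \<eta>) ^ k \<and>
      (1 - \<epsilon>) * (1 - \<theta>) < ((1 - \<theta>) * (1 - 3 * \<eta>) - \<eta>) * (1 - 4 * \<eta>) ^ k \<and>
      0 < (\<theta> * (1 - 3 * \<eta>) - \<eta>) * (1 - 4 * \<eta>) ^ 0 \<and> 0 < ((1 - \<theta>) * (1 - 3 * \<eta>) - \<eta>) * (1 - 4 * \<eta>) ^ 0"
    by (intro eventually_conj ev l order_tendstoD(2)[OF tendsto_ident_at] eventually_at_right_less)
       (use assms in auto)
  then obtain \<eta> where "\<eta> < 1/4 \<and> 0 < \<eta> \<and>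
      (1 - \<epsilon>) * \<theta> < (\<theta> * (1 - 3 * \<eta>) - \<eta>) * (1 - 4 * \<eta>) ^ k \<and>
      (1 - \<epsilon>) * (1 - \<theta>) < ((1 - \<theta>) * (1 - 3 * \<eta>) - \<eta>) * (1 - 4 * \<eta>) ^ k \<and>
      0 < (\<theta> * (1 - 3 * \<eta>) - \<eta>) * (1 - 4 * \<eta>) ^ 0 \<and> 0 < ((1 - \<theta>) * (1 - 3 * \<eta>) - \<eta>) * (1 - 4 * \<eta>) ^ 0"
    using eventually_happens'[OF trivial_limit_at_right_real] by blast
  then show thesis
    by (intro that[of \<eta>]) auto
qed

text \<open>Thinness of the box in direction \<open>j\<close> makes the transversal derivatives small.\<close>

lemma thin_box_model:
  fixes j :: "'n::finite" and \<alpha> \<beta> \<epsilon> \<theta> :: real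
  assumes "0 < \<alpha>" "0 < \<beta>" "0 < \<epsilon>" and \<theta>_def: "\<theta> = \<alpha> / (\<alpha> + \<beta>)"
  obtains \<tau> w and S R :: "(real^'n) set"
  where "0 < \<tau>" "test_fun (box 0 (\<chi> l. if l = j then \<tau> else 1)) w" "open S" "open R"
    "S \<subseteq> box 0 (\<chi> l. if l = j then \<tau> else 1)" "R \<subseteq> box 0 (\<chi> l. if l = j then \<tau> else 1)" "S \<inter> R = {}"
    "\<And>x l. x \<in> S \<Longrightarrow> pd w l x = (if l = j then \<beta> else 0)"
    "\<And>x l. x \<in> R \<Longrightarrow> pd w l x = (if l = j then - \<alpha> else 0)"
    "\<And>x. - \<alpha> \<le> pd w j x" "\<And>x. pd w j x \<le> \<beta>" "\<And>x l. l \<noteq> j \<Longrightarrow> \<bar>pd w l x\<bar> \<le> \<epsilon>"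
    "(1 - \<epsilon>) * \<theta> * \<tau> \<le> vol S" "vol S \<le> \<theta> * \<tau>"
    "(1 - \<epsilon>) * (1 - \<theta>) * \<tau> \<le> vol R" "vol R \<le> (1 - \<theta>) * \<tau>"
proof -
  define k where "k = card (UNIV - {j})"
  have \<theta>: "0 < \<theta>" "\<theta> < 1" using assms by (auto simp: \<theta>_def)
  obtain \<eta> where \<eta>: "0 < \<eta>" "4 * \<eta> < 1" "\<eta> \<le> \<theta> * (1 - 3 * \<eta>)" "\<eta> \<le> (1 - \<theta>) * (1 - 3 * \<eta>)"
    "(1 - \<epsilon>) * \<theta> \<le> (\<theta> * (1 - 3 * \<eta>) - \<eta>) * (1 - 4 * \<eta>) ^ k"
    "(1 - \<epsilon>) * (1 - \<theta>) \<le> ((1 - \<theta>) * (1 - 3 * \<eta>) - \<eta>) * (1 - 4 * \<eta>) ^ k"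
    by (rule model_parameters_exist[OF \<theta> \<open>0 < \<epsilon>\<close>]) (rule that)
  define r where "r = \<eta> + (1 - \<theta>) * (1 - 3 * \<eta>)"
  obtain g g' where g: "smooth_fun g" "\<And>y. (g has_real_derivative g' y) (at y)"
    "\<And>y. y \<le> \<eta> \<or> 1 - \<eta> \<le> y \<Longrightarrow> g y = 0" "\<And>y. -\<alpha> \<le> g' y" "\<And>y. g' y \<le> \<beta>"
    "\<And>y. 2 * \<eta> \<le> y \<Longrightarrow> y \<le> r \<Longrightarrow> g' y = - \<alpha>"
    "\<And>y. r + \<eta> \<le> y \<Longrightarrow> y \<le> 1 - 2 * \<eta> \<Longrightarrow> g' y = \<beta>"
    by (rule tent_exists[OF assms(1,2) \<eta>(1) \<theta>_def \<eta>(3,4) r_def]) (rule that)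
  obtain c c' D where c: "smooth_fun c" "\<And>y. (c has_real_derivative c' y) (at y)"
    "\<And>y. y \<le> \<eta> \<or> 1 - \<eta> \<le> y \<Longrightarrow> c y = 0" "\<And>y. 0 \<le> c y" "\<And>y. c y \<le> 1"
    "\<And>y. 2 * \<eta> \<le> y \<Longrightarrow> y \<le> 1 - 2 * \<eta> \<Longrightarrow> c y = 1"
    "\<And>y. 2 * \<eta> < y \<Longrightarrow> y < 1 - 2 * \<eta> \<Longrightarrow> c' y = 0" "\<And>y. \<bar>c' y\<bar> \<le> D" "0 < D"
    by (rule cutoff_exists[OF \<eta>(1)]) (rule that)
  have "bounded (g ` {0..1})"
    using smooth_continuous[OF g(1)]
    by (intro compact_imp_bounded compact_continuous_image) (auto intro: continuous_on_subset)
  then obtain G where G: "0 < G" "\<And>y. y \<in> {0..1} \<Longrightarrow> \<bar>g y\<bar> \<le> G"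
    unfolding bounded_pos by auto
  have G': "\<bar>g y\<bar> \<le> G" for y
    using G g(3)[of y] \<eta>(1,2) by (cases "y \<in> {0..1}") auto
  \<comment> \<open>A transversal derivative is a derivative of the cutoff times the profile of
    height at most \<tau> G, hence at most \<tau> G D, which this choice makes equal to
    \<epsilon>.\<close>
  define \<tau> where "\<tau> = \<epsilon> / (G * D)"
  have \<tau>: "0 < \<tau>" using G c(9) assms by (simp add: \<tau>_def)
  \<comment> \<open>The profile is compressed to length \<tau> in both directions of its graph, so
    its slopes survive; the other factors are plateaus.\<close>
  define h where "h l y = (if l = j then \<tau> * g ((1/\<tau>) * y + 0) else c y)" for l :: 'n and y
  define h' where "h' l y = (if l = j then g' ((1/\<tau>) * y + 0) else c' y)" for l :: 'n and y
  have hd: "(h l has_real_derivative h' l y) (at y)" for l y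
  proof (cases "l = j")
    case True
    have "((\<lambda>y. g ((1/\<tau>) * y + 0)) has_real_derivative g' ((1/\<tau>) * y + 0) * (1/\<tau>)) (at y)"
      by (rule DERIV_chain2[OF g(2)]) (use \<tau> in \<open>auto intro!: derivative_eq_intros\<close>)
    from DERIV_cmult[OF this, of \<tau>] show ?thesis
      using True \<tau> by (simp add: h_def[abs_def] h'_def)
  next
    case False
    then show ?thesis using c(2) by (simp add: h_def[abs_def] h'_def)
  qed
  have hs: "smooth_fun (h l)" for l
    using smooth_mult[OF smooth_const smooth_compose_scale[OF g(1)], of \<tau> "1/\<tau>" 0] c(1)
    by (cases "l = j") (simp_all add: h_def[abs_def])
  define w where "w x = (\<Prod>l\<in>UNIV. h l (x $ l))" for x :: "real^'n"
  have pdw: "pd w l x = h' l (x $ l) * (\<Prod>m\<in>UNIV - {l}. h m (x $ m))" for l x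
    unfolding w_def[abs_def] by (rule pd_prod[OF hd])
  define Q :: "(real^'n) set" where "Q = box 0 (\<chi> l. if l = j then \<tau> else 1)"
  define s where "s l = (if l = j then \<tau> else 1)" for l :: 'n
  have s: "0 < s l" for l using \<tau> by (simp add: s_def)
  have tw: "test_fun Q w"
  proof (rule test_funI)
    show "smooth_fun w"
      unfolding w_def[abs_def] by (rule smooth_prod) (rule smooth_coord[OF hs])
    show "compact (cbox (\<chi> l. \<eta> * s l) (\<chi> l. (1 - \<eta>) * s l))" by simp
    show "cbox (\<chi> l. \<eta> * s l) (\<chi> l. (1 - \<eta>) * s l) \<subseteq> Q"
    proof
      fix x assume x: "x \<in> cbox (\<chi> l. \<eta> * s l) (\<chi> l. (1 - \<eta>) * s l)"
      have "0 < x $ l" "x $ l < s l" for l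
      proof -
        have "0 < \<eta> * s l" using s \<eta>(1) by simp
        moreover have "\<eta> * s l \<le> x $ l" "x $ l \<le> s l - \<eta> * s l"
          using x by (simp_all add: mem_box_cart left_diff_distrib)
        ultimately show "0 < x $ l" "x $ l < s l" by linarith+
      qed
      then show "x \<in> Q"
        unfolding Q_def by (simp add: mem_box_cart s_def)
    qed
    show "w x = 0" if x: "x \<notin> cbox (\<chi> l. \<eta> * s l) (\<chi> l. (1 - \<eta>) * s l)" for x
    proof -
      obtain l where l: "x $ l < \<eta> * s l \<or> (1 - \<eta>) * s l < x $ l"
        using x unfolding mem_box_cart by (auto simp: not_le)
      have "h l (x $ l) = 0"
      proof (cases "l = j")
        case True
        have "x $ l / \<tau> \<le> \<eta> \<or> 1 - \<eta> \<le> x $ l / \<tau>"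
          using l \<tau> True by (auto simp: s_def pos_divide_le_eq pos_le_divide_eq)
        from g(3)[OF this] True show ?thesis by (simp add: h_def)
      next
        case False
        then show ?thesis using l c(3)[of "x $ l"] by (auto simp: h_def s_def)
      qed
      then show ?thesis unfolding w_def by (auto intro!: prod_zero)
    qed
  qed
  have prodc: "\<bar>\<Prod>m\<in>A. h m (x $ m)\<bar> \<le> 1" "0 \<le> (\<Prod>m\<in>A. h m (x $ m))" if "j \<notin> A" for A x
  proof -
    have "h m (x $ m) = c (x $ m)" if "m \<in> A" for m using \<open>j \<notin> A\<close> that by (auto simp: h_def)
    then have "(\<Prod>m\<in>A. h m (x $ m)) = (\<Prod>m\<in>A. c (x $ m))" by simp
    moreover have "0 \<le> (\<Prod>m\<in>A. c (x $ m))" "(\<Prod>m\<in>A. c (x $ m)) \<le> 1"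
      using c(4,5) by (auto intro!: prod_nonneg prod_le_1)
    ultimately show "\<bar>\<Prod>m\<in>A. h m (x $ m)\<bar> \<le> 1" "0 \<le> (\<Prod>m\<in>A. h m (x $ m))" by auto
  qed
  have jb: "- \<alpha> \<le> pd w j x \<and> pd w j x \<le> \<beta>" for x
  proof -
    define P where "P = (\<Prod>m\<in>UNIV - {j}. h m (x $ m))"
    have P: "0 \<le> P" "P \<le> 1" using prodc[of "UNIV - {j}" x] by (auto simp: P_def)
    define z where "z = g' ((1/\<tau>) * (x $ j) + 0)"
    have z: "- \<alpha> \<le> z" "z \<le> \<beta>" using g(4,5) by (auto simp: z_def)
    have "- \<alpha> \<le> - \<alpha> * P" "- \<alpha> * P \<le> z * P" "z * P \<le> \<beta> * P" "\<beta> * P \<le> \<beta>"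
      using P z assms(1,2) by (auto intro: mult_right_mono mult_left_le mult_right_mono[of "- \<alpha>" z P, simplified])
    then show ?thesis unfolding pdw P_def[symmetric] by (simp add: h'_def z_def)
  qed
  have lb: "\<bar>pd w l x\<bar> \<le> \<epsilon>" if "l \<noteq> j" for l x
  proof -
    define P where "P = (\<Prod>m\<in>UNIV - {l} - {j}. h m (x $ m))"
    have "(\<Prod>m\<in>UNIV - {l}. h m (x $ m)) = h j (x $ j) * P"
      unfolding P_def using that by (intro prod.remove) auto
    then have "\<bar>pd w l x\<bar> = \<bar>c' (x $ l)\<bar> * ((\<tau> * \<bar>g ((1/\<tau>) * (x $ j) + 0)\<bar>) * \<bar>P\<bar>)"
      unfolding pdw using that \<tau> by (simp add: h_def h'_def abs_mult)
    also have "\<dots> \<le> D * ((\<tau> * G) * 1)"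
      using prodc(1)[of "UNIV - {l} - {j}" x] G' c(8,9) \<tau> G(1)
      by (intro mult_mono) (auto simp: P_def)
    also have "\<dots> = \<epsilon>" using G c(9) by (simp add: \<tau>_def)
    finally show ?thesis .
  qed
  \<comment> \<open>In the box from \<open>lo u\<close> to \<open>hi v\<close> all plateaus equal 1
    and \<open>x $ j / \<tau>\<close> runs from u to v. If the profile has constant slope between u
    and v, the gradient there is exact.\<close>
  define lo hi :: "real \<Rightarrow> real^'n" where "lo u = (\<chi> l. if l = j then \<tau> * u else 2 * \<eta>)"
    and "hi u = (\<chi> l. if l = j then \<tau> * u else 1 - 2 * \<eta>)" for u
  have rb: "2 * \<eta> \<le> r" "r + \<eta> \<le> 1 - 2 * \<eta>"
    using \<eta> by (auto simp: r_def algebra_simps)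
  have grad: "pd w l x = (if l = j then b else 0)"
    if "x \<in> box (lo u) (hi v)" "\<And>y. u < y \<Longrightarrow> y < v \<Longrightarrow> g' y = b" for x u v b l
  proof -
    have x: "2 * \<eta> < x $ m" "x $ m < 1 - 2 * \<eta>" if "m \<noteq> j" for m
      using \<open>x \<in> _\<close> that by (auto simp: mem_box_cart lo_def hi_def dest!: spec[of _ m])
    have "\<tau> * u < x $ j" "x $ j < \<tau> * v"
      using \<open>x \<in> _\<close> by (auto simp: mem_box_cart lo_def hi_def dest!: spec[of _ j])
    then have "u < (1/\<tau>) * (x $ j)" "(1/\<tau>) * (x $ j) < v"
      using \<tau> by (auto simp: field_simps)
    then have "g' ((1/\<tau>) * (x $ j) + 0) = b"
      using that(2)[of "(1/\<tau>) * (x $ j)"] by simp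
    moreover have "(\<Prod>m\<in>UNIV - {j}. h m (x $ m)) = 1"
      using x c(6) by (intro prod.neutral) (auto simp: h_def less_imp_le)
    moreover have "h' l (x $ l) = 0" if "l \<noteq> j"
      using that x c(7) by (simp add: h'_def)
    ultimately show ?thesis
      unfolding pdw by (auto simp: h'_def)
  qed
  have sub: "box (lo u) (hi v) \<subseteq> Q" if "0 \<le> u" "v \<le> 1" for u v
  proof -
    have "0 \<le> \<tau> * u" "\<tau> * v \<le> \<tau>"
      using that \<tau> mult_left_le[of v \<tau>] by auto
    then show ?thesis
      unfolding Q_def using \<eta>(1) by (intro subset_box_imp) (auto simp: lo_def hi_def Basis_vec_def inner_axis)
  qed
  have mes: "vol (box (lo u) (hi v)) = \<tau> * (v - u) * (1 - 4 * \<eta>) ^ k" if "u \<le> v" for u v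
  proof -
    have "vol (box (lo u) (hi v)) = (\<Prod>i\<in>UNIV. hi v $ i - lo u $ i)"
      using that \<tau> \<eta>(1,2) by (intro measure_box_cart) (auto simp: lo_def hi_def)
    also have "\<dots> = (hi v $ j - lo u $ j) * (\<Prod>i\<in>UNIV - {j}. hi v $ i - lo u $ i)"
      by (intro prod.remove) auto
    also have "(\<Prod>i\<in>UNIV - {j}. hi v $ i - lo u $ i) = (\<Prod>i\<in>UNIV - {j}. 1 - 4 * \<eta>)"
      by (intro prod.cong) (auto simp: lo_def hi_def)
    finally show ?thesis
      by (simp add: k_def lo_def hi_def algebra_simps)
  qed
  have p1: "0 \<le> (1 - 4 * \<eta>) ^ k" "(1 - 4 * \<eta>) ^ k \<le> 1" using \<eta>(1,2) by (auto intro: power_le_one)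
  have up: "\<tau> * (t * (1 - 3 * \<eta>) - \<eta>) * (1 - 4 * \<eta>) ^ k \<le> t * \<tau>"
    if "0 \<le> t" "\<eta> \<le> t * (1 - 3 * \<eta>)" for t
  proof -
    have "t * (1 - 3 * \<eta>) - \<eta> \<le> t" using that(1) \<eta>(1) by (simp add: algebra_simps add_increasing)
    then have "(t * (1 - 3 * \<eta>) - \<eta>) * (1 - 4 * \<eta>) ^ k \<le> t * 1"
      using p1 that by (intro mult_mono) auto
    then show ?thesis using \<tau> by (simp add: mult.assoc mult.commute[of t])
  qed
  show thesis
  proof (rule that[of \<tau> w "box (lo (r + \<eta>)) (hi (1 - 2 * \<eta>))" "box (lo (2 * \<eta>)) (hi r)"])
    show "box (lo (r + \<eta>)) (hi (1 - 2 * \<eta>)) \<inter> box (lo (2 * \<eta>)) (hi r) = {}"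
    proof -
      have "False" if "x \<in> box (lo (r + \<eta>)) (hi (1 - 2 * \<eta>))" "x \<in> box (lo (2 * \<eta>)) (hi r)" for x
      proof -
        have "\<tau> * (r + \<eta>) < x $ j" "x $ j < \<tau> * r"
          using that by (auto simp: mem_box_cart lo_def hi_def dest!: spec[of _ j])
        then show False using \<tau> \<eta>(1) by (simp add: algebra_simps) (smt (verit) mult_pos_pos)
      qed
      then show ?thesis by blast
    qed
    have eq: "1 - 2 * \<eta> - (r + \<eta>) = \<theta> * (1 - 3 * \<eta>) - \<eta>" "r - 2 * \<eta> = (1 - \<theta>) * (1 - 3 * \<eta>) - \<eta>"
      by (auto simp: r_def algebra_simps)
    show "vol (box (lo (r + \<eta>)) (hi (1 - 2 * \<eta>))) \<le> \<theta> * \<tau>"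
      unfolding mes[OF rb(2)] eq using up[of \<theta>] \<theta> \<eta>(3) by simp
    show "vol (box (lo (2 * \<eta>)) (hi r)) \<le> (1 - \<theta>) * \<tau>"
      unfolding mes[OF rb(1)] eq using up[of "1 - \<theta>"] \<theta> \<eta>(4) by simp
    show "(1 - \<epsilon>) * \<theta> * \<tau> \<le> vol (box (lo (r + \<eta>)) (hi (1 - 2 * \<eta>)))"
      unfolding mes[OF rb(2)] eq using mult_right_mono[OF \<eta>(5), of \<tau>] \<tau> by (simp add: mult_ac)
    show "(1 - \<epsilon>) * (1 - \<theta>) * \<tau> \<le> vol (box (lo (2 * \<eta>)) (hi r))"
      unfolding mes[OF rb(1)] eq using mult_right_mono[OF \<eta>(6), of \<tau>] \<tau> by (simp add: mult_ac)
    show "box (lo (r + \<eta>)) (hi (1 - 2 * \<eta>)) \<subseteq> box 0 (\<chi> l. if l = j then \<tau> else 1)"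
      "box (lo (2 * \<eta>)) (hi r) \<subseteq> box 0 (\<chi> l. if l = j then \<tau> else 1)"
      using sub[unfolded Q_def] rb \<eta>(1) by auto
  qed (use \<tau> tw jb lb grad g(6,7) in \<open>auto simp: Q_def less_imp_le\<close>)
qed

section \<open>Exhaustion by homothetic boxes\<close>

lemma image_affinity_box_pos:
  fixes u :: "real^'n"
  assumes "0 < \<rho>"
  shows "(\<lambda>y. \<rho> *\<^sub>R y + u) ` box 0 b = box u (\<rho> *\<^sub>R b + u)"
proof (intro set_eqI iffI)
  fix x assume "x \<in> (\<lambda>y. \<rho> *\<^sub>R y + u) ` box 0 b"
  then show "x \<in> box u (\<rho> *\<^sub>R b + u)"
    using assms by (auto simp: mem_box_cart)
next
  fix x assume x: "x \<in> box u (\<rho> *\<^sub>R b + u)"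
  have "(x - u) /\<^sub>R \<rho> \<in> box 0 b"
    using x assms by (auto simp: mem_box_cart divide_simps less_diff_eq diff_less_eq algebra_simps)
  then show "x \<in> (\<lambda>y. \<rho> *\<^sub>R y + u) ` box 0 b"
    using assms by (intro image_eqI[of _ _ "(x - u) /\<^sub>R \<rho>"]) auto
qed

text \<open>Dyadic subdivision of a large box with the proportions of \<open>b\<close> produces only
  homothetic copies of that box, and the covering lemma selects such cells with union
  \<open>S\<close>. Interiors are disjoint and have the same volume as the closed cells; finitely
  many of them already carry almost all of the volume.\<close>

lemma homothetic_box_exhaustion:
  fixes S :: "(real^'n) set" and b :: "real^'n"
  assumes "open S" "bounded S" and b: "\<And>i. 0 < b $ i" and "0 < e"
  obtains D :: "(real^'n) set set" and \<rho> :: "(real^'n) set \<Rightarrow> real" and u :: "(real^'n) set \<Rightarrow> real^'n"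
  where "finite D" "\<And>K. K \<in> D \<Longrightarrow> 0 < \<rho> K"
    "\<And>K. K \<in> D \<Longrightarrow> (\<lambda>y. \<rho> K *\<^sub>R y + u K) ` box 0 b \<subseteq> S"
    "\<And>K L. K \<in> D \<Longrightarrow> L \<in> D \<Longrightarrow> K \<noteq> L \<Longrightarrow>
      (\<lambda>y. \<rho> K *\<^sub>R y + u K) ` box 0 b \<inter> (\<lambda>y. \<rho> L *\<^sub>R y + u L) ` box 0 b = {}"
    "vol S - e \<le> (\<Sum>K\<in>D. vol ((\<lambda>y. \<rho> K *\<^sub>R y + u K) ` box 0 b))"
    "(\<Sum>K\<in>D. vol ((\<lambda>y. \<rho> K *\<^sub>R y + u K) ` box 0 b)) \<le> vol S"
proof -
  obtain r where r: "0 < r" "\<And>x. x \<in> S \<Longrightarrow> norm x \<le> r"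
    using \<open>bounded S\<close> unfolding bounded_pos by blast
  define m where "m = Min (range (($) b))"
  have m: "0 < m" "\<And>i. m \<le> b $ i"
  proof -
    have "m \<in> range (($) b)" unfolding m_def by (intro Min_in) auto
    then obtain i where "m = b $ i" by blast
    with b show "0 < m" by simp
    show "m \<le> b $ i" for i unfolding m_def by (intro Min_le) auto
  qed
  define a :: "real^'n" where "a = (\<chi> i. - r)"
  \<comment> \<open>\<open>S\<close> lies in the cube of half side \<open>r\<close>, and with this
    factor even the shortest side of \<open>R *\<^sub>R b\<close> has length 2r.\<close>
  define R where "R = 2 * r / m"
  have R: "0 < R" using r m by (simp add: R_def)
  have "S \<subseteq> cbox a (a + R *\<^sub>R b)"
  proof
    fix x assume "x \<in> S"
    have "- r \<le> x $ i" "x $ i \<le> - r + R * b $ i" for i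
    proof -
      have "\<bar>x $ i\<bar> \<le> r"
        using component_le_norm_cart[of x i] r(2)[OF \<open>x \<in> S\<close>] by linarith
      moreover have "2 * r \<le> R * b $ i"
        using mult_left_mono[OF m(2)[of i], of R] R m(1) by (simp add: R_def)
      ultimately show "- r \<le> x $ i" "x $ i \<le> - r + R * b $ i" by linarith+
    qed
    then show "x \<in> cbox a (a + R *\<^sub>R b)"
      by (simp add: mem_box_cart a_def)
  qed
  moreover have "box a (a + R *\<^sub>R b) \<noteq> {}"
    using b R by (simp add: interval_ne_empty_cart)
  \<comment> \<open>This gauge forces every selected cell, which has a tag in \<open>S\<close>, to
    lie inside \<open>S\<close>.\<close>
  moreover have "gauge (\<lambda>x. if x \<in> S then S else UNIV)"
    using \<open>open S\<close> by (auto simp: gauge_def)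
  ultimately obtain \<D> where \<D>: "countable \<D>" "\<Union>\<D> \<subseteq> cbox a (a + R *\<^sub>R b)"
    "\<And>K. K \<in> \<D> \<Longrightarrow> interior K \<noteq> {} \<and> (\<exists>c d. K = cbox c d)"
    "pairwise (\<lambda>A B. interior A \<inter> interior B = {}) \<D>"
    "\<And>K. K \<in> \<D> \<Longrightarrow> \<exists>x \<in> S \<inter> K. K \<subseteq> (if x \<in> S then S else UNIV)"
    "\<And>u v. cbox u v \<in> \<D> \<Longrightarrow> \<exists>n. \<forall>i \<in> Basis. v \<bullet> i - u \<bullet> i = ((a + R *\<^sub>R b) \<bullet> i - a \<bullet> i) / 2^n"
    "S \<subseteq> \<Union>\<D>"
    by (rule covering_lemma) (rule that)
  have KS: "K \<subseteq> S" if "K \<in> \<D>" for K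
    using \<D>(5)[OF that] by auto
  then have US: "\<Union>\<D> = S" using \<D>(7) by blast
  have "\<exists>\<rho> u. 0 < \<rho> \<and> K = cbox u (\<rho> *\<^sub>R b + u)" if "K \<in> \<D>" for K
  proof -
    obtain u v where K: "K = cbox u v" using \<D>(3)[OF \<open>K \<in> \<D>\<close>] by blast
    then obtain n where n: "\<forall>i \<in> Basis. v \<bullet> i - u \<bullet> i = ((a + R *\<^sub>R b) \<bullet> i - a \<bullet> i) / 2^n"
      using \<D>(6) \<open>K \<in> \<D>\<close> by blast
    have "v = (R / 2^n) *\<^sub>R b + u"
    proof (rule euclidean_eqI)
      fix i :: "real^'n" assume "i \<in> Basis"
      with n show "v \<bullet> i = ((R / 2^n) *\<^sub>R b + u) \<bullet> i"
        by (auto simp: inner_simps algebra_simps dest: bspec)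
    qed
    then show ?thesis
      using K R by (intro exI[of _ "R / 2^n"] exI[of _ u]) auto
  qed
  then obtain \<rho> u where K: "\<And>K. K \<in> \<D> \<Longrightarrow> 0 < \<rho> K" "\<And>K. K \<in> \<D> \<Longrightarrow> K = cbox (u K) (\<rho> K *\<^sub>R b + u K)"
    by metis
  define I where "I K = (\<lambda>y. \<rho> K *\<^sub>R y + u K) ` box 0 b" for K
  have I: "I K = interior K" if "K \<in> \<D>" for K
  proof -
    have "interior K = box (u K) (\<rho> K *\<^sub>R b + u K)"
      using interior_cbox[of "u K" "\<rho> K *\<^sub>R b + u K"] K(2)[OF that] by metis
    then show ?thesis unfolding I_def using image_affinity_box_pos[OF K(1)[OF that]] by metis
  qed
  have mI: "vol (I K) = vol K" if "K \<in> \<D>" for K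
  proof -
    have "vol (box (u K) (\<rho> K *\<^sub>R b + u K)) = vol (cbox (u K) (\<rho> K *\<^sub>R b + u K))"
      by (simp add: measure_lborel_box_eq measure_lborel_cbox_eq)
    then show ?thesis
      using K(2)[OF that] unfolding I_def image_affinity_box_pos[OF K(1)[OF that]] by metis
  qed
  have fm: "K \<in> lmeasurable" if "K \<in> \<D>" for K
    using K(2)[OF that] lmeasurable_cbox by metis
  have fS: "S \<in> lmeasurable" using assms by (simp add: lmeasurable_open)
  have bd: "vol (\<Union>D) \<le> vol S" if "D \<subseteq> \<D>" "finite D" for D
  proof (rule measure_mono_fmeasurable[OF _ _ fS])
    have "D \<subseteq> sets lebesgue" using that(1) fm fmeasurableD by blast
    then show "\<Union>D \<in> sets lebesgue" using that(2) by blast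
  qed (use that KS in auto)
  obtain D where D: "D \<subseteq> \<D>" "finite D" "vol (\<Union>\<D>) - e < vol (\<Union>D)"
    by (rule measure_countable_Union_approachable[OF \<D>(1) \<open>0 < e\<close>]) (erule fm, erule (1) bd, erule (2) that)
  have disj: "I K \<inter> I L = {}" if "K \<in> D" "L \<in> D" "K \<noteq> L" for K L
    using \<D>(4) that D(1) I unfolding pairwise_def by blast
  have fI: "I K \<in> lmeasurable" if "K \<in> D" for K
    using I[of K] that D(1) fm K(2) by (metis bounded_cbox lmeasurable_interior subsetD)
  have IS: "I K \<subseteq> S" if "K \<in> D" for K
    using I[of K] that D(1) KS[of K] interior_subset[of K] by blast
  have "(\<Sum>K\<in>D. vol (I K)) = vol (\<Union>K\<in>D. I K)"
    using D(2) fI disj by (intro measure_UNION'[symmetric]) (auto simp: pairwise_def disjnt_def)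
  also have "\<dots> \<le> vol S"
    using D(2) fI IS fS by (intro measure_mono_fmeasurable) (auto intro!: fmeasurable.finite_UN)
  finally have up: "(\<Sum>K\<in>D. vol (I K)) \<le> vol S" .
  have "vol (\<Union>D) \<le> (\<Sum>K\<in>D. vol K)"
    using measure_UNION_le[OF D(2), of "\<lambda>K. K" lebesgue] D(1) fm by (auto dest: fmeasurableD)
  also have "\<dots> = (\<Sum>K\<in>D. vol (I K))"
    using D(1) mI by (intro sum.cong) auto
  finally have low: "vol S - e \<le> (\<Sum>K\<in>D. vol (I K))"
    using D(3) US by simp
  show thesis
    by (rule that[of D \<rho> u]) (use D K(1) IS disj low up in \<open>auto simp: I_def\<close>)
qed

text \<open>Disjoint homothetic copies of the model fill \<open>S\<close> up to small measure. Each
  copy keeps the gradient values, so the pointwise bounds pass to the sum of the copies, and the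
  volume fractions of the model become fractions of \<open>S\<close>.\<close>

lemma gradient_split:
  fixes S :: "(real^'n) set" and j :: 'n and \<alpha> \<beta> \<epsilon> \<theta> :: real
  assumes "open S" "bounded S" "0 < \<alpha>" "0 < \<beta>" "0 < \<epsilon>" "\<epsilon> \<le> 1"
    and \<theta>_def: "\<theta> = \<alpha> / (\<alpha> + \<beta>)"
  obtains w and S' R :: "(real^'n) set"
  where "test_fun S w" "open S'" "open R" "S' \<subseteq> S" "R \<subseteq> S" "S' \<inter> R = {}"
    "\<And>x l. x \<in> S' \<Longrightarrow> pd w l x = (if l = j then \<beta> else 0)"
    "\<And>x l. x \<in> R \<Longrightarrow> pd w l x = (if l = j then - \<alpha> else 0)"
    "\<And>x. - \<alpha> \<le> pd w j x" "\<And>x. pd w j x \<le> \<beta>" "\<And>x l. l \<noteq> j \<Longrightarrow> \<bar>pd w l x\<bar> \<le> \<epsilon>"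
    "(1 - \<epsilon>) * \<theta> * vol S \<le> vol S'" "vol S' \<le> \<theta> * vol S"
    "(1 - \<epsilon>) * (1 - \<theta>) * vol S \<le> vol R" "vol R \<le> (1 - \<theta>) * vol S"
proof -
  \<comment> \<open>A factor 1 - e is lost twice, inside the model and in the exhaustion, and the
    square of 1 - e is at least 1 - \<epsilon>.\<close>
  define e where "e = \<epsilon> / 2"
  have e: "0 < e" "e \<le> \<epsilon>" "e \<le> 1" using assms by (auto simp: e_def)
  have \<theta>: "0 < \<theta>" "\<theta> < 1" using assms by (auto simp: \<theta>_def)
  obtain \<tau> w0 and S0 R0 :: "(real^'n) set" where 
    model: "0 < \<tau>" "test_fun (box 0 (\<chi> l. if l = j then \<tau> else 1)) w0" "open S0" "open R0"
    "S0 \<subseteq> box 0 (\<chi> l. if l = j then \<tau> else 1)" "R0 \<subseteq> box 0 (\<chi> l. if l = j then \<tau> else 1)" "S0 \<inter> R0 = {}"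
    "\<And>x l. x \<in> S0 \<Longrightarrow> pd w0 l x = (if l = j then \<beta> else 0)"
    "\<And>x l. x \<in> R0 \<Longrightarrow> pd w0 l x = (if l = j then - \<alpha> else 0)"
    "\<And>x. - \<alpha> \<le> pd w0 j x" "\<And>x. pd w0 j x \<le> \<beta>" "\<And>x l. l \<noteq> j \<Longrightarrow> \<bar>pd w0 l x\<bar> \<le> e"
    "(1 - e) * \<theta> * \<tau> \<le> vol S0" "vol S0 \<le> \<theta> * \<tau>"
    "(1 - e) * (1 - \<theta>) * \<tau> \<le> vol R0" "vol R0 \<le> (1 - \<theta>) * \<tau>"
    by (rule thin_box_model[OF assms(3,4) e(1) \<theta>_def, where j = j]) (rule that)
  define b :: "real^'n" where "b = (\<chi> l. if l = j then \<tau> else 1)"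
  have b: "0 < b $ i" for i using model(1) by (simp add: b_def)
  have mb: "vol (box 0 b) = \<tau>"
  proof -
    have "vol (box 0 b) = (\<Prod>i\<in>UNIV. b $ i)"
      using b by (subst measure_box_cart) (auto simp: less_imp_le)
    also have "\<dots> = \<tau>" by (simp add: b_def prod.delta)
    finally show ?thesis .
  qed
  define M where "M = vol S"
  \<comment> \<open>The exhaustion requires a positive error. For a null set the relative error
    would be 0, so 1 is taken; the lower bound on the filled volume is then trivial.\<close>
  define e' where "e' = (if M = 0 then 1 else e * M)"
  have M: "0 \<le> M" by (simp add: M_def)
  have e': "0 < e'" using e M by (simp add: e'_def)
  obtain D :: "(real^'n) set set" and \<rho> u where D: "finite D" "\<And>K. K \<in> D \<Longrightarrow> 0 < \<rho> K"
    "\<And>K. K \<in> D \<Longrightarrow> (\<lambda>y. \<rho> K *\<^sub>R y + u K) ` box 0 b \<subseteq> S"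
    "\<And>K L. K \<in> D \<Longrightarrow> L \<in> D \<Longrightarrow> K \<noteq> L \<Longrightarrow>
      (\<lambda>y. \<rho> K *\<^sub>R y + u K) ` box 0 b \<inter> (\<lambda>y. \<rho> L *\<^sub>R y + u L) ` box 0 b = {}"
    "M - e' \<le> (\<Sum>K\<in>D. vol ((\<lambda>y. \<rho> K *\<^sub>R y + u K) ` box 0 b))"
    "(\<Sum>K\<in>D. vol ((\<lambda>y. \<rho> K *\<^sub>R y + u K) ` box 0 b)) \<le> M"
    by (rule homothetic_box_exhaustion[OF assms(1,2) b e', folded M_def]) (rule that)
  define T where "T K X = (\<lambda>y. \<rho> K *\<^sub>R y + u K) ` X" for K and X :: "(real^'n) set"
  define wK where "wK K x = \<rho> K * w0 ((x - u K) /\<^sub>R \<rho> K)" for K x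
  define w where "w x = (\<Sum>K\<in>D. wK K x)" for x
  have memT: "x \<in> T K X \<longleftrightarrow> (x - u K) /\<^sub>R \<rho> K \<in> X" if "K \<in> D" for K X x
  proof
    assume "x \<in> T K X"
    then show "(x - u K) /\<^sub>R \<rho> K \<in> X" using D(2)[OF that] by (auto simp: T_def)
  next
    assume "(x - u K) /\<^sub>R \<rho> K \<in> X"
    then show "x \<in> T K X"
      unfolding T_def using D(2)[OF that] by (intro image_eqI[of _ _ "(x - u K) /\<^sub>R \<rho> K"]) auto
  qed
  have openT: "open (T K X)" if "K \<in> D" "open X" for K X
    using open_affinity[OF that(2), of "\<rho> K" "u K"] D(2)[OF that(1)] by (simp add: T_def add.commute)
  have TS: "T K (box 0 b) \<subseteq> S" if "K \<in> D" for K using D(3)[OF that] by (simp add: T_def)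
  have Tmono: "T K X \<subseteq> T K Y" if "X \<subseteq> Y" for K X Y using that by (auto simp: T_def)
  have Tdisj: "T K X \<inter> T L Y = {}" if "K \<in> D" "L \<in> D" "K \<noteq> L" "X \<subseteq> box 0 b" "Y \<subseteq> box 0 b" for K L X Y
    using D(4)[OF that(1-3)] Tmono[OF that(4), of K] Tmono[OF that(5), of L] unfolding T_def by blast
  have sub0: "S0 \<subseteq> box 0 b" "R0 \<subseteq> box 0 b" using model(5,6) by (auto simp: b_def)
  have tw: "test_fun (T K (box 0 b)) (wK K)" if "K \<in> D" for K
  proof -
    obtain C where C: "compact C" "C \<subseteq> box 0 b" "\<And>x. x \<notin> C \<Longrightarrow> w0 x = 0"
      using test_fun_support[OF model(2)] unfolding b_def by blast
    show ?thesis
    proof (rule test_funI)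
      show "smooth_fun (wK K)"
        unfolding wK_def[abs_def] by (rule smooth_compose_scaleR) (rule test_fun_smooth[OF model(2)])
      show "compact (T K C)"
        unfolding T_def by (intro compact_continuous_image C continuous_intros)
      show "T K C \<subseteq> T K (box 0 b)" using Tmono[OF C(2)] .
      show "wK K x = 0" if "x \<notin> T K C" for x
        using C(3) memT[OF \<open>K \<in> D\<close>] that by (simp add: wK_def)
    qed
  qed
  have pdK: "pd (wK K) l x = pd w0 l ((x - u K) /\<^sub>R \<rho> K)" if "K \<in> D" for K l x
    unfolding wK_def[abs_def]
    by (rule pd_compose_scale) (use test_fun_smooth[OF model(2)] D(2)[OF that] in auto)
  have pdw: "pd w l x = (\<Sum>K\<in>D. pd (wK K) l x)" for l x
    unfolding w_def[abs_def] by (rule pd_sum) (rule test_fun_smooth[OF tw])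
  have pd_in: "pd w l x = pd w0 l ((x - u K) /\<^sub>R \<rho> K)" if "K \<in> D" "x \<in> T K (box 0 b)" for K l x
  proof -
    have "pd (wK L) l x = 0" if "L \<in> D - {K}" for L
    proof (rule pd_outside[OF tw])
      show "x \<notin> T L (box 0 b)"
        using Tdisj[of K L "box 0 b" "box 0 b"] that \<open>K \<in> D\<close> \<open>x \<in> T K (box 0 b)\<close> by auto
    qed (use that in auto)
    then have "pd w l x = pd (wK K) l x"
      unfolding pdw using D(1) \<open>K \<in> D\<close> by (subst sum.remove[of _ K]) auto
    then show ?thesis using pdK[OF \<open>K \<in> D\<close>] by simp
  qed
  have pd_out: "pd w l x = 0" if "\<And>K. K \<in> D \<Longrightarrow> x \<notin> T K (box 0 b)" for l x
    unfolding pdw using that tw by (intro sum.neutral) (auto intro: pd_outside)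
  \<comment> \<open>The sum of the volume factors of the homotheties: the copies of a set in the
    model box have total volume \<open>N\<close> times its volume, and N \<tau> is the filled
    volume.\<close>
  define N where "N = (\<Sum>K\<in>D. \<rho> K ^ CARD('n))"
  have mT: "vol (T K X) = \<rho> K ^ CARD('n) * vol X" if "K \<in> D" for K X
    unfolding T_def using D(2)[OF that] by (simp add: measure_lebesgue_affine)
  have sumT: "(\<Sum>K\<in>D. vol (T K X)) = N * vol X" for X
    unfolding N_def sum_distrib_right using mT by (intro sum.cong) auto
  have mU: "vol (\<Union>K\<in>D. T K X) = N * vol X" if "X \<subseteq> box 0 b" "open X" for X
  proof -
    have "T K X \<in> lmeasurable" if "K \<in> D" for K
      by (rule lmeasurable_open[OF bounded_subset[OF \<open>bounded S\<close>] openT[OF that \<open>open X\<close>]])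
         (use TS[OF that] Tmono[OF \<open>X \<subseteq> box 0 b\<close>, of K] in auto)
    then have "vol (\<Union>K\<in>D. T K X) = (\<Sum>K\<in>D. vol (T K X))"
      using D(1) Tdisj[OF _ _ _ that(1) that(1)]
      by (intro measure_UNION') (auto simp: pairwise_def disjnt_def)
    then show ?thesis using sumT by simp
  qed
  have N: "0 \<le> N" "N * \<tau> \<le> M" "(1 - e) * M \<le> N * \<tau>"
  proof -
    show "0 \<le> N" unfolding N_def using D(2) by (intro sum_nonneg) (auto simp: less_imp_le)
    then have "0 \<le> N * \<tau>" using model(1) by simp
    have s: "(\<Sum>K\<in>D. vol ((\<lambda>y. \<rho> K *\<^sub>R y + u K) ` box 0 b)) = N * \<tau>"
      using sumT[of "box 0 b"] unfolding T_def mb .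
    show "N * \<tau> \<le> M" using D(6) unfolding s .
    show "(1 - e) * M \<le> N * \<tau>"
      using D(5) \<open>0 \<le> N * \<tau>\<close> unfolding s e'_def by (auto simp: algebra_simps split: if_splits)
  qed
  have lowm: "(1 - \<epsilon>) * t * M \<le> N * m" if "0 \<le> t" "(1 - e) * t * \<tau> \<le> m" for t m
  proof -
    have "(1 - \<epsilon>) * (t * M) \<le> ((1 - e) * (1 - e)) * (t * M)"
      using that(1) M by (intro mult_right_mono) (auto simp: e_def algebra_simps)
    also have "\<dots> = ((1 - e) * t) * ((1 - e) * M)" by simp
    also have "\<dots> \<le> ((1 - e) * t) * (N * \<tau>)"
      using N(3) that(1) e by (intro mult_left_mono) auto
    also have "\<dots> = N * ((1 - e) * t * \<tau>)" by simp
    also have "\<dots> \<le> N * m" using that(2) N(1) by (intro mult_left_mono)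
    finally show ?thesis by (simp add: mult.assoc)
  qed
  have upm: "N * m \<le> t * M" if "0 \<le> t" "m \<le> t * \<tau>" for t m
  proof -
    have "N * m \<le> N * (t * \<tau>)" using that(2) N(1) by (intro mult_left_mono)
    also have "\<dots> = t * (N * \<tau>)" by simp
    also have "\<dots> \<le> t * M" using N(2) that(1) by (intro mult_left_mono)
    finally show ?thesis .
  qed
  have bounds: "- \<alpha> \<le> pd w j x \<and> pd w j x \<le> \<beta> \<and> (\<forall>l. l \<noteq> j \<longrightarrow> \<bar>pd w l x\<bar> \<le> \<epsilon>)" for x
  proof (cases "\<exists>K\<in>D. x \<in> T K (box 0 b)")
    case True
    then obtain K where K: "K \<in> D" "x \<in> T K (box 0 b)" by blast
    show ?thesis
      unfolding pd_in[OF K] using model(10,11) order_trans[OF model(12) e(2)] by blast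
  next
    case False
    then have "pd w l x = 0" for l by (intro pd_out) blast
    then show ?thesis using assms(3-5) by simp
  qed
  show thesis
  proof (rule that[of w "\<Union>K\<in>D. T K S0" "\<Union>K\<in>D. T K R0"])
    show "test_fun S w"
      unfolding w_def[abs_def] by (intro test_fun_sum test_fun_mono[OF tw TS])
    show "open (\<Union>K\<in>D. T K S0)" "open (\<Union>K\<in>D. T K R0)"
      using openT model(3,4) by auto
    show "(\<Union>K\<in>D. T K S0) \<subseteq> S" "(\<Union>K\<in>D. T K R0) \<subseteq> S"
      using TS Tmono[OF sub0(1)] Tmono[OF sub0(2)] by blast+
    show "(\<Union>K\<in>D. T K S0) \<inter> (\<Union>K\<in>D. T K R0) = {}"
    proof -
      have "T K S0 \<inter> T L R0 = {}" if "K \<in> D" "L \<in> D" for K L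
      proof (cases "K = L")
        case True
        then show ?thesis using model(7) memT[OF that(1)] by auto
      qed (use Tdisj sub0 that in auto)
      then show ?thesis by blast
    qed
    show "pd w l x = (if l = j then \<beta> else 0)" if x: "x \<in> (\<Union>K\<in>D. T K S0)" for x l
    proof -
      obtain K where K: "K \<in> D" "x \<in> T K S0" using x by blast
      then have "x \<in> T K (box 0 b)" using Tmono[OF sub0(1)] by blast
      from pd_in[OF K(1) this] show ?thesis
        using model(8) memT[OF K(1)] K(2) by simp
    qed
    show "pd w l x = (if l = j then - \<alpha> else 0)" if x: "x \<in> (\<Union>K\<in>D. T K R0)" for x l
    proof -
      obtain K where K: "K \<in> D" "x \<in> T K R0" using x by blast
      then have "x \<in> T K (box 0 b)" using Tmono[OF sub0(2)] by blast
      from pd_in[OF K(1) this] show ?thesis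
        using model(9) memT[OF K(1)] K(2) by simp
    qed
    show "(1 - \<epsilon>) * \<theta> * vol S \<le> vol (\<Union>K\<in>D. T K S0)"
      "vol (\<Union>K\<in>D. T K S0) \<le> \<theta> * vol S"
      unfolding mU[OF sub0(1) model(3)] M_def[symmetric] using lowm upm \<theta> model(13,14) by auto
    show "(1 - \<epsilon>) * (1 - \<theta>) * vol S \<le> vol (\<Union>K\<in>D. T K R0)"
      "vol (\<Union>K\<in>D. T K R0) \<le> (1 - \<theta>) * vol S"
      unfolding mU[OF sub0(2) model(4)] M_def[symmetric] using lowm upm \<theta> model(15,16) by auto
  qed (use bounds in auto)
qed

section \<open>Laminates in a plane of off-diagonal matrices\<close>

definition symm :: "real^'n^'n \<Rightarrow> real^'n^'n" where
  "symm X = (1/2) *\<^sub>R (X + transpose X)"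

definition plane :: "'n \<Rightarrow> 'n \<Rightarrow> real \<Rightarrow> real \<Rightarrow> real^'n^'n" where
  "plane p q a b = a *\<^sub>R axis p (axis q 1) + b *\<^sub>R axis q (axis p 1)"

lemma norm_transpose: "norm (transpose X) = norm (X :: real^'n^'m)"
proof -
  have sq: "(norm Y)\<^sup>2 = (\<Sum>i\<in>UNIV. \<Sum>j\<in>UNIV. (Y $ i $ j)\<^sup>2)" for Y :: "real^'a^'b"
    unfolding power2_norm_eq_inner by (simp add: inner_vec_def power2_eq_square)
  have "(norm (transpose X))\<^sup>2 = (norm X)\<^sup>2"
    unfolding sq by (subst sum.swap) (simp add: transpose_def)
  then show ?thesis by simp
qed

lemma norm_axis: "norm (axis i x :: 'a::real_normed_vector^'n) = norm x"
proof -
  have "(\<Sum>j\<in>UNIV. (norm (axis i x $ j))\<^sup>2) = (\<Sum>j\<in>UNIV. if j = i then (norm x)\<^sup>2 else 0)"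
    by (intro sum.cong) (auto simp: axis_def)
  then show ?thesis by (simp add: norm_vec_def L2_set_def)
qed

lemma norm_symm_le: "norm (symm X) \<le> norm X"
  using norm_triangle_ineq[of X "transpose X"] by (simp add: symm_def norm_transpose)

lemma symm_add: "symm (X + Y) = symm X + symm Y"
  by (simp add: symm_def transpose_def vec_eq_iff algebra_simps)

lemma symm_nth: "symm X $ i $ j = (X $ i $ j + X $ j $ i) / 2"
  by (simp add: symm_def transpose_def)

lemma linear_symm: "linear symm"
  by (rule linearI) (simp_all add: symm_add symm_def transpose_def vec_eq_iff algebra_simps)

lemma plane_swap: "plane q p b a = plane p q a b"
  by (simp add: plane_def)

lemma plane_nth:
  "plane p q a b $ i $ j = (if i = p \<and> j = q then a else 0) + (if i = q \<and> j = p then b else 0)"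
proof -
  have e: "(axis p (axis q 1) :: real^'a^'b) $ i $ j = (if i = p \<and> j = q then 1 else 0)" for p q i j
    by (cases "i = p") (simp_all add: axis_def)
  have m: "c *\<^sub>R (if P then 1 else 0) = (if P then c else 0)" for c :: real and P
    by simp
  show ?thesis
    unfolding plane_def vector_add_component vector_scaleR_component e m ..
qed

lemma norm_plane_ge:
  assumes "p \<noteq> q"
  shows "\<bar>a\<bar> \<le> norm (plane p q a b)"
proof -
  have "plane p q a b $ p $ q = a"
    using assms by (simp add: plane_nth)
  then show ?thesis
    using component_le_norm_cart[of "plane p q a b $ p" q] Finite_Cartesian_Product.norm_nth_le[of "plane p q a b" p]
    by linarith
qed

lemma symm_plane: "symm (plane p q a b) = plane p q ((a + b)/2) ((a + b)/2)"
proof -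
  have "((if P then a else 0) + (if Q then b else 0) + ((if Q then a else 0) + (if P then b else 0))) / 2
      = (if P then (a + b)/2 else 0) + (if Q then (a + b)/2 else 0)" for P Q
    by (cases P; cases Q) simp_all
  then have "symm (plane p q a b) $ i $ j = plane p q ((a + b)/2) ((a + b)/2) $ i $ j" for i j
    unfolding symm_nth plane_nth conj_commute[of "j = p"] conj_commute[of "j = q"] .
  then show ?thesis by (simp add: vec_eq_iff)
qed

text \<open>For distinct indices the exact value is |a + b| divided by the square root of 2. The
  cruder bound costs only a constant and keeps the decisive feature that it vanishes for b =
  -a.\<close>

lemma norm_symm_plane_le: "norm (symm (plane p q a b)) \<le> \<bar>a + b\<bar>"
proof -
  have "norm (plane p q c c) \<le> \<bar>c\<bar> + \<bar>c\<bar>" for c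
    unfolding plane_def by (rule order_trans[OF norm_triangle_ineq]) (simp add: norm_axis)
  from this[of "(a + b)/2"] show ?thesis by (simp add: symm_plane)
qed

lemma norm_symm_near_plane:
  assumes "norm (X - plane p q a b) \<le> e"
  shows "norm (symm X) \<le> \<bar>a + b\<bar> + e"
proof -
  have "symm X = symm (X - plane p q a b) + symm (plane p q a b)"
    by (simp flip: symm_add)
  then have "norm (symm X) \<le> norm (symm (X - plane p q a b)) + norm (symm (plane p q a b))"
    using norm_triangle_ineq by metis
  then show ?thesis
    using assms norm_symm_le[of "X - plane p q a b"] norm_symm_plane_le[of p q a b] by linarith
qed

section \<open>Splitting one entry of the gradient of a vector field\<close>

lemma jac_nth: "jac u x $ i $ j = pd (\<lambda>y. u y $ i) j x"
  by (simp add: jac_def)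

text \<open>Adding a scalar \<open>w\<close> to component \<open>p\<close> changes only row
  \<open>p\<close> of the Jacobian, by the gradient of \<open>w\<close>. If \<open>w\<close>
  oscillates in direction \<open>q\<close>, entry a moves to a + \<beta> or a - \<alpha>. On the
  transition part of \<open>S\<close> only closeness to the segment between these two matrices is
  known.\<close>

lemma jac_step:
  fixes u :: "real^'n \<Rightarrow> real^'n" and p q :: 'n and S Q :: "(real^'n) set"
  assumes "p \<noteq> q" "open S" "bounded S" "S \<subseteq> Q" "0 < \<alpha>" "0 < \<beta>" "0 < \<epsilon>" "\<epsilon> \<le> 1"
    and \<theta>: "\<theta> = \<alpha> / (\<alpha> + \<beta>)"
    and u: "\<And>i. test_fun Q (\<lambda>y. u y $ i)" and ab: "\<And>x. x \<in> S \<Longrightarrow> jac u x = plane p q a b"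
  obtains u' and S' R :: "(real^'n) set"
  where "\<And>i. test_fun Q (\<lambda>y. u' y $ i)" "open S'" "open R" "S' \<subseteq> S" "R \<subseteq> S" "S' \<inter> R = {}"
    "\<And>x. x \<notin> S \<Longrightarrow> jac u' x = jac u x"
    "\<And>x. x \<in> S' \<Longrightarrow> jac u' x = plane p q (a + \<beta>) b"
    "\<And>x. x \<in> R \<Longrightarrow> jac u' x = plane p q (a - \<alpha>) b"
    "\<And>x. x \<in> S \<Longrightarrow> \<exists>c. a - \<alpha> \<le> c \<and> c \<le> a + \<beta> \<and> norm (jac u' x - plane p q c b) \<le> \<epsilon>"
    "(1 - \<epsilon>) * \<theta> * vol S \<le> vol S'" "vol S' \<le> \<theta> * vol S"
    "(1 - \<epsilon>) * (1 - \<theta>) * vol S \<le> vol R" "vol R \<le> (1 - \<theta>) * vol S"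
proof -
  \<comment> \<open>The error row has at most \<open>CARD('n)\<close> small entries and is measured
    by the sum of their absolute values.\<close>
  define e where "e = \<epsilon> / CARD('n)"
  have n: "1 \<le> real CARD('n)" using one_le_card_finite[where 'a='n] by linarith
  have e: "0 < e" "e \<le> \<epsilon>"
    using assms(7) n by (auto simp: e_def field_simps)
  obtain w and S' R :: "(real^'n) set"
  where w: "test_fun S w" "open S'" "open R" "S' \<subseteq> S" "R \<subseteq> S" "S' \<inter> R = {}"
    "\<And>x l. x \<in> S' \<Longrightarrow> pd w l x = (if l = q then \<beta> else 0)"
    "\<And>x l. x \<in> R \<Longrightarrow> pd w l x = (if l = q then - \<alpha> else 0)"
    "\<And>x. - \<alpha> \<le> pd w q x" "\<And>x. pd w q x \<le> \<beta>" "\<And>x l. l \<noteq> q \<Longrightarrow> \<bar>pd w l x\<bar> \<le> e"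
    "(1 - e) * \<theta> * vol S \<le> vol S'" "vol S' \<le> \<theta> * vol S"
    "(1 - e) * (1 - \<theta>) * vol S \<le> vol R" "vol R \<le> (1 - \<theta>) * vol S"
    by (rule gradient_split[OF assms(2,3,5,6) e(1) order_trans[OF e(2) assms(8)] \<theta>, where j = q]) (rule that)
  have \<theta>01: "0 < \<theta>" "\<theta> < 1" using assms by auto
  define u' where "u' y = u y + w y *\<^sub>R axis p 1" for y
  have u'nth: "(\<lambda>y. u' y $ i) = (if i = p then (\<lambda>y. u y $ i + w y) else (\<lambda>y. u y $ i))" for i
    by (auto simp: u'_def axis_def)
  have wQ: "test_fun Q w" using w(1) assms(4) test_fun_mono by blast
  have jac: "jac u' x = jac u x + axis p (\<chi> l. pd w l x)" for x
    using test_fun_smooth[OF u] test_fun_smooth[OF wQ]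
    by (auto simp: vec_eq_iff jac_nth u'nth axis_def pd_add)
  have axisq: "axis p (\<chi> l. if l = q then c else 0) = c *\<^sub>R axis p (axis q 1 :: real^'n)" for c :: real
    by (auto simp: vec_eq_iff axis_def)
  have step: "plane p q a b + c *\<^sub>R axis p (axis q 1) = plane p q (a + c) b" for c
    by (simp add: plane_def scaleR_add_left)
  show thesis
  proof (rule that[of u' S' R])
    show "test_fun Q (\<lambda>y. u' y $ i)" for i
      using u wQ by (simp add: u'nth test_fun_add)
    show "jac u' x = jac u x" if "x \<notin> S" for x
      unfolding jac using pd_outside[OF w(1) that] by (simp add: vec_eq_iff axis_def)
    show "jac u' x = plane p q (a + \<beta>) b" if "x \<in> S'" for x
      unfolding jac w(7)[OF that] using ab[of x] w(4) that by (auto simp: axisq step)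
    show "jac u' x = plane p q (a - \<alpha>) b" if "x \<in> R" for x
      unfolding jac w(8)[OF that] using ab[of x] w(5) that step[of "- \<alpha>"] by (auto simp: axisq)
    show "\<exists>c. a - \<alpha> \<le> c \<and> c \<le> a + \<beta> \<and> norm (jac u' x - plane p q c b) \<le> \<epsilon>" if "x \<in> S" for x
    proof (intro exI conjI)
      show "a - \<alpha> \<le> a + pd w q x" "a + pd w q x \<le> a + \<beta>" using w(9,10)[of x] by auto
      have "jac u' x - plane p q (a + pd w q x) b = axis p (\<chi> l. if l = q then 0 else pd w l x)"
        unfolding jac ab[OF that] step[symmetric] by (auto simp: vec_eq_iff axis_def)
      then have "norm (jac u' x - plane p q (a + pd w q x) b) = norm (\<chi> l. if l = q then 0 else pd w l x)"
        by (simp add: norm_axis)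
      also have "\<dots> \<le> (\<Sum>l\<in>UNIV. \<bar>(\<chi> l. if l = q then 0 else pd w l x) $ l\<bar>)"
        by (rule norm_le_l1_cart)
      also have "\<dots> \<le> (\<Sum>l\<in>(UNIV::'n set). e)"
        using w(11)[of _ x] e(1) by (intro sum_mono) auto
      also have "\<dots> = \<epsilon>" by (simp add: e_def)
      finally show "norm (jac u' x - plane p q (a + pd w q x) b) \<le> \<epsilon>" .
    qed
    have mono: "(1 - \<epsilon>) * t * vol S \<le> (1 - e) * t * vol S" if "0 \<le> t" for t
      using that e(2) by (intro mult_right_mono) auto
    show "(1 - \<epsilon>) * \<theta> * vol S \<le> vol S'"
      "(1 - \<epsilon>) * (1 - \<theta>) * vol S \<le> vol R"
      using mono[of \<theta>] mono[of "1 - \<theta>"] w(12,14) \<theta>01 by linarith+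
  qed (use w in auto)
qed

text \<open>Superlevel sets of a monotone function are intervals, hence Borel. Composition with
  \<open>max 0\<close> makes \<open>A\<close> monotone on the whole line, since its values at
  negative arguments are arbitrary.\<close>

lemma mono_norm_measurable:
  fixes A :: "real \<Rightarrow> ennreal" and f :: "'a \<Rightarrow> 'b::real_normed_vector"
  assumes mono: "\<And>x y. 0 \<le> x \<Longrightarrow> x \<le> y \<Longrightarrow> A x \<le> A y" and f: "f \<in> borel_measurable M"
  shows "(\<lambda>x. A (norm (f x))) \<in> borel_measurable M"
proof -
  have "(\<lambda>x. A (max 0 x)) \<in> borel_measurable borel"
  proof (rule borel_measurableI_greater)
    fix y
    have "is_interval {x. y < A (max 0 x)}"
      unfolding is_interval_1 using mono by (auto intro: less_le_trans)
    then show "{x \<in> space borel. y < A (max 0 x)} \<in> sets borel"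
      by (simp add: real_interval_borel_measurable)
  qed
  then have "(\<lambda>x. A (max 0 (norm (f x)))) \<in> borel_measurable M"
    by (rule measurable_compose[rotated]) (use f in measurable)
  then show ?thesis by simp
qed

lemma continuous_jac:
  assumes "\<And>i. smooth_fun (\<lambda>y. u y $ i)"
  shows "continuous_on UNIV (jac u)"
  unfolding jac_def[abs_def]
  by (intro continuous_on_vec_lambda smooth_continuous smooth_pd assms)

lemma borel_measurable_jac:
  assumes "\<And>i. test_fun Q (\<lambda>y. u y $ i)"
  shows "jac u \<in> borel_measurable lebesgue" "(\<lambda>x. symm (jac u x)) \<in> borel_measurable lebesgue"
proof -
  have c: "continuous_on UNIV (jac u)"
    by (rule continuous_jac[OF test_fun_smooth[OF assms]])
  have "continuous_on UNIV symm"
    using linear_symm linear_continuous_on linear_conv_bounded_linear by blast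
  then have "continuous_on UNIV (\<lambda>x. symm (jac u x))"
    using c continuous_on_compose2 by blast
  with c show "jac u \<in> borel_measurable lebesgue" "(\<lambda>x. symm (jac u x)) \<in> borel_measurable lebesgue"
    by (auto intro!: measurable_completion borel_measurable_continuous_onI)
qed

lemma set_nn_integral_le_const:
  assumes "N \<in> lmeasurable" "\<And>x. x \<in> N \<Longrightarrow> f x \<le> c"
  shows "(\<integral>\<^sup>+x\<in>N. f x \<partial>lebesgue) \<le> c * ennreal (vol N)"
proof -
  have "(\<integral>\<^sup>+x\<in>N. f x \<partial>lebesgue) \<le> (\<integral>\<^sup>+x. c * indicator N x \<partial>lebesgue)"
    using assms(2) by (intro nn_integral_mono) (auto split: split_indicator)
  also have "\<dots> = c * ennreal (vol N)"
    using assms(1) by (simp add: nn_integral_cmult_indicator fmeasurableD emeasure_eq_measure2)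
  finally show ?thesis .
qed

lemma set_nn_integral_ge_const:
  assumes "N \<in> lmeasurable" "\<And>x. x \<in> N \<Longrightarrow> c \<le> f x"
  shows "c * ennreal (vol N) \<le> (\<integral>\<^sup>+x\<in>N. f x \<partial>lebesgue)"
proof -
  have "c * ennreal (vol N) = (\<integral>\<^sup>+x. c * indicator N x \<partial>lebesgue)"
    using assms(1) by (simp add: nn_integral_cmult_indicator fmeasurableD emeasure_eq_measure2)
  also have "\<dots> \<le> (\<integral>\<^sup>+x\<in>N. f x \<partial>lebesgue)"
    using assms(2) by (intro nn_integral_mono) (auto split: split_indicator)
  finally show ?thesis .
qed

lemma set_nn_integral_mono_set:
  "N \<subseteq> N' \<Longrightarrow> (\<integral>\<^sup>+x\<in>N. f x \<partial>M) \<le> (\<integral>\<^sup>+x\<in>N'. f x \<partial>M)"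
  by (intro nn_integral_mono) (auto split: split_indicator)

text \<open>Additivity of the modular over rounds: \<open>g\<close> belongs to the field before the
  round and \<open>f\<close> to the field after it, while \<open>S\<close> and \<open>S'\<close> are
  the active sets before and after.\<close>

lemma set_nn_integral_step:
  fixes f g :: "'a::euclidean_space \<Rightarrow> ennreal"
  assumes "f \<in> borel_measurable lebesgue" "open S" "open S'" "open Q" "S' \<subseteq> S" "S \<subseteq> Q"
    and "\<And>x. x \<notin> S \<Longrightarrow> f x = g x"
  shows "(\<integral>\<^sup>+x\<in>Q - S'. f x \<partial>lebesgue) = (\<integral>\<^sup>+x\<in>Q - S. g x \<partial>lebesgue) + (\<integral>\<^sup>+x\<in>S - S'. f x \<partial>lebesgue)"
proof -
  have "Q - S' = (Q - S) \<union> (S - S')" using assms(5,6) by blast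
  then have "(\<integral>\<^sup>+x\<in>Q - S'. f x \<partial>lebesgue) = (\<integral>\<^sup>+x\<in>Q - S. f x \<partial>lebesgue) + (\<integral>\<^sup>+x\<in>S - S'. f x \<partial>lebesgue)"
    using assms(1-4) by (simp only:, intro nn_integral_disjoint_pair) (auto simp: borel_open)
  moreover have "(\<integral>\<^sup>+x\<in>Q - S. f x \<partial>lebesgue) = (\<integral>\<^sup>+x\<in>Q - S. g x \<partial>lebesgue)"
    using assms(7) by (intro nn_integral_cong) (auto split: split_indicator)
  ultimately show ?thesis by simp
qed

text \<open>The second entry is split only on \<open>S1\<close>, where the first one has gone up, by
  \<open>jac_step\<close> with \<open>p\<close> and \<open>q\<close> exchanged. \<open>R1\<close> is
  where a goes down, \<open>R2\<close> where b goes down after a has gone up, and \<open>S2\<close>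
  where both go up.\<close>

lemma jac_double_step:
  fixes u :: "real^'n \<Rightarrow> real^'n" and p q :: 'n and S Q :: "(real^'n) set"
  assumes pq: "p \<noteq> q" and S: "open S" "bounded S" "S \<subseteq> Q"
    and pos: "0 < \<alpha>" "0 < \<beta>" "0 < \<alpha>'" "0 < \<beta>'" "0 < \<epsilon>" "\<epsilon> \<le> 1"
    and \<theta>: "\<theta> = \<alpha> / (\<alpha> + \<beta>)" "\<theta>' = \<alpha>' / (\<alpha>' + \<beta>')"
    and u: "\<And>i. test_fun Q (\<lambda>y. u y $ i)" and ab: "\<And>x. x \<in> S \<Longrightarrow> jac u x = plane p q a b"
  obtains u' and S1 R1 S2 R2 :: "(real^'n) set"
  where "\<And>i. test_fun Q (\<lambda>y. u' y $ i)" "open S1" "open R1" "open S2" "open R2"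
    "S1 \<subseteq> S" "R1 \<subseteq> S" "S1 \<inter> R1 = {}" "S2 \<subseteq> S1" "R2 \<subseteq> S1" "S2 \<inter> R2 = {}"
    "\<And>x. x \<notin> S \<Longrightarrow> jac u' x = jac u x"
    "\<And>x. x \<in> R1 \<Longrightarrow> jac u' x = plane p q (a - \<alpha>) b"
    "\<And>x. x \<in> S2 \<Longrightarrow> jac u' x = plane p q (a + \<beta>) (b + \<beta>')"
    "\<And>x. x \<in> R2 \<Longrightarrow> jac u' x = plane p q (a + \<beta>) (b - \<alpha>')"
    "\<And>x. x \<in> S \<Longrightarrow> x \<notin> S1 \<Longrightarrow> \<exists>c. a - \<alpha> \<le> c \<and> c \<le> a + \<beta> \<and> norm (jac u' x - plane p q c b) \<le> \<epsilon>"
    "\<And>x. x \<in> S1 \<Longrightarrow> \<exists>c. b - \<alpha>' \<le> c \<and> c \<le> b + \<beta>' \<and> norm (jac u' x - plane p q (a + \<beta>) c) \<le> \<epsilon>"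
    "(1 - \<epsilon>) * \<theta> * vol S \<le> vol S1" "vol S1 \<le> \<theta> * vol S"
    "(1 - \<epsilon>) * (1 - \<theta>) * vol S \<le> vol R1"
    "(1 - \<epsilon>) * \<theta>' * vol S1 \<le> vol S2" "vol S2 \<le> \<theta>' * vol S1"
    "(1 - \<epsilon>) * (1 - \<theta>') * vol S1 \<le> vol R2"
    "vol R2 \<le> (1 - \<theta>') * vol S1"
proof -
  obtain v and S1 R1 :: "(real^'n) set" where v: "\<And>i. test_fun Q (\<lambda>y. v y $ i)" "open S1" "open R1" "S1 \<subseteq> S" "R1 \<subseteq> S" "S1 \<inter> R1 = {}"
    "\<And>x. x \<notin> S \<Longrightarrow> jac v x = jac u x"
    "\<And>x. x \<in> S1 \<Longrightarrow> jac v x = plane p q (a + \<beta>) b"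
    "\<And>x. x \<in> R1 \<Longrightarrow> jac v x = plane p q (a - \<alpha>) b"
    "\<And>x. x \<in> S \<Longrightarrow> \<exists>c. a - \<alpha> \<le> c \<and> c \<le> a + \<beta> \<and> norm (jac v x - plane p q c b) \<le> \<epsilon>"
    "(1 - \<epsilon>) * \<theta> * vol S \<le> vol S1" "vol S1 \<le> \<theta> * vol S"
    "(1 - \<epsilon>) * (1 - \<theta>) * vol S \<le> vol R1" "vol R1 \<le> (1 - \<theta>) * vol S"
    by (rule jac_step[OF pq S pos(1,2,5,6) \<theta>(1)]) (rule u, erule ab, rule that)
  have v': "jac v x = plane q p b (a + \<beta>)" if "x \<in> S1" for x
    using v(8)[OF that] by (simp add: plane_swap[of q p])
  have S1: "bounded S1" "S1 \<subseteq> Q" using S v(4) bounded_subset by auto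
  obtain w and S2 R2 :: "(real^'n) set" where w: "\<And>i. test_fun Q (\<lambda>y. w y $ i)" "open S2" "open R2" "S2 \<subseteq> S1" "R2 \<subseteq> S1" "S2 \<inter> R2 = {}"
    "\<And>x. x \<notin> S1 \<Longrightarrow> jac w x = jac v x"
    "\<And>x. x \<in> S2 \<Longrightarrow> jac w x = plane q p (b + \<beta>') (a + \<beta>)"
    "\<And>x. x \<in> R2 \<Longrightarrow> jac w x = plane q p (b - \<alpha>') (a + \<beta>)"
    "\<And>x. x \<in> S1 \<Longrightarrow> \<exists>c. b - \<alpha>' \<le> c \<and> c \<le> b + \<beta>' \<and> norm (jac w x - plane q p c (a + \<beta>)) \<le> \<epsilon>"
    "(1 - \<epsilon>) * \<theta>' * vol S1 \<le> vol S2" "vol S2 \<le> \<theta>' * vol S1"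
    "(1 - \<epsilon>) * (1 - \<theta>') * vol S1 \<le> vol R2" "vol R2 \<le> (1 - \<theta>') * vol S1"
    by (rule jac_step[OF pq[symmetric] v(2) S1 pos(3-6) \<theta>(2)]) (rule v(1), erule v', rule that)
  show thesis
  proof (rule that[of w S1 R1 S2 R2])
    show "jac w x = jac u x" if "x \<notin> S" for x
      using w(7)[of x] v(4,7) that by auto
    show "jac w x = plane p q (a - \<alpha>) b" if "x \<in> R1" for x
      using w(7)[of x] v(6) v(9)[OF that] that by auto
    show "\<exists>c. a - \<alpha> \<le> c \<and> c \<le> a + \<beta> \<and> norm (jac w x - plane p q c b) \<le> \<epsilon>" if "x \<in> S" "x \<notin> S1" for x
      using w(7)[OF that(2)] v(10)[OF that(1)] by simp
    show "jac w x = plane p q (a + \<beta>) (b + \<beta>')" if "x \<in> S2" for x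
      using w(8)[OF that] by (simp add: plane_swap[of q p])
    show "jac w x = plane p q (a + \<beta>) (b - \<alpha>')" if "x \<in> R2" for x
      using w(9)[OF that] by (simp add: plane_swap[of q p])
    show "\<exists>c. b - \<alpha>' \<le> c \<and> c \<le> b + \<beta>' \<and> norm (jac w x - plane p q (a + \<beta>) c) \<le> \<epsilon>" if "x \<in> S1" for x
      using w(10)[OF that] by (simp add: plane_swap[of q p])
  qed (fact v w)+
qed

section \<open>The two kinds of rounds\<close>

lemma measure_Diff_Un_open:
  fixes S :: "(real^'n) set"
  assumes "open S" "bounded S" "open X" "open Y" "X \<subseteq> S" "Y \<subseteq> S" "X \<inter> Y = {}"
  shows "vol (S - (X \<union> Y)) = vol S - vol X - vol Y"
    and "S - (X \<union> Y) \<in> lmeasurable"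
proof -
  have "X \<in> lmeasurable" "Y \<in> lmeasurable" "S \<in> lmeasurable"
    using assms bounded_subset by (auto intro!: lmeasurable_open)
  moreover have "X \<union> Y \<in> lmeasurable" using calculation by auto
  ultimately show "vol (S - (X \<union> Y)) = vol S - vol X - vol Y"
    "S - (X \<union> Y) \<in> lmeasurable"
    using assms(5-7) by (auto simp: measurable_measure_Diff measure_Un3 fmeasurableD)
qed

text \<open>Splitting a = s into 2s and -s uses the proportions 2/3 and 1/3; splitting b = s into 2s
  and -2s then uses 3/4 and 1/4. Half of \<open>S\<close> reaches (2s, 2s), while the values (-s, s)
  and (2s, -2s) are skew and free for \<open>A\<close>. On the remaining set the symmetric part is
  at most 5s, so finiteness of \<open>A (5 * s)\<close> allows its cost to be pushed below
  \<delta>.\<close>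

lemma concentration_round:
  fixes u :: "real^'n \<Rightarrow> real^'n" and p q :: 'n and S Q :: "(real^'n) set" and A B :: "real \<Rightarrow> ennreal"
  assumes pq: "p \<noteq> q" and S: "open S" "bounded S" "S \<subseteq> Q" and "0 < s" and fin: "A (5 * s) < \<infinity>"
    and Amono: "\<And>x y. 0 \<le> x \<Longrightarrow> x \<le> y \<Longrightarrow> A x \<le> A y" and A0: "A 0 = 0"
    and Bmono: "\<And>x y. 0 \<le> x \<Longrightarrow> x \<le> y \<Longrightarrow> B x \<le> B y"
    and \<delta>: "0 < \<delta>" "\<delta> \<le> 1"
    and u: "\<And>i. test_fun Q (\<lambda>y. u y $ i)" and ab: "\<And>x. x \<in> S \<Longrightarrow> jac u x = plane p q s s"
  obtains u' and S' :: "(real^'n) set"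
  where "\<And>i. test_fun Q (\<lambda>y. u' y $ i)" "open S'" "S' \<subseteq> S" "\<And>x. x \<notin> S \<Longrightarrow> jac u' x = jac u x"
    "\<And>x. x \<in> S' \<Longrightarrow> jac u' x = plane p q (2 * s) (2 * s)"
    "(1 - \<delta>) / 2 * vol S \<le> vol S'" "vol S' \<le> vol S / 2"
    "(\<integral>\<^sup>+x\<in>S - S'. A (norm (symm (jac u' x))) \<partial>lebesgue) \<le> ennreal \<delta>"
    "B s * ennreal (vol S / 4) \<le> (\<integral>\<^sup>+x\<in>S - S'. B (norm (jac u' x)) \<partial>lebesgue)"
proof -
  define m where "m = vol S"
  define c where "c = enn2real (A (5 * s))"
  have m: "0 \<le> m" and c: "0 \<le> c" "A (5 * s) = ennreal c"
    using fin by (auto simp: m_def c_def less_top)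
  \<comment> \<open>The bound 1/4 leaves a quarter of \<open>S\<close> for \<open>R1\<close>;
    \<delta>/2 makes the square of 1 - \<epsilon> at least 1 - \<delta>; \<open>s\<close> gives 4s +
    \<epsilon> at most 5s; the last entry bounds the cost on the transition set, with + 1 to keep
    the denominator positive.\<close>
  define \<epsilon> where "\<epsilon> = min (min (1/4) (\<delta>/2)) (min s (\<delta> / (2 * c * m + 1)))"
  have cm: "0 \<le> c * m" using c m by simp
  have "0 < \<delta> / (2 * c * m + 1)" using \<delta> cm by (intro divide_pos_pos) auto
  then have \<epsilon>: "0 < \<epsilon>" "\<epsilon> \<le> 1" "\<epsilon> \<le> 1/4" "\<epsilon> \<le> \<delta>/2" "\<epsilon> \<le> s" "\<epsilon> \<le> \<delta> / (2 * c * m + 1)"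
  proof -
    show le: "\<epsilon> \<le> 1/4" "\<epsilon> \<le> \<delta>/2" "\<epsilon> \<le> s" "\<epsilon> \<le> \<delta> / (2 * c * m + 1)"
      unfolding \<epsilon>_def by (simp_all only: min_le_iff_disj order_refl simp_thms)
    show "\<epsilon> \<le> 1" using le(1) by simp
    show "0 < \<epsilon>"
      using \<delta> \<open>0 < s\<close> \<open>0 < \<delta> / (2 * c * m + 1)\<close> unfolding \<epsilon>_def by (simp only: min_less_iff_conj) simp
  qed
  have small: "c * (2 * \<epsilon> * m) \<le> \<delta>"
  proof -
    have "\<epsilon> * (2 * c * m + 1) \<le> \<delta>"
      using \<epsilon>(6) cm by (subst (asm) pos_le_divide_eq) auto
    then show ?thesis using \<epsilon>(1) by (simp add: algebra_simps)
  qed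
  have \<theta>: "2/3 = 2 * s / (2 * s + s)" "3/4 = 3 * s / (3 * s + s)"
    and pos: "0 < 2 * s" "0 < 3 * s"
    using \<open>0 < s\<close> by (auto simp: field_simps)
  obtain u' and S1 R1 S2 R2 :: "(real^'n) set"
  where v: "\<And>i. test_fun Q (\<lambda>y. u' y $ i)" "open S1" "open R1" "open S2" "open R2"
    "S1 \<subseteq> S" "R1 \<subseteq> S" "S1 \<inter> R1 = {}" "S2 \<subseteq> S1" "R2 \<subseteq> S1" "S2 \<inter> R2 = {}"
    "\<And>x. x \<notin> S \<Longrightarrow> jac u' x = jac u x"
    "\<And>x. x \<in> R1 \<Longrightarrow> jac u' x = plane p q (s - 2 * s) s"
    "\<And>x. x \<in> S2 \<Longrightarrow> jac u' x = plane p q (s + s) (s + s)"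
    "\<And>x. x \<in> R2 \<Longrightarrow> jac u' x = plane p q (s + s) (s - 3 * s)"
    "\<And>x. x \<in> S \<Longrightarrow> x \<notin> S1 \<Longrightarrow> \<exists>c. s - 2 * s \<le> c \<and> c \<le> s + s \<and> norm (jac u' x - plane p q c s) \<le> \<epsilon>"
    "\<And>x. x \<in> S1 \<Longrightarrow> \<exists>c. s - 3 * s \<le> c \<and> c \<le> s + s \<and> norm (jac u' x - plane p q (s + s) c) \<le> \<epsilon>"
    "(1 - \<epsilon>) * (2/3) * vol S \<le> vol S1" "vol S1 \<le> (2/3) * vol S"
    "(1 - \<epsilon>) * (1 - 2/3) * vol S \<le> vol R1"
    "(1 - \<epsilon>) * (3/4) * vol S1 \<le> vol S2" "vol S2 \<le> (3/4) * vol S1"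
    "(1 - \<epsilon>) * (1 - 3/4) * vol S1 \<le> vol R2"
    "vol R2 \<le> (1 - 3/4) * vol S1"
    by (rule jac_double_step[OF pq S pos(1) \<open>0 < s\<close> pos(2) \<open>0 < s\<close> \<epsilon>(1,2) \<theta>]) (rule u, erule ab, rule that)
  have S1: "bounded S1" using S v(6) bounded_subset by auto
  \<comment> \<open>The transition set of both splittings. It carries the whole
    \<open>A\<close>-cost of the round, because the symmetric part vanishes on \<open>R1\<close> and
    \<open>R2\<close>.\<close>
  define N where "N = (S - (S1 \<union> R1)) \<union> (S1 - (S2 \<union> R2))"
  have N: "N \<in> lmeasurable" "vol N \<le> 2 * \<epsilon> * m"
  proof -
    note d = measure_Diff_Un_open[OF S(1,2) v(2,3,6,7,8)] measure_Diff_Un_open[OF v(2) S1 v(4,5,9-11)]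
    show "N \<in> lmeasurable" unfolding N_def using d(2,4) by blast
    have "vol N \<le> vol (S - (S1 \<union> R1)) + vol (S1 - (S2 \<union> R2))"
      unfolding N_def using d(2,4) by (intro measure_Un_le) (auto dest: fmeasurableD)
    also have "\<dots> \<le> \<epsilon> * m + \<epsilon> * vol S1"
      unfolding d(1,3) using v(18,20,21,23) by (simp add: m_def algebra_simps)
    also have "\<dots> \<le> \<epsilon> * m + \<epsilon> * m"
    proof (intro add_left_mono mult_left_mono)
      show "vol S1 \<le> m" using v(19) m unfolding m_def by linarith
    qed (use \<epsilon>(1) in simp)
    finally show "vol N \<le> 2 * \<epsilon> * m" by simp
  qed
  have bound: "A (norm (symm (jac u' x))) \<le> ennreal c" if "x \<in> S" for x
  proof -
    have "norm (symm (jac u' x)) \<le> 5 * s"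
    proof (cases "x \<in> S1")
      case True
      then obtain c where c: "s - 3 * s \<le> c" "c \<le> s + s" "norm (jac u' x - plane p q (s + s) c) \<le> \<epsilon>"
        using v(17) by blast
      have "\<bar>s + s + c\<bar> \<le> 4 * s" using c(1,2) \<open>0 < s\<close> by auto
      then show ?thesis using norm_symm_near_plane[OF c(3)] \<epsilon>(5) by linarith
    next
      case False
      then obtain c where c: "s - 2 * s \<le> c" "c \<le> s + s" "norm (jac u' x - plane p q c s) \<le> \<epsilon>"
        using v(16) \<open>x \<in> S\<close> by blast
      have "\<bar>c + s\<bar> \<le> 4 * s" using c(1,2) \<open>0 < s\<close> by auto
      then show ?thesis using norm_symm_near_plane[OF c(3)] \<epsilon>(5) by linarith
    qed
    then show ?thesis using Amono[of "norm (symm (jac u' x))" "5 * s"] c(2) by simp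
  qed
  have zero: "A (norm (symm (jac u' x))) = 0" if "x \<in> R1 \<or> x \<in> R2" for x
  proof -
    have "norm (symm (plane p q (s - 2 * s) s)) \<le> 0" "norm (symm (plane p q (s + s) (s - 3 * s))) \<le> 0"
      using norm_symm_plane_le[of p q "s - 2 * s" s] norm_symm_plane_le[of p q "s + s" "s - 3 * s"] by simp_all
    then have "symm (jac u' x) = 0"
      using that v(13,15)[of x] by auto
    then show ?thesis by (simp add: A0)
  qed
  show thesis
  proof (rule that[of u' S2])
    show "S2 \<subseteq> S" using v(6,9) by blast
    show "jac u' x = plane p q (2 * s) (2 * s)" if "x \<in> S2" for x
      using v(14)[OF that] by simp
    show "vol S2 \<le> vol S / 2" using v(19,22) by simp
    have "(1 - \<delta>) / 2 * m \<le> (1 - \<epsilon>) * (3/4) * ((1 - \<epsilon>) * (2/3) * m)"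
    proof -
      have "(1 - \<epsilon>) * (1 - \<epsilon>) = 1 - 2 * \<epsilon> + \<epsilon> * \<epsilon>" by (simp add: algebra_simps)
    then have "1 - \<delta> \<le> (1 - \<epsilon>) * (1 - \<epsilon>)" using \<epsilon>(4) zero_le_square[of \<epsilon>] by linarith
      then have "(1 - \<delta>) * (m / 2) \<le> (1 - \<epsilon>) * (1 - \<epsilon>) * (m / 2)" using m by (intro mult_right_mono) auto
      then show ?thesis by (simp add: field_simps)
    qed
    also have "\<dots> \<le> (1 - \<epsilon>) * (3/4) * vol S1"
      using v(18) \<epsilon>(2) unfolding m_def by (intro mult_left_mono) auto
    finally show "(1 - \<delta>) / 2 * vol S \<le> vol S2"
      using v(21) unfolding m_def by linarith
    have "(\<integral>\<^sup>+x\<in>S - S2. A (norm (symm (jac u' x))) \<partial>lebesgue) \<le> (\<integral>\<^sup>+x\<in>N. A (norm (symm (jac u' x))) \<partial>lebesgue)"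
      using zero by (intro nn_integral_mono) (auto simp: N_def split: split_indicator)
    also have "\<dots> \<le> ennreal c * ennreal (vol N)"
      using N(1) v(6) bound by (intro set_nn_integral_le_const) (auto simp: N_def)
    also have "\<dots> \<le> ennreal \<delta>"
      using order_trans[OF mult_left_mono[OF N(2) c(1)] small] c(1) by (simp add: ennreal_mult[symmetric] ennreal_leI)
    finally show "(\<integral>\<^sup>+x\<in>S - S2. A (norm (symm (jac u' x))) \<partial>lebesgue) \<le> ennreal \<delta>" .
    have "B s * ennreal (vol S / 4) \<le> B s * ennreal (vol R1)"
    proof (intro mult_left_mono ennreal_leI)
      have "3/4 * (1/3 * m) \<le> (1 - \<epsilon>) * (1/3 * m)" using \<epsilon>(3) m by (intro mult_right_mono) auto
      then show "vol S / 4 \<le> vol R1" using v(20) by (simp add: m_def)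
    qed simp
    also have "\<dots> \<le> (\<integral>\<^sup>+x\<in>R1. B (norm (jac u' x)) \<partial>lebesgue)"
    proof (rule set_nn_integral_ge_const)
      show "R1 \<in> lmeasurable" using S v(3,7) bounded_subset lmeasurable_open by blast
      show "B s \<le> B (norm (jac u' x))" if "x \<in> R1" for x
        using norm_plane_ge[OF pq, of "s - 2 * s" s] \<open>0 < s\<close> v(13)[OF that] by (intro Bmono) auto
    qed
    also have "\<dots> \<le> (\<integral>\<^sup>+x\<in>S - S2. B (norm (jac u' x)) \<partial>lebesgue)"
      using v(7,8,9) by (intro set_nn_integral_mono_set) blast
    finally show "B s * ennreal (vol S / 4) \<le> (\<integral>\<^sup>+x\<in>S - S2. B (norm (jac u' x)) \<partial>lebesgue)" .
  qed (use v in auto)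
qed

text \<open>All steps have the same size g, so each of the two splittings halves the measure. The
  set \<open>S'\<close>, used with a = 0, is the entry to the concentrating staircase;
  \<open>R'\<close> continues the skew one. Everywhere on \<open>S\<close> the sum of the two
  entries is at most 2g in size, and the error is at most g.\<close>

lemma skew_round:
  fixes u :: "real^'n \<Rightarrow> real^'n" and p q :: 'n and S Q :: "(real^'n) set"
  assumes pq: "p \<noteq> q" and S: "open S" "bounded S" "S \<subseteq> Q" and "0 < g" and \<delta>: "0 < \<delta>" "\<delta> \<le> 1"
    and u: "\<And>i. test_fun Q (\<lambda>y. u y $ i)" and ab: "\<And>x. x \<in> S \<Longrightarrow> jac u x = plane p q a (- a)"
  obtains u' and S' R' :: "(real^'n) set"
  where "\<And>i. test_fun Q (\<lambda>y. u' y $ i)" "open S'" "open R'" "S' \<subseteq> S" "R' \<subseteq> S"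
    "\<And>x. x \<notin> S \<Longrightarrow> jac u' x = jac u x"
    "\<And>x. x \<in> S' \<Longrightarrow> jac u' x = plane p q (a + g) (- a + g)"
    "\<And>x. x \<in> R' \<Longrightarrow> jac u' x = plane p q (a + g) (- (a + g))"
    "\<And>x. x \<in> S \<Longrightarrow> norm (symm (jac u' x)) \<le> 3 * g"
    "(1 - \<delta>) / 4 * vol S \<le> vol S'" "vol S' \<le> vol S / 4"
    "(1 - \<delta>) / 4 * vol S \<le> vol R'" "vol R' \<le> vol S / 4"
proof -
  define m where "m = vol S"
  have m: "0 \<le> m" by (simp add: m_def)
  define \<epsilon> where "\<epsilon> = min (\<delta>/2) g"
  have \<epsilon>: "0 < \<epsilon>" "\<epsilon> \<le> 1" "\<epsilon> \<le> \<delta>/2" "\<epsilon> \<le> g"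
  proof -
    show le: "\<epsilon> \<le> \<delta>/2" "\<epsilon> \<le> g"
      unfolding \<epsilon>_def by (simp_all only: min_le_iff_disj order_refl simp_thms)
    show "\<epsilon> \<le> 1" using le(1) \<delta> by simp
    show "0 < \<epsilon>" using \<delta> \<open>0 < g\<close> unfolding \<epsilon>_def by (simp only: min_less_iff_conj) simp
  qed
  have \<theta>: "1/2 = g / (g + g)"
    using \<open>0 < g\<close> by (auto simp: field_simps)
  obtain u' and S1 R1 S2 R2 :: "(real^'n) set"
  where v: "\<And>i. test_fun Q (\<lambda>y. u' y $ i)" "open S1" "open R1" "open S2" "open R2"
    "S1 \<subseteq> S" "R1 \<subseteq> S" "S1 \<inter> R1 = {}" "S2 \<subseteq> S1" "R2 \<subseteq> S1" "S2 \<inter> R2 = {}"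
    "\<And>x. x \<notin> S \<Longrightarrow> jac u' x = jac u x"
    "\<And>x. x \<in> R1 \<Longrightarrow> jac u' x = plane p q (a - g) (- a)"
    "\<And>x. x \<in> S2 \<Longrightarrow> jac u' x = plane p q (a + g) (- a + g)"
    "\<And>x. x \<in> R2 \<Longrightarrow> jac u' x = plane p q (a + g) (- a - g)"
    "\<And>x. x \<in> S \<Longrightarrow> x \<notin> S1 \<Longrightarrow> \<exists>c. a - g \<le> c \<and> c \<le> a + g \<and> norm (jac u' x - plane p q c (- a)) \<le> \<epsilon>"
    "\<And>x. x \<in> S1 \<Longrightarrow> \<exists>c. - a - g \<le> c \<and> c \<le> - a + g \<and> norm (jac u' x - plane p q (a + g) c) \<le> \<epsilon>"
    "(1 - \<epsilon>) * (1/2) * vol S \<le> vol S1" "vol S1 \<le> (1/2) * vol S"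
    "(1 - \<epsilon>) * (1 - 1/2) * vol S \<le> vol R1"
    "(1 - \<epsilon>) * (1/2) * vol S1 \<le> vol S2" "vol S2 \<le> (1/2) * vol S1"
    "(1 - \<epsilon>) * (1 - 1/2) * vol S1 \<le> vol R2"
    "vol R2 \<le> (1 - 1/2) * vol S1"
    by (rule jac_double_step[OF pq S \<open>0 < g\<close> \<open>0 < g\<close> \<open>0 < g\<close> \<open>0 < g\<close> \<epsilon>(1,2) \<theta> \<theta>]) (rule u, erule ab, rule that)
  have bound: "norm (symm (jac u' x)) \<le> 3 * g" if "x \<in> S" for x
  proof (cases "x \<in> S1")
    case True
    then obtain c where c: "- a - g \<le> c" "c \<le> - a + g" "norm (jac u' x - plane p q (a + g) c) \<le> \<epsilon>"
      using v(17) by blast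
    have "\<bar>a + g + c\<bar> \<le> 2 * g" using c(1,2) \<open>0 < g\<close> by auto
    then show ?thesis using norm_symm_near_plane[OF c(3)] \<epsilon>(4) by linarith
  next
    case False
    then obtain c where c: "a - g \<le> c" "c \<le> a + g" "norm (jac u' x - plane p q c (- a)) \<le> \<epsilon>"
      using v(16) \<open>x \<in> S\<close> by blast
    have "\<bar>c + - a\<bar> \<le> 2 * g" using c(1,2) \<open>0 < g\<close> by auto
    then show ?thesis using norm_symm_near_plane[OF c(3)] \<epsilon>(4) by linarith
  qed
  have "(1 - \<delta>) / 4 * m \<le> (1 - \<epsilon>) * (1/2) * ((1 - \<epsilon>) * (1/2) * m)"
  proof -
    have "(1 - \<epsilon>) * (1 - \<epsilon>) = 1 - 2 * \<epsilon> + \<epsilon> * \<epsilon>" by (simp add: algebra_simps)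
    then have "1 - \<delta> \<le> (1 - \<epsilon>) * (1 - \<epsilon>)" using \<epsilon>(3) zero_le_square[of \<epsilon>] by linarith
    then have "(1 - \<delta>) * (m / 4) \<le> (1 - \<epsilon>) * (1 - \<epsilon>) * (m / 4)" using m by (intro mult_right_mono) auto
    then show ?thesis by (simp add: field_simps)
  qed
  also have "\<dots> \<le> (1 - \<epsilon>) * (1/2) * vol S1"
    using v(18) \<epsilon>(2) unfolding m_def by (intro mult_left_mono) auto
  finally have low: "(1 - \<delta>) / 4 * vol S \<le> (1 - \<epsilon>) * (1/2) * vol S1"
    unfolding m_def .
  have half: "1 - 1/2 = (1/2 :: real)" by simp
  show thesis
  proof (rule that[of u' S2 R2])
    show "S2 \<subseteq> S" "R2 \<subseteq> S" using v(6,9,10) by blast+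
    show "(1 - \<delta>) / 4 * vol S \<le> vol S2"
      "(1 - \<delta>) / 4 * vol S \<le> vol R2"
      using low v(21) v(23)[unfolded half] by linarith+
    show "vol S2 \<le> vol S / 4" "vol R2 \<le> vol S / 4"
      using v(19,22) v(24)[unfolded half] by linarith+
    show "jac u' x = plane p q (a + g) (- (a + g))" if "x \<in> R2" for x
      using v(15)[OF that] by simp
  qed (use v bound in auto)
qed

section \<open>Staircases\<close>

lemma jac_zero: "jac (\<lambda>x. 0) x = (0 :: real^'n^'n)"
  by (simp add: vec_eq_iff jac_nth pd_const)

lemma plane_zero [simp]: "plane p q 0 0 = 0"
  by (simp add: plane_def)

text \<open>Induction with \<delta> arbitrary: the earlier rounds are requested with \<delta>/2 and
  the new round spends the other half. The base case is a skew round from the zero field, whose cost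
  is bounded by \<open>A (3 * s0)\<close> on all of \<open>Q\<close>. The number 32 is 4 for the
  initial quarter, times 2 for the loss 1 - \<delta>/2 of at most one half, times 4 for the part of
  the active set that turns skew.\<close>

lemma concentration_staircase:
  fixes p q :: "'n::finite" and Q :: "(real^'n) set" and A B :: "real \<Rightarrow> ennreal"
  assumes pq: "p \<noteq> q" and Q: "open Q" "bounded Q" and s0: "0 < s0" and fin: "\<And>x. 0 \<le> x \<Longrightarrow> A x < \<infinity>"
    and Amono: "\<And>x y. 0 \<le> x \<Longrightarrow> x \<le> y \<Longrightarrow> A x \<le> A y" and A0: "A 0 = 0"
    and Bmono: "\<And>x y. 0 \<le> x \<Longrightarrow> x \<le> y \<Longrightarrow> B x \<le> B y"
  shows "0 < \<delta> \<Longrightarrow> \<delta> \<le> 1 \<Longrightarrow> \<exists>u S. (\<forall>i. test_fun Q (\<lambda>y. u y $ i)) \<and> open S \<and> S \<subseteq> Q \<and>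
    (\<forall>x\<in>S. jac u x = plane p q (s0 * 2^k) (s0 * 2^k)) \<and>
    (1 - \<delta>) / 4 / 2^k * vol Q \<le> vol S \<and> vol S \<le> vol Q / 4 / 2^k \<and>
    (\<integral>\<^sup>+x\<in>Q - S. A (norm (symm (jac u x))) \<partial>lebesgue) \<le> A (3 * s0) * ennreal (vol Q) + ennreal \<delta> \<and>
    (\<Sum>j<k. B (s0 * 2^j) * ennreal (vol Q / (32 * 2^j))) \<le> (\<integral>\<^sup>+x\<in>Q - S. B (norm (jac u x)) \<partial>lebesgue)"
proof (induction k arbitrary: \<delta>)
  case 0
  have u0: "test_fun Q (\<lambda>y. (0::real^'n) $ i)" for i by (simp add: test_fun_zero)
  have j0: "jac (\<lambda>x. 0) x = plane p q 0 (- 0)" if "x \<in> Q" for x :: "real^'n"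
    by (simp add: jac_zero)
  obtain u' and S' R' :: "(real^'n) set"
    where v: "\<And>i. test_fun Q (\<lambda>y. u' y $ i)" "open S'" "open R'" "S' \<subseteq> Q" "R' \<subseteq> Q"
    "\<And>x. x \<notin> Q \<Longrightarrow> jac u' x = jac (\<lambda>x. 0) x"
    "\<And>x. x \<in> S' \<Longrightarrow> jac u' x = plane p q (0 + s0) (- 0 + s0)"
    "\<And>x. x \<in> R' \<Longrightarrow> jac u' x = plane p q (0 + s0) (- (0 + s0))"
    "\<And>x. x \<in> Q \<Longrightarrow> norm (symm (jac u' x)) \<le> 3 * s0"
    "(1 - \<delta>) / 4 * vol Q \<le> vol S'" "vol S' \<le> vol Q / 4"
    "(1 - \<delta>) / 4 * vol Q \<le> vol R'" "vol R' \<le> vol Q / 4"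
    by (rule skew_round[OF pq Q order_refl s0 0]) (rule u0, erule j0, rule that)
  have "(\<integral>\<^sup>+x\<in>Q - S'. A (norm (symm (jac u' x))) \<partial>lebesgue) \<le> (\<integral>\<^sup>+x\<in>Q. A (norm (symm (jac u' x))) \<partial>lebesgue)"
    by (rule set_nn_integral_mono_set) blast
  also have "\<dots> \<le> A (3 * s0) * ennreal (vol Q)"
    using Q v(9) Amono by (intro set_nn_integral_le_const lmeasurable_open) auto
  finally have "(\<integral>\<^sup>+x\<in>Q - S'. A (norm (symm (jac u' x))) \<partial>lebesgue) \<le> A (3 * s0) * ennreal (vol Q) + ennreal \<delta>"
    by (rule order_trans) simp
  then show ?case
    using v by (intro exI[of _ u'] exI[of _ S']) simp
next
  case (Suc k)
  define m where "m = vol Q"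
  have m: "0 \<le> m" by (simp add: m_def)
  define s where "s = s0 * 2^k"
  have s: "0 < s" using s0 by (simp add: s_def)
  have \<delta>2: "0 < \<delta>/2" "\<delta>/2 \<le> 1" using Suc.prems by auto
  obtain u S where u: "\<And>i. test_fun Q (\<lambda>y. u y $ i)" "open S" "S \<subseteq> Q"
    "\<And>x. x \<in> S \<Longrightarrow> jac u x = plane p q s s"
    "(1 - \<delta>/2) / 4 / 2^k * m \<le> vol S" "vol S \<le> m / 4 / 2^k"
    "(\<integral>\<^sup>+x\<in>Q - S. A (norm (symm (jac u x))) \<partial>lebesgue) \<le> A (3 * s0) * ennreal m + ennreal (\<delta>/2)"
    "(\<Sum>j<k. B (s0 * 2^j) * ennreal (m / (32 * 2^j))) \<le> (\<integral>\<^sup>+x\<in>Q - S. B (norm (jac u x)) \<partial>lebesgue)"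
    using Suc.IH[OF \<delta>2] unfolding m_def s_def by blast
  have bS: "bounded S" using Q u(3) bounded_subset by blast
  have fin': "A (5 * s) < \<infinity>" using fin s by simp
  obtain u' and S' :: "(real^'n) set"
  where v: "\<And>i. test_fun Q (\<lambda>y. u' y $ i)" "open S'" "S' \<subseteq> S" "\<And>x. x \<notin> S \<Longrightarrow> jac u' x = jac u x"
    "\<And>x. x \<in> S' \<Longrightarrow> jac u' x = plane p q (2 * s) (2 * s)"
    "(1 - \<delta>/2) / 2 * vol S \<le> vol S'" "vol S' \<le> vol S / 2"
    "(\<integral>\<^sup>+x\<in>S - S'. A (norm (symm (jac u' x))) \<partial>lebesgue) \<le> ennreal (\<delta>/2)"
    "B s * ennreal (vol S / 4) \<le> (\<integral>\<^sup>+x\<in>S - S'. B (norm (jac u' x)) \<partial>lebesgue)"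
    by (rule concentration_round[OF pq u(2) bS u(3) s fin' Amono A0 Bmono \<delta>2 u(1) u(4)]) (assumption | rule that)+
  have mA: "(\<lambda>x. A (norm (symm (jac u' x)))) \<in> borel_measurable lebesgue"
    by (rule mono_norm_measurable[OF Amono borel_measurable_jac(2)[OF v(1)]])
  have mB: "(\<lambda>x. B (norm (jac u' x))) \<in> borel_measurable lebesgue"
    by (rule mono_norm_measurable[OF Bmono borel_measurable_jac(1)[OF v(1)]])
  have splitA: "(\<integral>\<^sup>+x\<in>Q - S'. A (norm (symm (jac u' x))) \<partial>lebesgue) =
      (\<integral>\<^sup>+x\<in>Q - S. A (norm (symm (jac u x))) \<partial>lebesgue) + (\<integral>\<^sup>+x\<in>S - S'. A (norm (symm (jac u' x))) \<partial>lebesgue)"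
    by (rule set_nn_integral_step[OF mA u(2) v(2) Q(1) v(3) u(3)]) (simp add: v(4))
  have splitB: "(\<integral>\<^sup>+x\<in>Q - S'. B (norm (jac u' x)) \<partial>lebesgue) =
      (\<integral>\<^sup>+x\<in>Q - S. B (norm (jac u x)) \<partial>lebesgue) + (\<integral>\<^sup>+x\<in>S - S'. B (norm (jac u' x)) \<partial>lebesgue)"
    by (rule set_nn_integral_step[OF mB u(2) v(2) Q(1) v(3) u(3)]) (simp add: v(4))
  have 1: "(\<integral>\<^sup>+x\<in>Q - S'. A (norm (symm (jac u' x))) \<partial>lebesgue) \<le> A (3 * s0) * ennreal m + ennreal \<delta>"
  proof -
    have "(\<integral>\<^sup>+x\<in>Q - S'. A (norm (symm (jac u' x))) \<partial>lebesgue) \<le> A (3 * s0) * ennreal m + ennreal (\<delta>/2) + ennreal (\<delta>/2)"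
      unfolding splitA by (intro add_mono u v)
    also have "ennreal (\<delta>/2) + ennreal (\<delta>/2) = ennreal \<delta>"
      using Suc.prems by (simp flip: ennreal_plus)
    then have "A (3 * s0) * ennreal m + ennreal (\<delta>/2) + ennreal (\<delta>/2) = A (3 * s0) * ennreal m + ennreal \<delta>"
      by (simp add: add.assoc)
    finally show ?thesis .
  qed
  have 2: "(1 - \<delta>) / 4 / 2 ^ Suc k * m \<le> vol S'"
  proof -
    have "(1 - \<delta>/2) * (1 - \<delta>/2) = 1 - \<delta> + (\<delta>/2) * (\<delta>/2)" by (simp add: algebra_simps)
    then have "1 - \<delta> \<le> (1 - \<delta>/2) * (1 - \<delta>/2)" using zero_le_square[of "\<delta>/2"] by linarith
    then have "(1 - \<delta>) * (m / 4 / 2^Suc k) \<le> (1 - \<delta>/2) * (1 - \<delta>/2) * (m / 4 / 2^Suc k)"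
      using m by (intro mult_right_mono) auto
    also have "\<dots> = (1 - \<delta>/2) / 2 * ((1 - \<delta>/2) / 4 / 2^k * m)" by simp
    also have "\<dots> \<le> (1 - \<delta>/2) / 2 * vol S"
      using u(5) \<delta>2 by (intro mult_left_mono) auto
    also note v(6)
    also have "(1 - \<delta>) * (m / 4 / 2^Suc k) = (1 - \<delta>) / 4 / 2^Suc k * m" by (simp only: times_divide_eq_right times_divide_eq_left)
    finally show ?thesis .
  qed
  have 3: "vol S' \<le> m / 4 / 2 ^ Suc k" using v(7) u(6) by simp
  have 4: "(\<Sum>j<Suc k. B (s0 * 2^j) * ennreal (m / (32 * 2^j))) \<le> (\<integral>\<^sup>+x\<in>Q - S'. B (norm (jac u' x)) \<partial>lebesgue)"
  proof -
    have "(1/2) / 4 / 2^k * m \<le> (1 - \<delta>/2) / 4 / 2^k * m"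
      using Suc.prems m by (intro mult_right_mono divide_right_mono) auto
    then have "m / (32 * 2^k) \<le> vol S / 4" using u(5) by simp
    then have "B s * ennreal (m / (32 * 2^k)) \<le> B s * ennreal (vol S / 4)"
      by (intro mult_left_mono ennreal_leI) auto
    also note v(9)
    finally show ?thesis
      unfolding splitB by (simp add: s_def[symmetric] add_mono u(8))
  qed
  show ?case
    using u v 1 2 3 4 unfolding m_def[symmetric]
    by (intro exI[of _ u'] exI[of _ S']) (simp add: s_def mult_ac order_trans[OF v(3) u(3)])
qed

text \<open>Round j acts on a set of measure at most \<open>vol Q / 4^j\<close>, and the symmetric
  part there is at most 3 g_j. The innermost set is left out of the integral because its gradient is
  skew and costs nothing.\<close>

lemma skew_staircase:
  fixes p q :: "'n::finite" and Q :: "(real^'n) set" and A :: "real \<Rightarrow> ennreal" and g :: "nat \<Rightarrow> real"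
  assumes pq: "p \<noteq> q" and Q: "open Q" "bounded Q" and g: "\<And>j. 0 < g j"
    and Amono: "\<And>x y. 0 \<le> x \<Longrightarrow> x \<le> y \<Longrightarrow> A x \<le> A y"
  shows "0 < \<delta> \<Longrightarrow> \<delta> \<le> 1 \<Longrightarrow> \<exists>u S. (\<forall>i. test_fun Q (\<lambda>y. u y $ i)) \<and> open S \<and> S \<subseteq> Q \<and>
    (\<forall>x\<in>S. jac u x = plane p q (\<Sum>j<k. g j) (- (\<Sum>j<k. g j))) \<and>
    (1 - \<delta>) / 4^k * vol Q \<le> vol S \<and> vol S \<le> vol Q / 4^k \<and>
    (\<integral>\<^sup>+x\<in>Q - S. A (norm (symm (jac u x))) \<partial>lebesgue) \<le> (\<Sum>j<k. A (3 * g j) * ennreal (vol Q / 4^j))"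
proof (induction k arbitrary: \<delta>)
  case 0
  have "(1 - \<delta>) * vol Q \<le> 1 * vol Q"
    using 0 by (intro mult_right_mono) auto
  then show ?case
    using Q by (intro exI[of _ "\<lambda>x. 0"] exI[of _ Q]) (simp add: test_fun_zero jac_zero)
next
  case (Suc k)
  define m where "m = vol Q"
  have m: "0 \<le> m" by (simp add: m_def)
  define a where "a = (\<Sum>j<k. g j)"
  have \<delta>2: "0 < \<delta>/2" "\<delta>/2 \<le> 1" using Suc.prems by auto
  obtain u S where u: "\<And>i. test_fun Q (\<lambda>y. u y $ i)" "open S" "S \<subseteq> Q"
    "\<And>x. x \<in> S \<Longrightarrow> jac u x = plane p q a (- a)"
    "(1 - \<delta>/2) / 4^k * m \<le> vol S" "vol S \<le> m / 4^k"
    "(\<integral>\<^sup>+x\<in>Q - S. A (norm (symm (jac u x))) \<partial>lebesgue) \<le> (\<Sum>j<k. A (3 * g j) * ennreal (m / 4^j))"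
    using Suc.IH[OF \<delta>2] unfolding m_def a_def by blast
  have bS: "bounded S" using Q u(3) bounded_subset by blast
  obtain u' and S' R' :: "(real^'n) set"
    where v: "\<And>i. test_fun Q (\<lambda>y. u' y $ i)" "open S'" "open R'" "S' \<subseteq> S" "R' \<subseteq> S"
    "\<And>x. x \<notin> S \<Longrightarrow> jac u' x = jac u x"
    "\<And>x. x \<in> S' \<Longrightarrow> jac u' x = plane p q (a + g k) (- a + g k)"
    "\<And>x. x \<in> R' \<Longrightarrow> jac u' x = plane p q (a + g k) (- (a + g k))"
    "\<And>x. x \<in> S \<Longrightarrow> norm (symm (jac u' x)) \<le> 3 * g k"
    "(1 - \<delta>/2) / 4 * vol S \<le> vol S'" "vol S' \<le> vol S / 4"
    "(1 - \<delta>/2) / 4 * vol S \<le> vol R'" "vol R' \<le> vol S / 4"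
    by (rule skew_round[OF pq u(2) bS u(3) g \<delta>2]) (rule u(1), erule u(4), rule that)
  have mA: "(\<lambda>x. A (norm (symm (jac u' x)))) \<in> borel_measurable lebesgue"
    by (rule mono_norm_measurable[OF Amono borel_measurable_jac(2)[OF v(1)]])
  have splitA: "(\<integral>\<^sup>+x\<in>Q - R'. A (norm (symm (jac u' x))) \<partial>lebesgue) =
      (\<integral>\<^sup>+x\<in>Q - S. A (norm (symm (jac u x))) \<partial>lebesgue) + (\<integral>\<^sup>+x\<in>S - R'. A (norm (symm (jac u' x))) \<partial>lebesgue)"
    by (rule set_nn_integral_step[OF mA u(2) v(3) Q(1) v(5) u(3)]) (simp add: v(6))
  have 1: "(\<integral>\<^sup>+x\<in>Q - R'. A (norm (symm (jac u' x))) \<partial>lebesgue) \<le> (\<Sum>j<Suc k. A (3 * g j) * ennreal (m / 4^j))"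
  proof -
    have "(\<integral>\<^sup>+x\<in>S - R'. A (norm (symm (jac u' x))) \<partial>lebesgue) \<le> (\<integral>\<^sup>+x\<in>S. A (norm (symm (jac u' x))) \<partial>lebesgue)"
      by (rule set_nn_integral_mono_set) blast
    also have "\<dots> \<le> A (3 * g k) * ennreal (vol S)"
      using u(2) bS v(9) Amono by (intro set_nn_integral_le_const lmeasurable_open) auto
    also have "\<dots> \<le> A (3 * g k) * ennreal (m / 4^k)"
      using u(6) by (intro mult_left_mono ennreal_leI) auto
    finally show ?thesis unfolding splitA by (simp add: add_mono u(7))
  qed
  have 2: "(1 - \<delta>) / 4 ^ Suc k * m \<le> vol R'"
  proof -
    have "(1 - \<delta>/2) * (1 - \<delta>/2) = 1 - \<delta> + (\<delta>/2) * (\<delta>/2)" by (simp add: algebra_simps)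
    then have "1 - \<delta> \<le> (1 - \<delta>/2) * (1 - \<delta>/2)" using zero_le_square[of "\<delta>/2"] by linarith
    then have "(1 - \<delta>) * (m / 4^Suc k) \<le> (1 - \<delta>/2) * (1 - \<delta>/2) * (m / 4^Suc k)"
      using m by (intro mult_right_mono) auto
    also have "\<dots> = (1 - \<delta>/2) / 4 * ((1 - \<delta>/2) / 4^k * m)" by simp
    also have "\<dots> \<le> (1 - \<delta>/2) / 4 * vol S"
      using u(5) \<delta>2 by (intro mult_left_mono) auto
    finally show ?thesis using v(12) by simp
  qed
  have 3: "vol R' \<le> m / 4 ^ Suc k" using v(13) u(6) by simp
  show ?case
    using v 1 2 3 unfolding m_def[symmetric]
    by (intro exI[of _ u'] exI[of _ R']) (simp add: a_def order_trans[OF v(5) u(3)])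
qed

section \<open>Integration by parts\<close>

lemma integrable_compact_support:
  fixes f :: "'a::euclidean_space \<Rightarrow> 'b::euclidean_space"
  assumes "compact K" "continuous_on UNIV f" "\<And>x. x \<notin> K \<Longrightarrow> f x = 0"
  shows "integrable lborel f" "integrable lebesgue f"
proof -
  have "(\<lambda>x. indicator K x *\<^sub>R f x) = f"
    using assms(3) by (auto simp: indicator_def)
  then show "integrable lborel f"
    using borel_integrable_compact[of K f] assms continuous_on_subset[of UNIV f K] by simp
  then show "integrable lebesgue f"
    using assms(2) by (subst integrable_completion) (auto intro: borel_measurable_continuous_onI)
qed

lemma test_fun_integrable:
  assumes "test_fun U f"
  shows "integrable lborel f" "integrable lebesgue f"
proof -
  obtain K where "compact K" "K \<subseteq> U" "\<And>x. x \<notin> K \<Longrightarrow> f x = 0"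
    using test_fun_support[OF assms] by blast
  with integrable_compact_support[of K f] smooth_continuous[OF test_fun_smooth[OF assms]]
  show "integrable lborel f" "integrable lebesgue f" by auto
qed

lemma test_fun_bounded:
  assumes "test_fun U f"
  obtains M where "0 < M" "\<And>x. \<bar>f x\<bar> \<le> M"
proof -
  obtain K where K: "compact K" "K \<subseteq> U" "\<And>x. x \<notin> K \<Longrightarrow> f x = 0"
    by (rule test_fun_support[OF assms]) (rule that)
  have "bounded (f ` K)"
    by (intro compact_imp_bounded compact_continuous_image K
        continuous_on_subset[OF smooth_continuous[OF test_fun_smooth[OF assms]] subset_UNIV])
  then obtain M where M: "0 < M" "\<And>x. x \<in> K \<Longrightarrow> \<bar>f x\<bar> \<le> M"
    unfolding bounded_pos by auto
  show thesis
  proof (rule that[OF M(1)])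
    show "\<bar>f x\<bar> \<le> M" for x using M K(3)[of x] by (cases "x \<in> K") auto
  qed
qed

lemma pd_has_real_derivative:
  assumes "smooth_fun f"
  shows "((\<lambda>t. f (x + t *\<^sub>R axis j 1)) has_real_derivative pd f j (x + t *\<^sub>R axis j 1)) (at t)"
proof -
  have d: "((\<lambda>t. x + t *\<^sub>R axis j 1) has_derivative (\<lambda>s. s *\<^sub>R axis j 1)) (at t)"
    by (auto intro!: derivative_eq_intros)
  from has_derivative_compose[OF d smooth_has_derivative[OF assms]]
  have *: "((\<lambda>t. f (x + t *\<^sub>R axis j 1)) has_derivative
      (\<lambda>s. frechet_derivative f (at (x + t *\<^sub>R axis j 1)) (s *\<^sub>R axis j 1))) (at t)" .
  show ?thesis
  proof (rule has_derivative_imp_has_field_derivative[OF *])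
    show "s * pd f j (x + t *\<^sub>R axis j 1) = frechet_derivative f (at (x + t *\<^sub>R axis j 1)) (s *\<^sub>R axis j 1)" for s
      using linear_cmul[OF has_derivative_linear[OF smooth_has_derivative[OF assms]], of "x + t *\<^sub>R axis j 1" s "axis j 1"]
      by (simp add: pd_def)
  qed
qed

text \<open>Translation invariance of Lebesgue measure applied to difference quotients.\<close>

lemma integral_pd_zero:
  fixes f :: "real^'n \<Rightarrow> real"
  assumes f: "test_fun U f"
  shows "integral\<^sup>L lborel (pd f j) = 0"
proof -
  have sf: "smooth_fun f" by (rule test_fun_smooth[OF f])
  obtain K where K: "compact K" "K \<subseteq> U" "\<And>x. x \<notin> K \<Longrightarrow> f x = 0"
    by (rule test_fun_support[OF f]) (rule that)
  obtain r where r: "\<And>x. x \<in> K \<Longrightarrow> norm x \<le> r"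
    using compact_imp_bounded[OF K(1)] unfolding bounded_iff by blast
  obtain M where M: "0 < M" "\<And>x. \<bar>pd f j x\<bar> \<le> M"
    by (rule test_fun_bounded[OF test_fun_pd[OF f]]) (rule that)
  define e :: "real^'n" where "e = axis j 1"
  define h where "h n = 1 / real (Suc n)" for n
  have h: "0 < h n" "h n \<le> 1" for n by (auto simp: h_def)
  define D where "D n x = (f (x + h n *\<^sub>R e) - f x) / h n" for n x
  \<comment> \<open>The mean value theorem serves twice: it yields the pointwise limit of the
    difference quotients and their bound by \<open>M\<close>. Since the increments are at most 1,
    the quotients vanish outside the ball of radius r + 1.\<close>
  have mvt: "\<exists>z. 0 < z \<and> z < h n \<and> D n x = pd f j (x + z *\<^sub>R e)" for n x
  proof -
    have "\<exists>z>0. z < h n \<and> f (x + h n *\<^sub>R axis j 1) - f (x + 0 *\<^sub>R axis j 1) = (h n - 0) * pd f j (x + z *\<^sub>R axis j 1)"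
      by (rule MVT2[OF h(1), where f = "\<lambda>t. f (x + t *\<^sub>R axis j 1)" and f' = "\<lambda>t. pd f j (x + t *\<^sub>R axis j 1)"])
         (rule pd_has_real_derivative[OF sf])
    then obtain z where z: "0 < z" "z < h n"
      "f (x + h n *\<^sub>R axis j 1) - f (x + 0 *\<^sub>R axis j 1) = (h n - 0) * pd f j (x + z *\<^sub>R axis j 1)"
      by auto
    then show ?thesis
      using h(1)[of n] by (intro exI[of _ z]) (simp add: D_def e_def)
  qed
  have int_f: "integrable lborel f" by (rule test_fun_integrable[OF f])
  have int_shift: "integrable lborel (\<lambda>x. f (x + c)) \<and> (\<integral>x. f (x + c) \<partial>lborel) = (\<integral>x. f x \<partial>lborel)" for c
  proof -
    have fm: "f \<in> borel_measurable borel"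
      by (rule borel_measurable_continuous_onI) (rule smooth_continuous[OF sf])
    have "integrable (distr lborel borel ((+) c)) f"
      using int_f by (simp add: lborel_distr_plus)
    then have 1: "integrable lborel (\<lambda>x. f (c + x))"
      using fm by (subst (asm) integrable_distr_eq) auto
    have "(\<integral>x. f x \<partial>distr lborel borel ((+) c)) = (\<integral>x. f (c + x) \<partial>lborel)"
      using fm by (intro integral_distr) auto
    then show ?thesis using 1 by (simp add: lborel_distr_plus add.commute)
  qed
  have zero: "(\<integral>x. D n x \<partial>lborel) = 0" for n
    using int_shift[of "h n *\<^sub>R e"] int_f by (simp add: D_def)
  have cont: "continuous_on UNIV (pd f j)" by (rule smooth_continuous[OF smooth_pd[OF sf]])
  have "(\<lambda>n. \<integral>x. D n x \<partial>lborel) \<longlonglongrightarrow> integral\<^sup>L lborel (pd f j)"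
  proof (rule integral_dominated_convergence)
    show "pd f j \<in> borel_measurable lborel"
      using borel_measurable_continuous_onI[OF cont] by simp
    show "D n \<in> borel_measurable lborel" for n
      using borel_measurable_integrable int_shift[of "h n *\<^sub>R e"] int_f
      unfolding D_def[abs_def] by (intro borel_measurable_divide borel_measurable_diff) auto
    show "integrable lborel (\<lambda>x. indicator (cball 0 (r + 1)) x *\<^sub>R M)"
      by (rule borel_integrable_compact) auto
    show "AE x in lborel. (\<lambda>n. D n x) \<longlonglongrightarrow> pd f j x"
    proof (rule AE_I2)
      fix x
      have "\<forall>n. \<exists>z. 0 < z \<and> z < h n \<and> D n x = pd f j (x + z *\<^sub>R e)" using mvt by blast
      from choice[OF this] obtain z where
        z: "\<And>n. 0 < z n" "\<And>n. z n < h n" "\<And>n. D n x = pd f j (x + z n *\<^sub>R e)"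
        by blast
      have "h \<longlonglongrightarrow> 0" unfolding h_def using LIMSEQ_inverse_real_of_nat by (simp add: inverse_eq_divide)
      then have "z \<longlonglongrightarrow> 0"
        using z(1,2) by (intro tendsto_sandwich[OF _ _ tendsto_const, of 0 z sequentially h]) (auto intro!: always_eventually simp: less_imp_le)
      then have "(\<lambda>n. x + z n *\<^sub>R e) \<longlonglongrightarrow> x + 0 *\<^sub>R e" by (intro tendsto_intros)
      then have "(\<lambda>n. pd f j (x + z n *\<^sub>R e)) \<longlonglongrightarrow> pd f j x"
        using cont by (intro isCont_tendsto_compose[of x "pd f j"]) (auto simp: continuous_on_eq_continuous_at)
      then show "(\<lambda>n. D n x) \<longlonglongrightarrow> pd f j x" using z(3) by simp
    qed
    show "AE x in lborel. norm (D n x) \<le> indicator (cball 0 (r + 1)) x *\<^sub>R M" for n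
    proof (rule AE_I2)
      fix x
      show "norm (D n x) \<le> indicator (cball 0 (r + 1)) x *\<^sub>R M"
      proof (cases "x \<in> cball 0 (r + 1)")
        case True
        then show ?thesis using mvt[of n x] M(2) by auto
      next
        case False
        then have nx: "r + 1 < norm x" by simp
        have "norm x \<le> norm (x + h n *\<^sub>R e) + norm (h n *\<^sub>R e)" by (metis add_diff_cancel norm_triangle_ineq4)
        moreover have "norm (h n *\<^sub>R e) \<le> 1" using h[of n] by (simp add: e_def)
        ultimately have "x + h n *\<^sub>R e \<notin> K" "x \<notin> K" using nx r by fastforce+
        then show ?thesis using K(3) False by (simp add: D_def)
      qed
    qed
  qed
  then show ?thesis unfolding zero using LIMSEQ_unique[OF tendsto_const] by metis
qed

lemma pd_mult:
  assumes "smooth_fun f" "smooth_fun g"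
  shows "pd (\<lambda>x. f x * g x) j x = f x * pd g j x + pd f j x * g x"
  using pd_eq[OF has_derivative_mult[OF smooth_has_derivative[OF assms(1)] smooth_has_derivative[OF assms(2)]]]
  by (simp add: pd_def)

lemma test_fun_mult:
  assumes "smooth_fun f" "test_fun U g"
  shows "test_fun U (\<lambda>x. f x * g x)"
proof -
  obtain K where "compact K" "K \<subseteq> U" "\<And>x. x \<notin> K \<Longrightarrow> g x = 0"
    using test_fun_support[OF assms(2)] by blast
  then show ?thesis
    using assms by (intro test_funI[of _ K]) (auto intro: smooth_mult test_fun_smooth)
qed

text \<open>Leads from the set integrals in the definitions of weak derivatives to Borel integrals
  over the whole space, where the translation argument lives.\<close>

lemma set_integral_test_fun:
  assumes "test_fun U f"
  shows "(LINT x:U|lebesgue. f x) = integral\<^sup>L lborel f"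
proof -
  obtain K where K: "compact K" "K \<subseteq> U" "\<And>x. x \<notin> K \<Longrightarrow> f x = 0"
    by (rule test_fun_support[OF assms]) (rule that)
  have ind: "indicator U x *\<^sub>R f x = f x" for x
    using K(2,3) by (cases "x \<in> U") auto
  then have "(LINT x:U|lebesgue. f x) = integral\<^sup>L lebesgue f" by (simp only: set_lebesgue_integral_def ind)
  also have "\<dots> = integral\<^sup>L lborel f"
    using smooth_continuous[OF test_fun_smooth[OF assms]]
    by (intro integral_completion) (auto intro: borel_measurable_continuous_onI)
  finally show ?thesis .
qed

lemma integration_by_parts:
  fixes v :: "real^'n \<Rightarrow> real"
  assumes v: "smooth_fun v" and \<phi>: "test_fun U \<phi>"
  shows "integral\<^sup>L lborel (\<lambda>x. v x * pd \<phi> j x) = - integral\<^sup>L lborel (\<lambda>x. pd v j x * \<phi> x)"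
proof -
  have t: "test_fun U (\<lambda>x. v x * pd \<phi> j x)" "test_fun U (\<lambda>x. pd v j x * \<phi> x)"
    using test_fun_mult[OF v test_fun_pd[OF \<phi>]] test_fun_mult[OF smooth_pd[OF v] \<phi>] by auto
  have "integral\<^sup>L lborel (\<lambda>x. v x * pd \<phi> j x + pd v j x * \<phi> x) = 0"
    using integral_pd_zero[OF test_fun_mult[OF v \<phi>], of j]
    by (simp add: pd_mult[OF v test_fun_smooth[OF \<phi>]] cong: Bochner_Integration.integral_cong)
  then show ?thesis
    using test_fun_integrable(1)[OF t(1)] test_fun_integrable(1)[OF t(2)] by simp
qed

lemma loc_int_continuous:
  fixes f :: "'a::euclidean_space \<Rightarrow> real"
  assumes "continuous_on UNIV f"
  shows "loc_int U f"
  unfolding loc_int_def set_integrable_def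
proof (intro allI impI)
  fix K assume "compact K \<and> K \<subseteq> U"
  then have "integrable lborel (\<lambda>x. indicator K x *\<^sub>R f x)"
    using assms by (intro borel_integrable_compact) (auto intro: continuous_on_subset)
  moreover from this have "(\<lambda>x. indicator K x *\<^sub>R f x) \<in> borel_measurable lborel"
    by (rule borel_measurable_integrable)
  ultimately show "integrable lebesgue (\<lambda>x. indicator K x *\<^sub>R f x)"
    by (subst integrable_completion)
qed

lemma weak_grad_jac:
  assumes u: "\<And>i. smooth_fun (\<lambda>y. u y $ i)"
  shows "weak_grad U u (jac u)"
  unfolding weak_grad_def
proof (intro conjI allI impI)
  show "loc_int U (\<lambda>x. u x $ i)" for i by (intro loc_int_continuous smooth_continuous u)
  show "loc_int U (\<lambda>x. jac u x $ i $ j)" for i j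
    unfolding jac_nth by (intro loc_int_continuous smooth_continuous smooth_pd u)
  fix \<phi> i j assume \<phi>: "test_fun U \<phi>"
  show "(LINT x:U|lebesgue. u x $ i * pd \<phi> j x) = - (LINT x:U|lebesgue. jac u x $ i $ j * \<phi> x)"
    unfolding jac_nth set_integral_test_fun[OF test_fun_mult[OF u test_fun_pd[OF \<phi>]]]
      set_integral_test_fun[OF test_fun_mult[OF smooth_pd[OF u] \<phi>]]
    by (rule integration_by_parts[OF u \<phi>])
qed

lemma weak_symgrad_symm_jac:
  assumes u: "\<And>i. smooth_fun (\<lambda>y. u y $ i)"
  shows "weak_symgrad U u (\<lambda>x. symm (jac u x))"
  unfolding weak_symgrad_def
proof (intro conjI allI impI)
  show "loc_int U (\<lambda>x. u x $ i)" for i by (intro loc_int_continuous smooth_continuous u)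
  show "loc_int U (\<lambda>x. symm (jac u x) $ i $ j)" for i j
    unfolding symm_nth jac_nth
    by (intro loc_int_continuous continuous_intros smooth_continuous smooth_pd u) simp
  fix \<phi> i j assume \<phi>: "test_fun U \<phi>"
  have t1: "test_fun U (\<lambda>x. u x $ i * pd \<phi> j x)" for i j by (rule test_fun_mult[OF u test_fun_pd[OF \<phi>]])
  have t2: "test_fun U (\<lambda>x. pd (\<lambda>y. u y $ i) j x * \<phi> x)" for i j by (rule test_fun_mult[OF smooth_pd[OF u] \<phi>])
  have eq: "symm (jac u x) $ i $ j * \<phi> x = (1/2) * (pd (\<lambda>y. u y $ i) j x * \<phi> x + pd (\<lambda>y. u y $ j) i x * \<phi> x)" for x
    by (simp add: symm_nth jac_nth field_simps)
  have "(LINT x:U|lebesgue. u x $ i * pd \<phi> j x + u x $ j * pd \<phi> i x)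
      = integral\<^sup>L lborel (\<lambda>x. u x $ i * pd \<phi> j x) + integral\<^sup>L lborel (\<lambda>x. u x $ j * pd \<phi> i x)"
    unfolding set_integral_test_fun[OF test_fun_add[OF t1 t1]]
    by (rule Bochner_Integration.integral_add) (rule test_fun_integrable[OF t1])+
  also have "\<dots> = - 2 * ((1/2) * (integral\<^sup>L lborel (\<lambda>x. pd (\<lambda>y. u y $ i) j x * \<phi> x) + integral\<^sup>L lborel (\<lambda>x. pd (\<lambda>y. u y $ j) i x * \<phi> x)))"
    by (simp add: integration_by_parts[OF u \<phi>])
  also have "(integral\<^sup>L lborel (\<lambda>x. pd (\<lambda>y. u y $ i) j x * \<phi> x) + integral\<^sup>L lborel (\<lambda>x. pd (\<lambda>y. u y $ j) i x * \<phi> x))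
      = integral\<^sup>L lborel (\<lambda>x. pd (\<lambda>y. u y $ i) j x * \<phi> x + pd (\<lambda>y. u y $ j) i x * \<phi> x)"
    by (rule Bochner_Integration.integral_add[symmetric]) (rule test_fun_integrable[OF t2])+
  also have "(1/2) * \<dots> = (LINT x:U|lebesgue. symm (jac u x) $ i $ j * \<phi> x)"
    unfolding eq set_integral_test_fun[OF test_fun_mult[OF smooth_const test_fun_add[OF t2 t2]]]
    by simp
  finally show "(LINT x:U|lebesgue. u x $ i * pd \<phi> j x + u x $ j * pd \<phi> i x)
      = - 2 * (LINT x:U|lebesgue. symm (jac u x) $ i $ j * \<phi> x)" .
qed

section \<open>Young functions and the Korn inequality in modular form\<close>

lemma young_zero: "young_function A \<Longrightarrow> A 0 = 0"
  by (simp add: young_function_def)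

lemma young_scale_le:
  assumes "young_function A" "0 \<le> l" "l \<le> 1" "0 \<le> x"
  shows "A (l * x) \<le> ennreal l * A x"
proof -
  have "A (l * x + (1 - l) * 0) \<le> ennreal l * A x + ennreal (1 - l) * A 0"
    using assms unfolding young_function_def by blast
  then show ?thesis by (simp add: young_zero[OF assms(1)])
qed

lemma young_mono:
  assumes "young_function A" "0 \<le> x" "x \<le> y"
  shows "A x \<le> A y"
proof (cases "y = 0")
  case True
  then show ?thesis using assms by simp
next
  case False
  then have y: "0 < y" using assms by simp
  have "A (x / y * y) \<le> ennreal (x / y) * A y"
    using assms y by (intro young_scale_le) auto
  also have "\<dots> \<le> 1 * A y"
    using assms y by (intro mult_right_mono) auto
  finally show ?thesis using y by simp
qed

text \<open>Convexity together with \<open>A 0 = 0\<close>. This is how constant factors in front of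
  a Young function are moved into its argument.\<close>

lemma young_scale_ge:
  assumes "young_function A" "1 \<le> c" "0 \<le> x"
  shows "ennreal c * A x \<le> A (c * x)"
proof -
  have "A (1/c * (c * x)) \<le> ennreal (1/c) * A (c * x)"
    using assms by (intro young_scale_le) auto
  then have "ennreal c * A x \<le> ennreal c * (ennreal (1/c) * A (c * x))"
    using assms by (intro mult_left_mono) auto
  also have "\<dots> = A (c * x)"
    using assms by (simp add: mult.assoc[symmetric] ennreal_mult[symmetric])
  finally show ?thesis .
qed

text \<open>\<open>A\<close> may jump to infinity, so the argument starts at a point of finite value
  and scales down from there by convexity.\<close>

lemma young_small:
  assumes "young_function A" "0 < \<eta>"
  obtains x where "0 < x" "A x \<le> ennreal \<eta>"
proof -
  obtain t where t: "0 < t" "A t \<noteq> \<infinity>" using assms(1) unfolding young_function_def by blast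
  define a where "a = enn2real (A t)"
  have a: "0 \<le> a" "A t = ennreal a" using t by (auto simp: a_def less_top)
  define l where "l = min 1 (\<eta> / (a + 1))"
  have pos: "0 < \<eta> / (a + 1)" using a assms(2) by simp
  have l: "0 < l" "l \<le> 1" "l \<le> \<eta> / (a + 1)" using pos by (auto simp: l_def)
  have "l * (a + 1) \<le> \<eta>" using l(3) a by (subst (asm) pos_le_divide_eq) auto
  then have "l * a \<le> \<eta>" using l by (simp add: algebra_simps)
  have "A (l * t) \<le> ennreal l * A t" using l t by (intro young_scale_le assms) auto
  also have "\<dots> \<le> ennreal \<eta>"
    using \<open>l * a \<le> \<eta>\<close> a l by (simp add: ennreal_mult[symmetric] ennreal_leI)
  finally show thesis using l t by (intro that[of "l * t"]) auto
qed

section \<open>Test fields as admissible competitors\<close>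

lemma in_orlicz_compact_support:
  fixes f :: "'a::euclidean_space \<Rightarrow> 'b::euclidean_space"
  assumes A: "young_function A" and K: "compact K" "\<And>x. x \<notin> K \<Longrightarrow> f x = 0" and cont: "continuous_on UNIV f"
  shows "in_orlicz A UNIV f"
proof -
  have "bounded (f ` K)"
    by (intro compact_imp_bounded compact_continuous_image K continuous_on_subset[OF cont subset_UNIV])
  then obtain M where M: "0 < M" "\<And>x. x \<in> K \<Longrightarrow> norm (f x) \<le> M"
    unfolding bounded_pos by auto
  define m where "m = vol K"
  have m: "0 \<le> m" by (simp add: m_def)
  obtain s where s: "0 < s" "A s \<le> ennreal (1 / (m + 1))"
  proof (rule young_small[OF A])
    show "0 < 1 / (m + 1)" using m by simp
  qed
  \<comment> \<open>M / s is an admissible parameter in the Luxemburg norm: dividing by it brings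
    the values of f below s, and \<open>A s\<close> times the volume of \<open>K\<close> is at most
    m / (m + 1).\<close>
  have l: "0 < M / s" using M s by simp
  have "(\<integral>\<^sup>+x\<in>UNIV. A (norm (f x) / (M / s)) \<partial>lebesgue) \<le> (\<integral>\<^sup>+x\<in>K. A (norm (f x) / (M / s)) \<partial>lebesgue)"
    using K(2) young_zero[OF A] by (intro nn_integral_mono) (auto split: split_indicator)
  also have "\<dots> \<le> ennreal (1 / (m + 1)) * ennreal (vol K)"
  proof (rule set_nn_integral_le_const)
    show "K \<in> lmeasurable" using K(1) by (rule lmeasurable_compact)
    fix x assume "x \<in> K"
    then have "norm (f x) / (M / s) \<le> M / (M / s)"
      using l by (intro divide_right_mono M) auto
    then have "norm (f x) / (M / s) \<le> s" using M by simp
    then have "A (norm (f x) / (M / s)) \<le> A s" using M s by (intro young_mono[OF A]) auto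
    then show "A (norm (f x) / (M / s)) \<le> ennreal (1 / (m + 1))" using s(2) by (rule order_trans)
  qed
  also have "\<dots> = ennreal (m / (m + 1))"
    using m by (simp add: m_def[symmetric] ennreal_mult[symmetric])
  also have "\<dots> \<le> 1" using m by simp
  finally have "ennreal (M / s) \<in> {ennreal l |l. l > 0 \<and> (\<integral>\<^sup>+ x\<in>UNIV. A (norm (f x) / l) \<partial>lebesgue) \<le> 1}"
    using l by blast
  then have "orlicz_norm A UNIV f \<le> ennreal (M / s)"
    unfolding orlicz_norm_def by (rule Inf_lower)
  also have "\<dots> < \<infinity>" by simp
  finally have "orlicz_norm A UNIV f < \<infinity>" .
  moreover have "f \<in> borel_measurable lebesgue"
    using cont by (intro measurable_completion) (auto intro: borel_measurable_continuous_onI)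
  ultimately show ?thesis
    by (simp add: in_orlicz_def set_borel_measurable_def)
qed

lemma test_fun_common_support:
  fixes u :: "real^'n \<Rightarrow> real^'n"
  assumes u: "\<And>i. test_fun U (\<lambda>y. u y $ i)"
  obtains K where "compact K" "K \<subseteq> U" "\<And>x. x \<notin> K \<Longrightarrow> u x = 0" "\<And>x. x \<notin> K \<Longrightarrow> jac u x = 0"
proof -
  have "\<forall>i. \<exists>K. compact K \<and> K \<subseteq> U \<and> (\<forall>x. x \<notin> K \<longrightarrow> u x $ i = 0)"
    using test_fun_support[OF u] by metis
  from choice[OF this] obtain K where K: "\<And>i. compact (K i)" "\<And>i. K i \<subseteq> U" "\<And>i x. x \<notin> K i \<Longrightarrow> u x $ i = 0"
    by blast
  have t: "test_fun (K i) (\<lambda>y. u y $ i)" for i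
    by (rule test_funI[OF test_fun_smooth[OF u] K(1) order_refl K(3)])
  show thesis
  proof (rule that[of "\<Union>i\<in>UNIV. K i"])
    show "compact (\<Union>i\<in>UNIV. K i)" using K(1) by (intro compact_UN) auto
    show "(\<Union>i\<in>UNIV. K i) \<subseteq> U" using K(2) by blast
    show "u x = 0" if "x \<notin> (\<Union>i\<in>UNIV. K i)" for x
      using that K(3) by (simp add: vec_eq_iff)
    show "jac u x = 0" if "x \<notin> (\<Union>i\<in>UNIV. K i)" for x
      using that pd_outside[OF t] by (simp add: vec_eq_iff jac_nth)
  qed
qed

text \<open>The extension by zero is \<open>u\<close> itself, the constant sequence \<open>u\<close>
  witnesses zero boundary values, and continuity with compact support gives finite Luxemburg
  norms.\<close>

lemma test_fun_admissible:
  fixes u :: "real^'n \<Rightarrow> real^'n"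
  assumes A: "young_function A" and u: "\<And>i. test_fun \<Omega> (\<lambda>y. u y $ i)"
  shows "in_W110 \<Omega> u (jac u)" "in_EA0 A \<Omega> u" "weak_symgrad \<Omega> u (\<lambda>x. symm (jac u x))"
proof -
  have su: "smooth_fun (\<lambda>y. u y $ i)" for i by (rule test_fun_smooth[OF u])
  show "weak_symgrad \<Omega> u (\<lambda>x. symm (jac u x))" by (rule weak_symgrad_symm_jac[OF su])
  obtain K where K: "compact K" "K \<subseteq> \<Omega>" "\<And>x. x \<notin> K \<Longrightarrow> u x = 0" "\<And>x. x \<notin> K \<Longrightarrow> jac u x = 0"
    by (rule test_fun_common_support[OF u]) (rule that)
  have cu: "continuous_on UNIV u"
  proof -
    have "continuous_on UNIV (\<lambda>x. \<chi> i. u x $ i)"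
      by (rule continuous_on_vec_lambda) (rule smooth_continuous[OF su])
    then show ?thesis by simp
  qed
  have cj: "continuous_on UNIV (jac u)" by (rule continuous_jac[OF su])
  have cs: "continuous_on UNIV (\<lambda>x. symm (jac u x))"
  proof (rule continuous_on_compose2[OF _ cj])
    show "continuous_on UNIV (symm :: real^'n^'n \<Rightarrow> _)"
      using linear_symm linear_continuous_on linear_conv_bounded_linear by blast
  qed simp
  have si: "set_integrable lebesgue \<Omega> f" if "continuous_on UNIV f" "\<And>x. x \<notin> K \<Longrightarrow> f x = 0"
    for f :: "real^'n \<Rightarrow> 'b::euclidean_space"
  proof -
    have ind: "indicator \<Omega> x *\<^sub>R f x = f x" for x
      using K(2) that(2) by (cases "x \<in> \<Omega>") auto
    have "integrable lebesgue f"
      by (rule integrable_compact_support(2)[OF K(1) that(1)]) (rule that(2))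
    then show ?thesis
      unfolding set_integrable_def by (simp only: ind)
  qed
  have "in_W11 \<Omega> u (jac u)"
    unfolding in_W11_def using si[OF cu K(3)] si[OF cj K(4)] weak_grad_jac[OF su] by blast
  then show "in_W110 \<Omega> u (jac u)"
    unfolding in_W110_def using u by (auto intro!: exI[of _ "\<lambda>_. u"] simp: set_integrable_def)
  have "(\<lambda>x. if x \<in> \<Omega> then u x else 0) = u" using K(2,3) by fastforce
  moreover have "in_orlicz A UNIV u" by (rule in_orlicz_compact_support[OF A K(1,3) cu])
  moreover have "in_orlicz A UNIV (\<lambda>x. symm (jac u x))"
    by (rule in_orlicz_compact_support[OF A K(1) _ cs]) (simp add: K(4) linear_0[OF linear_symm])
  ultimately show "in_EA0 A \<Omega> u"
    unfolding in_EA0_def in_EA_def using weak_symgrad_symm_jac[OF su] by auto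
qed

text \<open>The norm inequality becomes an implication between modulars. As the Luxemburg norm is an
  infimum, the strict inequality C < C' provides an admissible \<open>l\<close> below C' L, and
  monotonicity of \<open>B\<close> passes from \<open>l\<close> to C' L.\<close>

lemma korn_modular:
  fixes u :: "real^'n \<Rightarrow> real^'n"
  assumes A: "young_function A" and B: "young_function B"
    and korn: "\<forall>u G E. in_W110 \<Omega> u G \<and> in_EA0 A \<Omega> u \<and> weak_symgrad \<Omega> u E \<longrightarrow>
           orlicz_norm B \<Omega> G \<le> ennreal C * orlicz_norm A \<Omega> E"
    and C': "0 < C'" "C < C'" and u: "\<And>i. test_fun \<Omega> (\<lambda>y. u y $ i)" and L: "0 < L"
    and le1: "(\<integral>\<^sup>+x\<in>\<Omega>. A (norm (symm (jac u x)) / L) \<partial>lebesgue) \<le> 1"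
  shows "(\<integral>\<^sup>+x\<in>\<Omega>. B (norm (jac u x) / (C' * L)) \<partial>lebesgue) \<le> 1"
proof -
  have "ennreal L \<in> {ennreal l |l. l > 0 \<and> (\<integral>\<^sup>+x\<in>\<Omega>. A (norm (symm (jac u x)) / l) \<partial>lebesgue) \<le> 1}"
    using L le1 by blast
  then have "orlicz_norm A \<Omega> (\<lambda>x. symm (jac u x)) \<le> ennreal L"
    unfolding orlicz_norm_def by (rule Inf_lower)
  then have "orlicz_norm B \<Omega> (jac u) \<le> ennreal C * ennreal L"
    using korn test_fun_admissible[OF A u] by (meson mult_left_mono order_trans zero_le)
  also have "\<dots> < ennreal (C' * L)"
  proof (cases "0 \<le> C")
    case True
    then show ?thesis using C' L by (simp add: ennreal_mult[symmetric] ennreal_less_iff)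
  next
    \<comment> \<open>For negative \<open>C\<close> the factor \<open>ennreal C\<close> is 0, and
      the right-hand side is still positive.\<close>
    case False
    then show ?thesis using C' L by (simp add: ennreal_neg)
  qed
  finally obtain y where y: "y \<in> {ennreal l |l. l > 0 \<and> (\<integral>\<^sup>+x\<in>\<Omega>. B (norm (jac u x) / l) \<partial>lebesgue) \<le> 1}"
    "y < ennreal (C' * L)"
    unfolding orlicz_norm_def Inf_less_iff by blast
  then obtain l where l: "0 < l" "(\<integral>\<^sup>+x\<in>\<Omega>. B (norm (jac u x) / l) \<partial>lebesgue) \<le> 1" "ennreal l < ennreal (C' * L)"
    by blast
  then have "l \<le> C' * L" using C' L by (simp add: ennreal_less_iff)
  then have "(\<integral>\<^sup>+x\<in>\<Omega>. B (norm (jac u x) / (C' * L)) \<partial>lebesgue) \<le> (\<integral>\<^sup>+x\<in>\<Omega>. B (norm (jac u x) / l) \<partial>lebesgue)"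
    using l(1) C' L by (intro nn_integral_mono mult_right_mono young_mono[OF B] divide_left_mono) auto
  then show ?thesis using l(2) by (rule order_trans)
qed

section \<open>Geometric partitions, sums of suprema and boxes of prescribed volume\<close>

lemma geometric_bracket:
  fixes q t t0 :: real
  assumes "1 < q" "0 < t0" "t0 \<le> t"
  obtains m where "t0 * q ^ m \<le> t" "t \<le> t0 * q ^ Suc m"
proof -
  obtain n where "t / t0 < q ^ n" using real_arch_pow[OF assms(1)] by blast
  then have "t \<le> t0 * q ^ n" using assms(2) by (simp add: pos_divide_less_eq mult.commute less_imp_le)
  moreover have "t \<le> t0 * q ^ n \<Longrightarrow> \<exists>m. t0 * q ^ m \<le> t \<and> t \<le> t0 * q ^ Suc m" for n
  proof (induction n)
    case 0
    then have "t = t0" using assms by simp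
    then show ?case using assms by (intro exI[of _ 0]) simp
  next
    case (Suc n)
    show ?case
    proof (cases "t \<le> t0 * q ^ n")
      case False
      then show ?thesis using Suc.prems by (intro exI[of _ n]) simp
    qed (use Suc.IH in blast)
  qed
  ultimately show thesis using that by blast
qed

lemma geometric_interval_cover:
  fixes q t0 :: real
  assumes "t0 \<le> s" "s \<le> t0 * q ^ m" "0 < m"
  shows "\<exists>k<m. t0 * q ^ k \<le> s \<and> s \<le> t0 * q ^ Suc k"
  using assms(2,3)
proof (induction m)
  case (Suc m)
  show ?case
  proof (cases "0 < m \<and> s \<le> t0 * q ^ m")
    case True
    then show ?thesis using Suc.IH less_SucI by blast
  next
    case False
    then have "t0 * q ^ m \<le> s" using assms(1) by auto
    then show ?thesis using Suc.prems by blast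
  qed
qed simp

text \<open>An upper sum over a geometric partition: on the k-th cell \<open>F\<close> is bounded by
  its value at the right end, 1/s^2 by its value at the left end, and the length is q - 1 times the
  left end.\<close>

lemma geometric_integral_le:
  fixes F :: "real \<Rightarrow> ennreal" and q t0 t :: real
  assumes "0 < t0" "1 < q" "0 < m" and mono: "\<And>x y. t0 \<le> x \<Longrightarrow> x \<le> y \<Longrightarrow> F x \<le> F y"
    and t: "t \<le> t0 * q ^ m"
  shows "(\<integral>\<^sup>+s\<in>{t0..t}. F s / ennreal (s\<^sup>2) \<partial>lborel)
    \<le> (\<Sum>k<m. F (t0 * q ^ Suc k) * ennreal ((q - 1) / (t0 * q ^ k)))"
proof -
  define S where "S k = t0 * q ^ k" for k
  have S: "0 < S k" "S k \<le> S (Suc k)" "t0 \<le> S k" for k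
    using assms(1,2) by (auto simp: S_def mult_left_mono one_le_power)
  define c where "c k = F (S (Suc k)) * ennreal (1 / (S k)\<^sup>2)" for k
  have "F s / ennreal (s\<^sup>2) * indicator {t0..t} s \<le> (\<Sum>k<m. c k * indicator {S k..S (Suc k)} s)" for s
  proof (cases "s \<in> {t0..t}")
    case True
    then obtain k where k: "k < m" "S k \<le> s" "s \<le> S (Suc k)"
      using geometric_interval_cover[of t0 s q m] t assms(3) unfolding S_def by auto
    have s: "0 < s" using k(2) S(1)[of k] by simp
    have "F s / ennreal (s\<^sup>2) = F s * ennreal (1 / s\<^sup>2)"
      using s by (simp add: divide_ennreal_def inverse_ennreal inverse_eq_divide)
    also have "\<dots> \<le> c k"
      unfolding c_def
    proof (intro mult_mono ennreal_leI)
      show "F s \<le> F (S (Suc k))" using True k(3) by (intro mono) auto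
      show "1 / s\<^sup>2 \<le> 1 / (S k)\<^sup>2"
        using k(2) S(1)[of k] by (intro divide_left_mono power_mono mult_pos_pos) auto
    qed auto
    also have "\<dots> = c k * indicator {S k..S (Suc k)} s" using k by simp
    also have "\<dots> \<le> (\<Sum>k<m. c k * indicator {S k..S (Suc k)} s)"
      using k(1) by (intro member_le_sum) auto
    finally show ?thesis using True by simp
  qed simp
  then have "(\<integral>\<^sup>+s\<in>{t0..t}. F s / ennreal (s\<^sup>2) \<partial>lborel) \<le> (\<integral>\<^sup>+s. (\<Sum>k<m. c k * indicator {S k..S (Suc k)} s) \<partial>lborel)"
    by (intro nn_integral_mono)
  also have "\<dots> = (\<Sum>k<m. c k * ennreal (S (Suc k) - S k))"
    using S(2) by (subst nn_integral_sum) (auto simp: nn_integral_cmult_indicator)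
  also have "\<dots> = (\<Sum>k<m. F (t0 * q ^ Suc k) * ennreal ((q - 1) / (t0 * q ^ k)))"
  proof (rule sum.cong[OF refl])
    fix k
    have "1 / (S k)\<^sup>2 * (S (Suc k) - S k) = (q - 1) / S k"
    proof -
      have "S (Suc k) - S k = (q - 1) * S k" by (simp add: S_def algebra_simps)
      then show ?thesis using S(1)[of k] by (simp add: power2_eq_square)
    qed
    then show "c k * ennreal (S (Suc k) - S k) = F (t0 * q ^ Suc k) * ennreal ((q - 1) / (t0 * q ^ k))"
      using S(2)[of k] by (simp add: c_def S_def mult.assoc ennreal_mult[symmetric])
  qed
  finally show ?thesis .
qed

text \<open>The choices for different indices are independent, so a bound for all selections passes
  to the sum of the suprema. The last term is moved into the remainder \<open>y\<close>, which is
  why \<open>y\<close> is general; a supremum over a nonempty set commutes with adding a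
  constant.\<close>

lemma sum_SUP_le:
  fixes f :: "nat \<Rightarrow> 'a \<Rightarrow> ennreal"
  assumes R: "\<And>k. R k \<noteq> {}"
  shows "(\<And>g. (\<And>k. g k \<in> R k) \<Longrightarrow> (\<Sum>k<m. f k (g k)) + y \<le> X) \<Longrightarrow> (\<Sum>k<m. SUP r\<in>R k. f k r) + y \<le> X"
proof (induction m arbitrary: y)
  case 0
  have "\<forall>k. \<exists>r. r \<in> R k" using R by blast
  from choice[OF this] obtain g where "\<And>k. g k \<in> R k" by blast
  from 0[OF this] show ?case by simp
next
  case (Suc m)
  have "(\<Sum>k<m. SUP r\<in>R k. f k r) + (f m r + y) \<le> X" if "r \<in> R m" for r
  proof (rule Suc.IH)
    fix g assume g: "\<And>k. g k \<in> R k"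
    have "(\<Sum>k<Suc m. f k ((g(m := r)) k)) + y \<le> X"
      by (rule Suc.prems) (use g that in auto)
    moreover have "(\<Sum>k<m. f k ((g(m := r)) k)) = (\<Sum>k<m. f k (g k))"
      by (intro sum.cong) auto
    ultimately show "(\<Sum>k<m. f k (g k)) + (f m r + y) \<le> X" by (simp add: add.assoc)
  qed
  then have "(SUP r\<in>R m. (\<Sum>k<m. SUP r\<in>R k. f k r) + (f m r + y)) \<le> X"
    by (intro SUP_least)
  then show ?case
    by (simp add: ennreal_SUP_add_right[OF R, symmetric] ennreal_SUP_add_left[OF R] add.assoc)
qed

text \<open>The volume has to be met exactly, since it will be tuned to t. A cube of side e / n fits
  into a ball of radius e, and shrinking a single side realises every smaller volume.\<close>

lemma open_box_of_measure:
  fixes \<Omega> :: "(real^'n) set"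
  assumes "open \<Omega>" "\<Omega> \<noteq> {}"
  obtains v0 where "0 < v0"
    "\<And>v. 0 < v \<Longrightarrow> v \<le> v0 \<Longrightarrow> \<exists>Q. open Q \<and> bounded Q \<and> Q \<subseteq> \<Omega> \<and> vol Q = v"
proof -
  obtain x e where x: "0 < e" "ball x e \<subseteq> \<Omega>"
    using assms open_contains_ball by blast
  define h where "h = e / CARD('n)"
  have h: "0 < h" using x by (simp add: h_def)
  define v0 where "v0 = h ^ CARD('n)"
  have v0: "0 < v0" using h by (simp add: v0_def)
  fix p :: 'n
  have p: "\<exists>Q. open Q \<and> bounded Q \<and> Q \<subseteq> \<Omega> \<and> vol Q = v" if v: "0 < v" "v \<le> v0" for v
  proof -
    define l where "l i = (if i = p then h * (v / v0) else h)" for i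
    have l: "0 < l i" "l i \<le> h" for i
      using h v v0 mult_left_le[of "v / v0" h] by (auto simp: l_def)
    define Q where "Q = box x (x + (\<chi> i. l i))"
    have "Q \<subseteq> ball x e"
    proof
      fix y assume "y \<in> Q"
      then have y: "\<bar>(y - x) $ i\<bar> < h" for i
        using l(2)[of i] by (auto simp: Q_def mem_box_cart dest!: spec[of _ i])
      have "norm (y - x) \<le> (\<Sum>i\<in>UNIV. \<bar>(y - x) $ i\<bar>)" by (rule norm_le_l1_cart)
      also have "\<dots> < (\<Sum>i\<in>(UNIV::'n set). h)" using y by (intro sum_strict_mono) auto
      also have "\<dots> = e" by (simp add: h_def)
      finally show "y \<in> ball x e" by (simp add: dist_norm norm_minus_commute)
    qed
    moreover have "vol Q = v"
    proof -
      have "vol Q = (\<Prod>i\<in>UNIV. l i)"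
        unfolding Q_def using l(1) by (subst measure_box_cart) (auto simp: less_imp_le)
      also have "\<dots> = h * (v / v0) * (\<Prod>i\<in>UNIV - {p}. l i)"
        by (subst prod.remove[of _ p]) (auto simp: l_def)
      also have "(\<Prod>i\<in>UNIV - {p}. l i) = h ^ (CARD('n) - 1)"
        by (subst prod.cong[OF refl, where h = "\<lambda>_. h"]) (auto simp: l_def)
      also have "h * (v / v0) * h ^ (CARD('n) - 1) = (v / v0) * v0"
        unfolding v0_def by (metis (no_types, lifting) mult.commute mult.left_commute power_minus_mult zero_less_card_finite)
      finally show ?thesis using v0 by simp
    qed
    ultimately show ?thesis using x(2) by (intro exI[of _ Q]) (auto simp: Q_def)
  qed
  show thesis by (rule that[OF v0 p])
qed

section \<open>The two inequalities\<close>

lemma two_indices_exist: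
  assumes "CARD('n::finite) \<ge> 2"
  shows "\<exists>p q :: 'n::finite. p \<noteq> q"
proof (rule ccontr)
  assume "\<not> ?thesis"
  then have "(UNIV :: 'n set) = {undefined}" by auto
  then have "CARD('n) = card {undefined :: 'n}" by (rule arg_cong)
  with assms show False by simp
qed

lemma set_nn_integral_outside:
  assumes "\<And>x. x \<notin> Q \<Longrightarrow> f x = 0"
  shows "(\<integral>\<^sup>+x\<in>\<Omega>. f x \<partial>M) \<le> (\<integral>\<^sup>+x\<in>Q. f x \<partial>M)"
  using assms by (intro nn_integral_mono) (auto split: split_indicator)

text \<open>The \<open>A\<close>-budget 1 is divided into 1/4 for the initial round
  (\<open>small\<close>), 1/4 for the later rounds as \<delta>, and 1/2 for the innermost set
  (\<open>peak\<close>). So \<open>korn_modular\<close> applies with L = 1, and the staircase is run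
  with \<open>B (x / C')\<close> to match its conclusion.\<close>

lemma concentration_estimate:
  fixes p q :: "'n::finite" and \<Omega> Q :: "(real^'n) set"
  assumes pq: "p \<noteq> q" and A: "young_function A" and B: "young_function B"
    and korn: "\<forall>u G E. in_W110 \<Omega> u G \<and> in_EA0 A \<Omega> u \<and> weak_symgrad \<Omega> u E \<longrightarrow>
           orlicz_norm B \<Omega> G \<le> ennreal C * orlicz_norm A \<Omega> E"
    and C': "0 < C'" "C < C'" and Q: "open Q" "bounded Q" "Q \<subseteq> \<Omega>"
    and fin: "\<And>x. 0 \<le> x \<Longrightarrow> A x < \<infinity>" and s0: "0 < s0"
    and small: "A (3 * s0) * ennreal (vol Q) \<le> ennreal (1/4)"
    and peak: "A (2 * (s0 * 2^m)) * ennreal (vol Q / 4 / 2^m) \<le> ennreal (1/2)"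
  shows "(\<Sum>j<m. B (s0 * 2^j / C') * ennreal (vol Q / (32 * 2^j))) \<le> 1"
proof -
  define v where "v = vol Q"
  have B': "B (x / C') \<le> B (y / C')" if "0 \<le> x" "x \<le> y" for x y
    using that C' by (intro young_mono[OF B] divide_right_mono) auto
  have A': "A x \<le> A y" if "0 \<le> x" "x \<le> y" for x y
    by (rule young_mono[OF A that])
  have "\<exists>u S. (\<forall>i. test_fun Q (\<lambda>y. u y $ i)) \<and> open S \<and> S \<subseteq> Q \<and>
    (\<forall>x\<in>S. jac u x = plane p q (s0 * 2^m) (s0 * 2^m)) \<and>
    (1 - 1/4) / 4 / 2^m * vol Q \<le> vol S \<and> vol S \<le> vol Q / 4 / 2^m \<and>
    (\<integral>\<^sup>+x\<in>Q - S. A (norm (symm (jac u x))) \<partial>lebesgue) \<le> A (3 * s0) * ennreal (vol Q) + ennreal (1/4) \<and>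
    (\<Sum>j<m. B (s0 * 2^j / C') * ennreal (vol Q / (32 * 2^j))) \<le> (\<integral>\<^sup>+x\<in>Q - S. B (norm (jac u x) / C') \<partial>lebesgue)"
    by (rule concentration_staircase[where A = A and B = "\<lambda>x. B (x / C')", OF pq Q(1,2) s0 fin A' young_zero[OF A] B']) auto
  then obtain u S where u: "\<And>i. test_fun Q (\<lambda>y. u y $ i)" "open S" "S \<subseteq> Q"
    "\<And>x. x \<in> S \<Longrightarrow> jac u x = plane p q (s0 * 2^m) (s0 * 2^m)"
    "vol S \<le> v / 4 / 2^m"
    "(\<integral>\<^sup>+x\<in>Q - S. A (norm (symm (jac u x))) \<partial>lebesgue) \<le> A (3 * s0) * ennreal v + ennreal (1/4)"
    "(\<Sum>j<m. B (s0 * 2^j / C') * ennreal (v / (32 * 2^j))) \<le> (\<integral>\<^sup>+x\<in>Q - S. B (norm (jac u x) / C') \<partial>lebesgue)"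
    unfolding v_def by blast
  have jac0: "jac u x = 0" if "x \<notin> Q" for x
    using pd_outside[OF u(1) that] by (simp add: vec_eq_iff jac_nth)
  have mA: "(\<lambda>x. A (norm (symm (jac u x)))) \<in> borel_measurable lebesgue"
    by (rule mono_norm_measurable[where A = A, OF A' borel_measurable_jac(2)[OF u(1)]])
  have "(\<integral>\<^sup>+x\<in>\<Omega>. A (norm (symm (jac u x))) \<partial>lebesgue) \<le> (\<integral>\<^sup>+x\<in>Q. A (norm (symm (jac u x))) \<partial>lebesgue)"
    by (rule set_nn_integral_outside) (simp add: jac0 linear_0[OF linear_symm] young_zero[OF A])
  also have "\<dots> = (\<integral>\<^sup>+x\<in>(Q - S) \<union> S. A (norm (symm (jac u x))) \<partial>lebesgue)"
    using u(3) by (simp add: Un_absorb2)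
  also have "\<dots> = (\<integral>\<^sup>+x\<in>Q - S. A (norm (symm (jac u x))) \<partial>lebesgue) + (\<integral>\<^sup>+x\<in>S. A (norm (symm (jac u x))) \<partial>lebesgue)"
    using mA Q(1) u(2) by (intro nn_integral_disjoint_pair) (auto simp: borel_open)
  also have "\<dots> \<le> (ennreal (1/4) + ennreal (1/4)) + ennreal (1/2)"
  proof (rule add_mono)
    show "(\<integral>\<^sup>+x\<in>Q - S. A (norm (symm (jac u x))) \<partial>lebesgue) \<le> ennreal (1/4) + ennreal (1/4)"
      using u(6) add_right_mono[OF small] unfolding v_def by (rule order_trans)
    have "(\<integral>\<^sup>+x\<in>S. A (norm (symm (jac u x))) \<partial>lebesgue) \<le> A (2 * (s0 * 2^m)) * ennreal (vol S)"
    proof (rule set_nn_integral_le_const)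
      show "S \<in> lmeasurable" using u(2,3) Q(2) bounded_subset lmeasurable_open by blast
      show "A (norm (symm (jac u x))) \<le> A (2 * (s0 * 2^m))" if "x \<in> S" for x
        using norm_symm_plane_le[of p q "s0 * 2^m" "s0 * 2^m"] s0 u(4)[OF that] by (intro A') auto
    qed
    also have "\<dots> \<le> A (2 * (s0 * 2^m)) * ennreal (v / 4 / 2^m)"
      using u(5) by (intro mult_left_mono ennreal_leI) auto
    also note peak[folded v_def]
    finally show "(\<integral>\<^sup>+x\<in>S. A (norm (symm (jac u x))) \<partial>lebesgue) \<le> ennreal (1/2)" .
  qed
  also have "\<dots> = ennreal (1/4 + 1/4 + 1/2)" by (simp only: ennreal_plus)
  also have "\<dots> = 1" by simp
  finally have "(\<integral>\<^sup>+x\<in>\<Omega>. A (norm (symm (jac u x)) / 1) \<partial>lebesgue) \<le> 1" by simp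
  then have "(\<integral>\<^sup>+x\<in>\<Omega>. B (norm (jac u x) / (C' * 1)) \<partial>lebesgue) \<le> 1"
    by (intro korn_modular[OF A B korn C' test_fun_mono[OF u(1) Q(3)]]) auto
  moreover have "(\<integral>\<^sup>+x\<in>Q - S. B (norm (jac u x) / C') \<partial>lebesgue) \<le> (\<integral>\<^sup>+x\<in>\<Omega>. B (norm (jac u x) / C') \<partial>lebesgue)"
    using Q(3) by (intro set_nn_integral_mono_set) blast
  ultimately show ?thesis using u(7) unfolding v_def by simp
qed

text \<open>\<open>W\<close> bounds the \<open>A\<close>-cost of the skew staircase after division
  by 3. By convexity a further division by 1 + W brings the modular below 1, so L = 3(1 + W) is
  admissible. On the \<open>B\<close> side only the innermost set is kept, with measure at least
  half of the ideal value.\<close>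

lemma skew_estimate:
  fixes p q :: "'n::finite" and \<Omega> Q :: "(real^'n) set"
  assumes pq: "p \<noteq> q" and A: "young_function A" and B: "young_function B"
    and korn: "\<forall>u G E. in_W110 \<Omega> u G \<and> in_EA0 A \<Omega> u \<and> weak_symgrad \<Omega> u E \<longrightarrow>
           orlicz_norm B \<Omega> G \<le> ennreal C * orlicz_norm A \<Omega> E"
    and C': "0 < C'" "C < C'" and Q: "open Q" "bounded Q" "Q \<subseteq> \<Omega>"
    and g: "\<And>j. 0 < g j" and a: "\<And>j. A (g j) = ennreal (a j)" "\<And>j. 0 \<le> a j"
    and W: "W = (\<Sum>j<m. a j * (vol Q / 4^j))"
  shows "B ((\<Sum>j<m. g j) / (3 * C' * (1 + W))) * ennreal (vol Q / (2 * 4^m)) \<le> 1"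
proof -
  define v where "v = vol Q"
  have v: "0 \<le> v" by (simp add: v_def)
  have W0: "0 \<le> W" unfolding W using a(2) by (intro sum_nonneg) auto
  \<comment> \<open>The staircase is run with the dilated function \<open>A (x / 3)\<close>, so that
    its cost 3 g_j is evaluated as A(g_j).\<close>
  have A': "A (x / 3) \<le> A (y / 3)" if "0 \<le> x" "x \<le> y" for x y
    using that by (intro young_mono[OF A]) auto
  have "\<exists>u S. (\<forall>i. test_fun Q (\<lambda>y. u y $ i)) \<and> open S \<and> S \<subseteq> Q \<and>
    (\<forall>x\<in>S. jac u x = plane p q (\<Sum>j<m. g j) (- (\<Sum>j<m. g j))) \<and>
    (1 - 1/2) / 4^m * vol Q \<le> vol S \<and> vol S \<le> vol Q / 4^m \<and>
    (\<integral>\<^sup>+x\<in>Q - S. A (norm (symm (jac u x)) / 3) \<partial>lebesgue) \<le> (\<Sum>j<m. A (3 * g j / 3) * ennreal (vol Q / 4^j))"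
    by (rule skew_staircase[where A = "\<lambda>x. A (x / 3)" and g = g, OF pq Q(1,2) g A']) auto
  then obtain u S where u: "\<And>i. test_fun Q (\<lambda>y. u y $ i)" "open S" "S \<subseteq> Q"
    "\<And>x. x \<in> S \<Longrightarrow> jac u x = plane p q (\<Sum>j<m. g j) (- (\<Sum>j<m. g j))"
    "(1 - 1/2) / 4^m * v \<le> vol S"
    "(\<integral>\<^sup>+x\<in>Q - S. A (norm (symm (jac u x)) / 3) \<partial>lebesgue) \<le> (\<Sum>j<m. A (3 * g j / 3) * ennreal (v / 4^j))"
    unfolding v_def by blast
  have vS: "v / (2 * 4^m) \<le> vol S" using u(5) by simp
  have "(\<Sum>j<m. A (3 * g j / 3) * ennreal (v / 4^j)) = ennreal W"
  proof -
    have "A (3 * g j / 3) * ennreal (v / 4^j) = ennreal (a j * (v / 4^j))" for j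
      using a v ennreal_mult[of "a j" "v / 4^j"] by simp
    then show ?thesis
      unfolding W v_def[symmetric] using a(2) v by (simp only:) (intro sum_ennreal, simp)
  qed
  with u(6) have uW: "(\<integral>\<^sup>+x\<in>Q - S. A (norm (symm (jac u x)) / 3) \<partial>lebesgue) \<le> ennreal W" by (simp only:)
  have jac0: "jac u x = 0" if "x \<notin> Q" for x
    using pd_outside[OF u(1) that] by (simp add: vec_eq_iff jac_nth)
  have S0: "symm (jac u x) = 0" if "x \<in> S" for x
    using norm_symm_plane_le[of p q "\<Sum>j<m. g j" "- (\<Sum>j<m. g j)"] u(4)[OF that] by simp
  have mA: "(\<lambda>x. A (norm (symm (jac u x)) / 3)) \<in> borel_measurable lebesgue"
    by (rule mono_norm_measurable[where A = "\<lambda>x. A (x / 3)", OF A' borel_measurable_jac(2)[OF u(1)]])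
  define L where "L = 3 * (1 + W)"
  have L: "0 < L" using W0 by (simp add: L_def)
  have "(\<integral>\<^sup>+x\<in>\<Omega>. A (norm (symm (jac u x)) / L) \<partial>lebesgue) \<le> (\<integral>\<^sup>+x\<in>Q - S. A (norm (symm (jac u x)) / L) \<partial>lebesgue)"
    by (rule set_nn_integral_outside) (use S0 in \<open>auto simp: jac0 linear_0[OF linear_symm] young_zero[OF A]\<close>)
  also have "\<dots> \<le> (\<integral>\<^sup>+x. ennreal (1 / (1 + W)) * (A (norm (symm (jac u x)) / 3) * indicator (Q - S) x) \<partial>lebesgue)"
  proof (intro nn_integral_mono)
    fix x
    have "A (1 / (1 + W) * (norm (symm (jac u x)) / 3)) \<le> ennreal (1 / (1 + W)) * A (norm (symm (jac u x)) / 3)"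
      using W0 by (intro young_scale_le[OF A]) auto
    moreover have "1 / (1 + W) * (norm (symm (jac u x)) / 3) = norm (symm (jac u x)) / L"
      by (simp add: L_def)
    ultimately show "A (norm (symm (jac u x)) / L) * indicator (Q - S) x
        \<le> ennreal (1 / (1 + W)) * (A (norm (symm (jac u x)) / 3) * indicator (Q - S) x)"
      by (auto split: split_indicator)
  qed
  also have "\<dots> = ennreal (1 / (1 + W)) * (\<integral>\<^sup>+x\<in>Q - S. A (norm (symm (jac u x)) / 3) \<partial>lebesgue)"
  proof -
    have "Q - S \<in> sets lebesgue" using Q(1) u(2) by (intro sets.Diff) (auto simp: borel_open)
    then show ?thesis
      using mA by (intro nn_integral_cmult borel_measurable_times_ennreal borel_measurable_indicator)
  qed
  also have "\<dots> \<le> ennreal (1 / (1 + W)) * ennreal W"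
    using uW by (intro mult_left_mono) auto
  also have "\<dots> \<le> 1" using W0 by (simp add: ennreal_mult[symmetric])
  finally have "(\<integral>\<^sup>+x\<in>\<Omega>. A (norm (symm (jac u x)) / L) \<partial>lebesgue) \<le> 1" .
  then have le1: "(\<integral>\<^sup>+x\<in>\<Omega>. B (norm (jac u x) / (C' * L)) \<partial>lebesgue) \<le> 1"
    by (rule korn_modular[OF A B korn C' test_fun_mono[OF u(1) Q(3)] L])
  have "B ((\<Sum>j<m. g j) / (3 * C' * (1 + W))) * ennreal (v / (2 * 4^m))
      \<le> B ((\<Sum>j<m. g j) / (3 * C' * (1 + W))) * ennreal (vol S)"
    using vS by (intro mult_left_mono ennreal_leI) auto
  also have "\<dots> \<le> (\<integral>\<^sup>+x\<in>S. B (norm (jac u x) / (C' * L)) \<partial>lebesgue)"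
  proof (rule set_nn_integral_ge_const)
    show "S \<in> lmeasurable" using u(2,3) Q(2) bounded_subset lmeasurable_open by blast
    fix x assume "x \<in> S"
    have g0: "0 \<le> (\<Sum>j<m. g j)" using g by (intro sum_nonneg) (auto intro: less_imp_le)
    have "(\<Sum>j<m. g j) \<le> norm (jac u x)"
      using norm_plane_ge[OF pq, of "\<Sum>j<m. g j" "- (\<Sum>j<m. g j)"] u(4)[OF \<open>x \<in> S\<close>] by simp
    then have "(\<Sum>j<m. g j) / (C' * L) \<le> norm (jac u x) / (C' * L)"
      using C' L by (intro divide_right_mono) auto
    moreover have eq: "3 * C' * (1 + W) = C' * L"
      by (simp add: L_def)
    moreover have "0 \<le> (\<Sum>j<m. g j) / (C' * L)"
      using g0 C' L by simp
    ultimately show "B ((\<Sum>j<m. g j) / (3 * C' * (1 + W))) \<le> B (norm (jac u x) / (C' * L))"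
      unfolding eq by (intro young_mono[OF B])
  qed
  also have "\<dots> \<le> (\<integral>\<^sup>+x\<in>\<Omega>. B (norm (jac u x) / (C' * L)) \<partial>lebesgue)"
    using u(3) Q(3) by (intro set_nn_integral_mono_set) blast
  also note le1
  finally show ?thesis unfolding v_def .
qed

text \<open>If \<open>A\<close> takes the value infinity, starting beyond that point settles the
  claim. Otherwise, for each t a staircase climbs from a fixed height to one comparable with t, in a
  region whose volume is tuned to A(ct). The resulting bound controls a dyadic upper sum of the
  integral.\<close>

lemma first_inequality:
  fixes \<Omega> :: "(real^'n) set" and p q :: 'n
  assumes pq: "p \<noteq> q" and \<Omega>: "open \<Omega>" "\<Omega> \<noteq> {}" and A: "young_function A" and B: "young_function B"
    and korn: "\<forall>u G E. in_W110 \<Omega> u G \<and> in_EA0 A \<Omega> u \<and> weak_symgrad \<Omega> u E \<longrightarrow>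
           orlicz_norm B \<Omega> G \<le> ennreal C * orlicz_norm A \<Omega> E"
  shows "\<exists>c t0. 0 < c \<and> 0 < t0 \<and>
    (\<forall>t\<ge>t0. ennreal t * (\<integral>\<^sup>+s\<in>{t0..t}. B s / ennreal (s\<^sup>2) \<partial>lborel) \<le> A (c * t))"
proof (cases "\<forall>x\<ge>0. A x < \<infinity>")
  case False
  then obtain x where x: "0 \<le> x" "\<not> A x < \<infinity>" by blast
  then have x: "0 \<le> x" "A x = \<infinity>" by (metis infinity_ennreal_def less_top)+
  have "A (1 * t) = \<infinity>" if "x + 1 \<le> t" for t
    using young_mono[OF A x(1), of t] that x(2) by (simp add: top_unique)
  then show ?thesis
    using x(1) by (intro exI[of _ 1] exI[of _ "x + 1"]) auto
next
  case True
  then have fin: "A x < \<infinity>" if "0 \<le> x" for x using that by blast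
  obtain t0 where t0: "0 < t0" "A t0 \<noteq> 0" using A unfolding young_function_def by blast
  define a0 where "a0 = enn2real (A t0)"
  have a0: "0 < a0" "A t0 = ennreal a0"
    using t0 fin[of t0] by (auto simp: a0_def enn2real_positive_iff less_top zero_less_iff_neq_zero)
  define C' where "C' = max C 0 + 1"
  have C': "0 < C'" "C < C'" by (auto simp: C'_def)
  \<comment> \<open>The factor C' cancels the division by C' in
    \<open>concentration_estimate\<close>, so that \<open>B\<close> is sampled at t0 2^j.\<close>
  define s0 where "s0 = C' * t0"
  have s0: "0 < s0" using C' t0 by (simp add: s0_def)
  obtain v1 where v1: "0 < v1"
    "\<And>v. 0 < v \<Longrightarrow> v \<le> v1 \<Longrightarrow> \<exists>Q. open Q \<and> bounded Q \<and> Q \<subseteq> \<Omega> \<and> vol Q = v"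
    by (rule open_box_of_measure[OF \<Omega>]) (rule that)
  define k3 where "k3 = enn2real (A (3 * s0))"
  have k3: "0 \<le> k3" "A (3 * s0) = ennreal k3"
    using fin[of "3 * s0"] s0 by (auto simp: k3_def less_top)
  \<comment> \<open>The second entry keeps the cost of the initial round at most 1/4 for every
    volume up to \<open>v0\<close>.\<close>
  define v0 where "v0 = min v1 (1 / (4 * k3 + 4))"
  have v0: "0 < v0" "v0 \<le> v1" "v0 \<le> 1 / (4 * k3 + 4)"
    using v1(1) k3(1) by (auto simp: v0_def)
  have k3v: "k3 * v \<le> 1/4" if "0 \<le> v" "v \<le> v0" for v
  proof -
    have "k3 * v \<le> k3 * (1 / (4 * k3 + 4))" using that v0(3) k3(1) by (intro mult_left_mono) auto
    also have "\<dots> \<le> 1/4" using k3(1) by (simp add: field_simps)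
    finally show ?thesis .
  qed
  \<comment> \<open>The entry 1 gives t0 \<le> c t; 8 C' puts the peak height 2 s0 2^m below c t;
    the last entry, with the linear growth of \<open>A\<close> beyond t0, makes the volume
    \<open>v\<close> at most \<open>v0\<close>.\<close>
  define c where "c = max (max 1 (8 * C')) (4 / (v0 * a0))"
  have c: "1 \<le> c" "8 * C' \<le> c" "4 / (v0 * a0) \<le> c" by (auto simp: c_def)
  have "ennreal t * (\<integral>\<^sup>+s\<in>{t0..t}. B s / ennreal (s\<^sup>2) \<partial>lborel) \<le> A ((16 * c) * t)" if t: "t0 \<le> t" for t
  proof -
    have tpos: "0 < t" using t t0 by simp
    obtain M where M: "t0 * 2 ^ M \<le> t" "t \<le> t0 * 2 ^ Suc M"
      by (rule geometric_bracket[of 2 t0 t]) (use t0 t in auto)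
    define \<alpha> where "\<alpha> = enn2real (A (c * t))"
    have \<alpha>: "0 \<le> \<alpha>" "A (c * t) = ennreal \<alpha>"
      using fin[of "c * t"] c tpos by (auto simp: \<alpha>_def less_top)
    have "ennreal (c * t / t0) * A t0 \<le> A (c * t / t0 * t0)"
    proof (rule young_scale_ge[OF A])
      have "t0 \<le> c * t" using mult_mono[of 1 c t0 t] c t t0 by simp
      then show "1 \<le> c * t / t0" using t0 by simp
    qed (use t0 in simp)
    then have \<alpha>low: "c * t / t0 * a0 \<le> \<alpha>"
      using t0 a0 \<alpha> c tpos by (simp add: ennreal_mult[symmetric])
    have "4 / (v0 * a0) * (t / t0 * a0) \<le> c * (t / t0 * a0)"
      using c(3) tpos t0 a0 by (intro mult_right_mono) auto
    then have "4 * t / (t0 * v0) \<le> c * t / t0 * a0"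
      using a0 v0 t0 by (simp add: mult_ac)
    with \<alpha>low have \<alpha>v0: "4 * t / (t0 * v0) \<le> \<alpha>" by (rule order_trans[rotated])
    have \<alpha>pos: "0 < \<alpha>"
    proof -
      have "0 < 4 * t / (t0 * v0)" using tpos t0 v0 by simp
      then show ?thesis using \<alpha>v0 by linarith
    qed
    \<comment> \<open>The largest affordable volume up to a constant: the peak cost \<alpha> v / (4
      2^m) becomes t / (t0 2^m).\<close>
    define v where "v = 4 * t / (t0 * \<alpha>)"
    have v: "0 < v" using tpos t0 \<alpha>pos by (simp add: v_def)
    have "v \<le> v0"
    proof -
      have "4 * t \<le> \<alpha> * (t0 * v0)"
        using \<alpha>v0 t0 v0 by (simp add: pos_divide_le_eq)
      then show ?thesis
        unfolding v_def using t0 \<alpha>pos by (subst pos_divide_le_eq) (auto simp: mult_ac)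
    qed
    obtain Q where Q: "open Q" "bounded Q" "Q \<subseteq> \<Omega>" "vol Q = v"
      using v1(2)[OF v order_trans[OF \<open>v \<le> v0\<close> v0(2)]] by blast
    \<comment> \<open>The upper sum samples \<open>B\<close> at t0 2^(k+1) for k up to M, so the
      index M + 1 must still lie below m. The same choice gives t / (t0 2^m) \<le> 1/2.\<close>
    define m where "m = Suc (Suc M)"
    have est: "(\<Sum>j<m. B (s0 * 2^j / C') * ennreal (vol Q / (32 * 2^j))) \<le> 1"
    proof (rule concentration_estimate[OF pq A B korn C' Q(1-3) fin s0])
      show "A (3 * s0) * ennreal (vol Q) \<le> ennreal (1 / 4)"
        using k3v[OF less_imp_le[OF v] \<open>v \<le> v0\<close>] k3 v by (simp add: Q(4) ennreal_mult[symmetric] ennreal_leI)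
      have "A (2 * (s0 * 2^m)) \<le> A (c * t)"
      proof (rule young_mono[OF A])
        have "2 * (s0 * 2^m) = 8 * C' * (t0 * 2^M)" by (simp add: s0_def m_def)
        also have "\<dots> \<le> c * t"
          using c(2) M(1) C' t0 c(1) by (intro mult_mono) auto
        finally show "2 * (s0 * 2^m) \<le> c * t" .
      qed (use s0 in simp)
      then have "A (2 * (s0 * 2^m)) * ennreal (v / 4 / 2^m) \<le> ennreal \<alpha> * ennreal (v / 4 / 2^m)"
        unfolding \<alpha>(2) by (rule mult_right_mono) simp
      also have "\<dots> \<le> ennreal (1/2)"
      proof -
        have "\<alpha> * (v / 4 / 2^m) = t / (t0 * 2^m)"
          using \<alpha>pos t0 by (simp add: v_def)
        also have "\<dots> \<le> t0 * 2 ^ Suc M / (t0 * 2^m)"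
          using M(2) t0 by (intro divide_right_mono) auto
        also have "\<dots> = 1/2" using t0 by (simp add: m_def)
        finally have "ennreal (\<alpha> * (v / 4 / 2^m)) \<le> ennreal (1/2)" by (rule ennreal_leI)
        moreover have "ennreal (\<alpha> * (v / 4 / 2^m)) = ennreal \<alpha> * ennreal (v / 4 / 2^m)"
          using \<alpha>(1) v by (intro ennreal_mult) auto
        ultimately show ?thesis by (simp only:)
      qed
      finally show "A (2 * (s0 * 2^m)) * ennreal (vol Q / 4 / 2^m) \<le> ennreal (1/2)"
        unfolding Q(4) .
    qed
    have "(\<integral>\<^sup>+s\<in>{t0..t}. B s / ennreal (s\<^sup>2) \<partial>lborel)
        \<le> (\<Sum>k<Suc M. B (t0 * 2 ^ Suc k) * ennreal ((2 - 1) / (t0 * 2 ^ k)))"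
      by (rule geometric_integral_le[OF t0(1) _ _ _ M(2)]) (use young_mono[OF B] t0 in auto)
    then have "ennreal t * (\<integral>\<^sup>+s\<in>{t0..t}. B s / ennreal (s\<^sup>2) \<partial>lborel)
        \<le> ennreal t * (\<Sum>k<Suc M. B (t0 * 2 ^ Suc k) * ennreal ((2 - 1) / (t0 * 2 ^ k)))"
      by (rule mult_left_mono) simp
    \<comment> \<open>By the choice of \<open>v\<close>, the weight t / (t0 2^k) is 16 \<alpha>
      times the weight v / (32 2^(k+1)) of the next index.\<close>
    also have "\<dots> = (\<Sum>k<Suc M. ennreal (16 * \<alpha>) * (B (s0 * 2^Suc k / C') * ennreal (v / (32 * 2^Suc k))))"
      unfolding sum_distrib_left
    proof (rule sum.cong[OF refl])
      fix k
      have "t * ((2 - 1) / (t0 * 2 ^ k)) = 16 * \<alpha> * (v / (32 * 2^Suc k))"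
        using \<alpha>pos t0 by (simp add: v_def)
      then have e: "ennreal t * ennreal ((2 - 1) / (t0 * 2 ^ k)) = ennreal (16 * \<alpha>) * ennreal (v / (32 * 2^Suc k))"
        using tpos t0 \<alpha>pos v by (simp only: ennreal_mult[symmetric] ennreal_mult'[symmetric] less_imp_le mult_nonneg_nonneg zero_le_numeral)
      have "s0 * 2^Suc k / C' = t0 * 2^Suc k" using C' by (simp add: s0_def)
      then show "ennreal t * (B (t0 * 2 ^ Suc k) * ennreal ((2 - 1) / (t0 * 2 ^ k)))
          = ennreal (16 * \<alpha>) * (B (s0 * 2^Suc k / C') * ennreal (v / (32 * 2^Suc k)))"
        using e by (metis mult.left_commute)
    qed
    also have "\<dots> = ennreal (16 * \<alpha>) * (\<Sum>k<Suc M. B (s0 * 2^Suc k / C') * ennreal (v / (32 * 2^Suc k)))"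
      by (simp only: sum_distrib_left)
    also have "\<dots> \<le> ennreal (16 * \<alpha>) * (\<Sum>j<m. B (s0 * 2^j / C') * ennreal (v / (32 * 2^j)))"
      unfolding m_def sum.lessThan_Suc_shift[of _ "Suc M"] by (intro mult_left_mono) auto
    also have "\<dots> \<le> ennreal (16 * \<alpha>) * 1"
      using est unfolding Q(4) by (intro mult_left_mono) auto
    also have "\<dots> = ennreal 16 * A (c * t)"
      using \<alpha> by (simp add: ennreal_mult)
    also have "\<dots> \<le> A (16 * (c * t))"
      using c tpos by (intro young_scale_ge[OF A]) auto
    finally show ?thesis by (simp add: mult.assoc)
  qed
  then show ?thesis
    using c(1) t0(1) by (intro exI[of _ "16 * c"] exI[of _ t0]) auto
qed

section \<open>The conjugate and the second inequality\<close>

lemma young_conj_mono: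
  assumes "s \<le> t"
  shows "young_conj A s \<le> young_conj A t"
  unfolding young_conj_def
  using assms by (intro SUP_mono) (auto intro!: bexI ennreal_minus_mono ennreal_leI mult_left_mono)

lemma young_conj_ge: "0 \<le> r \<Longrightarrow> ennreal (r * t) - A r \<le> young_conj A t"
  unfolding young_conj_def by (rule SUP_upper) simp

text \<open>Holds for each r separately: multiplying r t - A r by c \<ge> 1 subtracts c A r, which
  is at least A r.\<close>

lemma young_conj_scale:
  assumes "1 \<le> c"
  shows "ennreal c * young_conj A t \<le> young_conj A (c * t)"
  unfolding young_conj_def SUP_mult_left_ennreal
proof (rule SUP_mono)
  fix r :: real assume r: "r \<in> {0..}"
  have "ennreal c * (ennreal (r * t) - A r) \<le> ennreal (r * (c * t)) - A r"
  proof (cases "A r")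
    case (real b)
    have "c * (r * t - b) \<le> r * (c * t) - b"
      using mult_right_mono[OF assms real(1)] by (simp add: algebra_simps)
    then show ?thesis
      using assms real by (simp add: ennreal_minus ennreal_mult'[symmetric] ennreal_leI)
  qed simp
  then show "\<exists>r'\<in>{0..}. ennreal c * (ennreal (r * t) - A r) \<le> ennreal (r' * (c * t)) - A r'"
    using r by blast
qed

text \<open>The discarded r contribute 0, by truncated subtraction or because r = 0. The remaining
  ones are positive with finite \<open>A r\<close>, as required of the step sizes of a skew
  staircase.\<close>

lemma young_conj_eq_SUP_restricted:
  assumes "A 0 = 0" and ne: "{r. 0 < r \<and> A r \<le> ennreal (r * s)} \<noteq> {}"
  shows "young_conj A s \<le> (SUP r\<in>{r. 0 < r \<and> A r \<le> ennreal (r * s)}. ennreal (r * s) - A r)"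
  unfolding young_conj_def
proof (rule SUP_least)
  fix r :: real assume r: "r \<in> {0..}"
  show "ennreal (r * s) - A r \<le> (SUP r\<in>{r. 0 < r \<and> A r \<le> ennreal (r * s)}. ennreal (r * s) - A r)"
  proof (cases "0 < r \<and> A r \<le> ennreal (r * s)")
    case True
    then show ?thesis by (intro SUP_upper) simp
  next
    case False
    then have "ennreal (r * s) - A r = 0"
      using r assms(1) by (cases "r = 0") (auto simp: diff_eq_0_iff_ennreal)
    then show ?thesis by simp
  qed
qed

text \<open>The hypothesis \<open>I\<close> says that the steps g_j gain more than they cost, and it
  turns into a lower bound for the final skew gradient relative to 1 + W.
  \<open>skew_estimate\<close> bounds \<open>B\<close> at the scaled size \<rho> of that gradient,
  and Young's inequality at \<rho> gives the claim. The number 12 is the 3 from the cost times the 4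
  from the shift in the sampling heights.\<close>

lemma skew_conj_estimate:
  fixes p q :: "'n::finite" and \<Omega> Q :: "(real^'n) set"
  assumes pq: "p \<noteq> q" and A: "young_function A" and B: "young_function B"
    and korn: "\<forall>u G E. in_W110 \<Omega> u G \<and> in_EA0 A \<Omega> u \<and> weak_symgrad \<Omega> u E \<longrightarrow>
           orlicz_norm B \<Omega> G \<le> ennreal C * orlicz_norm A \<Omega> E"
    and C': "0 < C'" "C < C'" and Q: "open Q" "bounded Q" "Q \<subseteq> \<Omega>"
    and v: "vol Q = v" "0 < v" and t0: "0 < t0" and y: "0 \<le> y"
    and g: "\<And>j. 0 < g j" and a: "\<And>j. A (g j) = ennreal (a j)" "\<And>j. 0 \<le> a j"
    and I: "1 \<le> (\<Sum>j<m. v / 4^j * (g j * (t0 * 4 ^ Suc j) - a j))"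
  shows "ennreal (y / (12 * C' * v * t0) - 2 * 4^m / v) \<le> young_conj B y"
proof -
  define W where "W = (\<Sum>j<m. a j * (v / 4^j))"
  define \<sigma> where "\<sigma> = (\<Sum>j<m. g j)"
  have W0: "0 \<le> W" unfolding W_def using a(2) v by (intro sum_nonneg) auto
  \<comment> \<open>The weight v / 4^j times the height t0 4^(j+1) equals 4 v t0 for every j, so the
    linear parts sum to a multiple of \<sigma>.\<close>
  have "(\<Sum>j<m. v / 4^j * (g j * (t0 * 4 ^ Suc j) - a j)) + W = (\<Sum>j<m. 4 * v * t0 * g j)"
    unfolding W_def sum.distrib[symmetric] by (intro sum.cong) (auto simp: field_simps)
  then have \<sigma>: "1 + W \<le> 4 * v * t0 * \<sigma>" using I by (simp add: \<sigma>_def sum_distrib_left)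
  define \<rho> where "\<rho> = \<sigma> / (3 * C' * (1 + W))"
  have \<rho>: "1 / (12 * C' * v * t0) \<le> \<rho>"
  proof -
    have "(1 + W) / (4 * v * t0) \<le> \<sigma>" using \<sigma> v t0 by (simp add: pos_divide_le_eq mult_ac)
    then have "(1 + W) / (4 * v * t0) / (3 * C' * (1 + W)) \<le> \<rho>"
      unfolding \<rho>_def using C' W0 by (intro divide_right_mono) auto
    moreover have "(1 + W) / (4 * v * t0) / (3 * C' * (1 + W)) = 1 / (12 * C' * v * t0)"
    proof -
      have "X / (4 * v * t0) / (3 * C' * X) = 1 / (12 * C' * v * t0)" if "X \<noteq> 0" for X
        using that by simp
      then show ?thesis using W0 by simp
    qed
    ultimately show ?thesis by simp
  qed
  have \<rho>0: "0 \<le> \<rho>" using order_trans[OF _ \<rho>, of 0] C' v t0 by simp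
  have "B \<rho> * ennreal (vol Q / (2 * 4^m)) \<le> 1"
    unfolding \<rho>_def \<sigma>_def by (rule skew_estimate[OF pq A B korn C' Q g a]) (simp add: W_def v(1))
  then have est: "B \<rho> * ennreal (v / (2 * 4^m)) \<le> 1" unfolding v(1) .
  have "B \<rho> = B \<rho> * ennreal (v / (2 * 4^m)) * ennreal (2 * 4^m / v)"
    using v(2) by (simp add: mult.assoc ennreal_mult[symmetric])
  also have "\<dots> \<le> 1 * ennreal (2 * 4^m / v)" by (rule mult_right_mono[OF est]) simp
  finally have B\<rho>: "B \<rho> \<le> ennreal (2 * 4^m / v)" by simp
  have "y / (12 * C' * v * t0) \<le> \<rho> * y" using mult_right_mono[OF \<rho> y] by simp
  then have "ennreal (y / (12 * C' * v * t0) - 2 * 4^m / v) \<le> ennreal (\<rho> * y - 2 * 4^m / v)"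
    by (intro ennreal_leI) simp
  also have "\<dots> = ennreal (\<rho> * y) - ennreal (2 * 4^m / v)" using v(2) by (simp add: ennreal_minus)
  also have "\<dots> \<le> ennreal (\<rho> * y) - B \<rho>" by (rule ennreal_minus_mono[OF order_refl B\<rho>])
  also have "\<dots> \<le> young_conj B y" by (rule young_conj_ge[OF \<rho>0])
  finally show ?thesis .
qed

text \<open>By contradiction for each selection of step sizes: if its weighted gain reached 1,
  \<open>skew_conj_estimate\<close> would force the conjugate of \<open>B\<close> at c t to be at
  least twice itself. So all gains stay below 1, and taking suprema bounds a weighted sum of values
  of the conjugate of \<open>A\<close>.\<close>

lemma second_inequality:
  fixes \<Omega> :: "(real^'n) set" and p q :: 'n
  assumes pq: "p \<noteq> q" and \<Omega>: "open \<Omega>" "\<Omega> \<noteq> {}" and A: "young_function A" and B: "young_function B"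
    and korn: "\<forall>u G E. in_W110 \<Omega> u G \<and> in_EA0 A \<Omega> u \<and> weak_symgrad \<Omega> u E \<longrightarrow>
           orlicz_norm B \<Omega> G \<le> ennreal C * orlicz_norm A \<Omega> E"
  shows "\<exists>c t0. 0 < c \<and> 0 < t0 \<and>
    (\<forall>t\<ge>t0. ennreal t * (\<integral>\<^sup>+s\<in>{t0..t}. young_conj A s / ennreal (s\<^sup>2) \<partial>lborel) \<le> young_conj B (c * t))"
proof -
  obtain r0 where r0: "0 < r0" "A r0 \<noteq> \<infinity>" using A unfolding young_function_def by blast
  \<comment> \<open>For slopes s above t0 the point \<open>r0\<close> satisfies A r0 \<le> r0 s, so
    the restricted choice sets \<open>R k\<close> are nonempty.\<close>
  define t0 where "t0 = max 1 (enn2real (A r0) / r0)"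
  have t0: "0 < t0" "enn2real (A r0) / r0 \<le> t0" by (auto simp: t0_def)
  have Ar0: "A r0 \<le> ennreal (r0 * s)" if "t0 \<le> s" for s
  proof -
    have "enn2real (A r0) \<le> t0 * r0" using t0(2) r0(1) by (simp add: pos_divide_le_eq)
    also have "\<dots> \<le> r0 * s" using that r0(1) by (simp add: mult.commute)
    finally have "ennreal (enn2real (A r0)) \<le> ennreal (r0 * s)" by (rule ennreal_leI)
    then show ?thesis using r0(2) by (simp add: less_top)
  qed
  obtain r1 where r1: "0 < r1" "B r1 \<noteq> \<infinity>" using B unfolding young_function_def by blast
  define b1 where "b1 = enn2real (B r1)"
  have b1: "0 \<le> b1" "B r1 = ennreal b1" using r1 by (auto simp: b1_def less_top)
  define C' where "C' = max C 0 + 1"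
  have C': "0 < C'" "C < C'" by (auto simp: C'_def)
  obtain v0 where v0: "0 < v0"
    "\<And>v. 0 < v \<Longrightarrow> v \<le> v0 \<Longrightarrow> \<exists>Q. open Q \<and> bounded Q \<and> Q \<subseteq> \<Omega> \<and> vol Q = v"
    by (rule open_box_of_measure[OF \<Omega>]) (rule that)
  \<comment> \<open>108 is 9 times the 12 of \<open>skew_conj_estimate\<close>. The last entry comes
    from testing the conjugate of \<open>B\<close> with \<open>r1\<close>: it makes \<beta> at least
    t / (2 t0 v0), hence \<open>v\<close> at most \<open>v0\<close>.\<close>
  define c where "c = max (max 1 (108 * C')) ((b1 / t0 + 1 / (2 * t0 * v0)) / r1)"
  have c: "1 \<le> c" "108 * C' \<le> c" "(b1 / t0 + 1 / (2 * t0 * v0)) / r1 \<le> c" by (auto simp: c_def)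
  have "ennreal t * (\<integral>\<^sup>+s\<in>{t0..t}. young_conj A s / ennreal (s\<^sup>2) \<partial>lborel) \<le> young_conj B ((6 * c) * t)"
    if t: "t0 \<le> t" for t
  proof (cases "young_conj B (c * t)")
    case top
    have "young_conj B (c * t) \<le> young_conj B ((6 * c) * t)"
      using c t t0 by (intro young_conj_mono) auto
    then show ?thesis using top by (simp add: top_unique)
  next
    case (real \<beta>)
    have tpos: "0 < t" using t t0 by simp
    obtain M where M: "t0 * 4 ^ M \<le> t" "t \<le> t0 * 4 ^ Suc M"
      by (rule geometric_bracket[of 4 t0 t]) (use t0 t in auto)
    define m where "m = Suc M"
    have m4: "4 ^ m \<le> 4 * t / t0" using M(1) t0 by (simp add: m_def field_simps)
    have \<beta>low: "t / (2 * t0 * v0) \<le> \<beta>"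
    proof -
      have "ennreal (r1 * (c * t) - b1) = ennreal (r1 * (c * t)) - B r1"
        using b1 by (simp add: ennreal_minus)
      also have "\<dots> \<le> young_conj B (c * t)" using r1 by (intro young_conj_ge) simp
      finally have "r1 * (c * t) - b1 \<le> \<beta>" using real by (simp add: ennreal_le_iff)
      moreover have "b1 / t0 + 1 / (2 * t0 * v0) \<le> c * r1"
        using c(3) r1 by (simp add: pos_divide_le_eq)
      then have "(b1 / t0 + 1 / (2 * t0 * v0)) * t \<le> c * r1 * t"
        using tpos by (intro mult_right_mono) auto
      then have "b1 * (t / t0) + t / (2 * t0 * v0) \<le> r1 * (c * t)"
        by (simp add: algebra_simps)
      moreover have "b1 * 1 \<le> b1 * (t / t0)"
        using b1 t t0 by (intro mult_left_mono) auto
      ultimately show ?thesis by linarith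
    qed
    have \<beta>: "0 < \<beta>"
    proof -
      have "0 < t / (2 * t0 * v0)" using tpos t0 v0 by simp
      then show ?thesis using \<beta>low by linarith
    qed
    \<comment> \<open>Chosen so that t / (v t0) = 2 \<beta>, the value that contradicts the estimate
      below.\<close>
    define v where "v = t / (2 * t0 * \<beta>)"
    have v: "0 < v" using tpos t0 \<beta> by (simp add: v_def)
    have "v \<le> v0"
    proof -
      have "t \<le> \<beta> * (2 * t0 * v0)" using \<beta>low t0 v0 by (simp add: pos_divide_le_eq)
      then show ?thesis
        unfolding v_def using t0 \<beta> by (subst pos_divide_le_eq) (auto simp: mult_ac)
    qed
    obtain Q where Q: "open Q" "bounded Q" "Q \<subseteq> \<Omega>" "vol Q = v"
      using v0(2)[OF v \<open>v \<le> v0\<close>] by blast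
    define s where "s k = t0 * 4 ^ Suc k" for k :: nat
    have s: "t0 \<le> s k" "0 < s k" for k
    proof -
      have "t0 * 1 \<le> s k" unfolding s_def using t0 by (intro mult_left_mono one_le_power) auto
      then show "t0 \<le> s k" "0 < s k" using t0 by auto
    qed
    define R where "R k = {r. 0 < r \<and> A r \<le> ennreal (r * s k)}" for k
    have R: "R k \<noteq> {}" for k using r0(1) Ar0[OF s(1)] by (auto simp: R_def)
    have choice_bound: "(\<Sum>k<m. ennreal (v / 4^k) * (ennreal (g k * s k) - A (g k))) \<le> 1"
      if g: "\<And>k. g k \<in> R k" for g
    proof -
      have gpos: "0 < g k" and gA: "A (g k) \<le> ennreal (g k * s k)" for k
        using g[of k] by (auto simp: R_def)
      define a where "a k = enn2real (A (g k))" for k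
      have a: "A (g k) = ennreal (a k)" "0 \<le> a k" for k
      proof -
        have "A (g k) < \<infinity>" using le_less_trans[OF gA[of k] ennreal_less_top] by simp
        then show "A (g k) = ennreal (a k)" "0 \<le> a k" by (auto simp: a_def)
      qed
      have ag: "a k \<le> g k * s k" for k
        using gA[of k] a gpos[of k] s(2)[of k] by (simp add: ennreal_le_iff)
      define I where "I = (\<Sum>k<m. v / 4^k * (g k * s k - a k))"
      have I0: "0 \<le> v / 4^k * (g k * s k - a k)" for k using v ag[of k] by simp
      \<comment> \<open>With X = t / (v t0) the estimate would give \<beta> \<ge> 9 X - 8 X = 2
        \<beta>. The 8 comes from 2 4^m / v and 4^m \<le> 4 t / t0.\<close>
      have "\<not> 1 \<le> I"
      proof
        assume "1 \<le> I"
        then have "ennreal (c * t / (12 * C' * v * t0) - 2 * 4^m / v) \<le> young_conj B (c * t)"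
          unfolding I_def s_def using c tpos
          by (intro skew_conj_estimate[OF pq A B korn C' Q v t0(1) _ gpos a]) auto
        then have "c * t / (12 * C' * v * t0) - 2 * 4^m / v \<le> \<beta>"
          using real by (simp add: ennreal_le_iff)
        moreover have "9 * (t / (v * t0)) \<le> c * t / (12 * C' * v * t0)"
        proof -
          have "108 * C' * (t / (12 * C' * v * t0)) \<le> c * (t / (12 * C' * v * t0))"
            using c(2) tpos C' v t0 by (intro mult_right_mono) auto
          then show ?thesis using C' by (simp add: mult_ac)
        qed
        moreover have "2 * 4^m / v \<le> 8 * (t / (v * t0))"
        proof -
          have "2 * 4^m / v \<le> 2 * (4 * t / t0) / v"
            using m4 v by (intro divide_right_mono mult_left_mono) auto
          then show ?thesis by (simp add: mult_ac)
        qed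
        moreover have "t / (v * t0) = 2 * \<beta>" using tpos t0 \<beta> by (simp add: v_def)
        ultimately show False using \<beta> by linarith
      qed
      have "(\<Sum>k<m. ennreal (v / 4^k) * (ennreal (g k * s k) - A (g k))) = (\<Sum>k<m. ennreal (v / 4^k * (g k * s k - a k)))"
      proof (rule sum.cong[OF refl])
        fix k
        have "ennreal (g k * s k) - A (g k) = ennreal (g k * s k - a k)"
          unfolding a(1) by (rule ennreal_minus[OF a(2)])
        then show "ennreal (v / 4^k) * (ennreal (g k * s k) - A (g k)) = ennreal (v / 4^k * (g k * s k - a k))"
          using v ennreal_mult'[of "v / 4^k" "g k * s k - a k"] by simp
      qed
      also have "\<dots> = ennreal I" unfolding I_def using I0 by (intro sum_ennreal) simp
      also have "\<dots> \<le> 1" using \<open>\<not> 1 \<le> I\<close> by simp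
      finally show ?thesis .
    qed
    have "(\<Sum>k<m. SUP r\<in>R k. ennreal (v / 4^k) * (ennreal (r * s k) - A r)) + 0 \<le> 1"
      by (rule sum_SUP_le[OF R]) (simp add: choice_bound)
    moreover have "(\<Sum>k<m. ennreal (v / 4^k) * young_conj A (s k))
        \<le> (\<Sum>k<m. SUP r\<in>R k. ennreal (v / 4^k) * (ennreal (r * s k) - A r))"
    proof (rule sum_mono)
      fix k
      have "young_conj A (s k) \<le> (SUP r\<in>R k. ennreal (r * s k) - A r)"
        using young_conj_eq_SUP_restricted[OF young_zero[OF A] R[unfolded R_def]] unfolding R_def .
      then show "ennreal (v / 4^k) * young_conj A (s k) \<le> (SUP r\<in>R k. ennreal (v / 4^k) * (ennreal (r * s k) - A r))"
        unfolding SUP_mult_left_ennreal[symmetric] by (rule mult_left_mono) simp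
    qed
    ultimately have bound: "(\<Sum>k<m. ennreal (v / 4^k) * young_conj A (s k)) \<le> 1"
      by (simp add: order_trans)
    have "(\<integral>\<^sup>+s\<in>{t0..t}. young_conj A s / ennreal (s\<^sup>2) \<partial>lborel)
        \<le> (\<Sum>k<m. young_conj A (t0 * 4 ^ Suc k) * ennreal ((4 - 1) / (t0 * 4 ^ k)))"
      by (rule geometric_integral_le[OF t0(1)]) (use M(2) young_conj_mono in \<open>auto simp: m_def\<close>)
    then have "ennreal t * (\<integral>\<^sup>+s\<in>{t0..t}. young_conj A s / ennreal (s\<^sup>2) \<partial>lborel)
        \<le> ennreal t * (\<Sum>k<m. young_conj A (t0 * 4 ^ Suc k) * ennreal ((4 - 1) / (t0 * 4 ^ k)))"
      by (rule mult_left_mono) simp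
    also have "\<dots> = (\<Sum>k<m. ennreal (6 * \<beta>) * (ennreal (v / 4^k) * young_conj A (s k)))"
      unfolding sum_distrib_left
    proof (rule sum.cong[OF refl])
      fix k
      have "t * ((4 - 1) / (t0 * 4 ^ k)) = 6 * \<beta> * (v / 4^k)"
        using \<beta> t0 by (simp add: v_def)
      moreover have "ennreal (t * ((4 - 1) / (t0 * 4 ^ k))) = ennreal t * ennreal ((4 - 1) / (t0 * 4 ^ k))"
        by (rule ennreal_mult') (use tpos in simp)
      moreover have "ennreal (6 * \<beta> * (v / 4^k)) = ennreal (6 * \<beta>) * ennreal (v / 4^k)"
        by (rule ennreal_mult') (use \<beta> in simp)
      ultimately have e: "ennreal t * ennreal ((4 - 1) / (t0 * 4 ^ k)) = ennreal (6 * \<beta>) * ennreal (v / 4^k)"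
        by (simp only:)
      have "ennreal t * (young_conj A (s k) * ennreal ((4 - 1) / (t0 * 4 ^ k)))
          = young_conj A (s k) * (ennreal t * ennreal ((4 - 1) / (t0 * 4 ^ k)))"
        by (rule mult.left_commute)
      also have "\<dots> = ennreal (6 * \<beta>) * (ennreal (v / 4^k) * young_conj A (s k))"
        unfolding e by (simp only: mult_ac)
      finally show "ennreal t * (young_conj A (t0 * 4 ^ Suc k) * ennreal ((4 - 1) / (t0 * 4 ^ k)))
          = ennreal (6 * \<beta>) * (ennreal (v / 4^k) * young_conj A (s k))"
        unfolding s_def .
    qed
    also have "\<dots> = ennreal (6 * \<beta>) * (\<Sum>k<m. ennreal (v / 4^k) * young_conj A (s k))"
      by (simp only: sum_distrib_left)
    also have "\<dots> \<le> ennreal (6 * \<beta>) * 1"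
      by (rule mult_left_mono[OF bound]) simp
    also have "\<dots> = ennreal 6 * young_conj B (c * t)"
      using real by (simp add: ennreal_mult)
    also have "\<dots> \<le> young_conj B (6 * (c * t))"
      by (rule young_conj_scale) simp
    finally show ?thesis by (simp add: mult.assoc)
  qed
  then show ?thesis
    using c(1) t0(1) by (intro exI[of _ "6 * c"] exI[of _ t0]) auto
qed

text \<open>A later starting point shrinks the integral and a larger c raises the right-hand side,
  so both inequalities can share their constants.\<close>

lemma average_bound_mono:
  fixes F :: "real \<Rightarrow> ennreal"
  assumes "\<forall>t\<ge>t0. ennreal t * (\<integral>\<^sup>+s\<in>{t0..t}. F s / ennreal (s\<^sup>2) \<partial>lborel) \<le> G (c * t)"
    and "0 \<le> c" "c \<le> c'" "0 \<le> t0" "t0 \<le> t0'" and G: "\<And>x y. 0 \<le> x \<Longrightarrow> x \<le> y \<Longrightarrow> G x \<le> G y" and "t0' \<le> t"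
  shows "ennreal t * (\<integral>\<^sup>+s\<in>{t0'..t}. F s / ennreal (s\<^sup>2) \<partial>lborel) \<le> (G (c' * t) :: ennreal)"
proof -
  have "ennreal t * (\<integral>\<^sup>+s\<in>{t0'..t}. F s / ennreal (s\<^sup>2) \<partial>lborel)
      \<le> ennreal t * (\<integral>\<^sup>+s\<in>{t0..t}. F s / ennreal (s\<^sup>2) \<partial>lborel)"
    using assms by (intro mult_left_mono set_nn_integral_mono_set) auto
  also have "\<dots> \<le> G (c * t)" using assms by auto
  also have "\<dots> \<le> G (c' * t)" using assms by (intro G mult_right_mono) auto
  finally show ?thesis .
qed

theorem theorem5p1:
  fixes \<Omega> :: "(real^'n) set" and A B :: "real \<Rightarrow> ennreal" and C :: real
  assumes "CARD('n) \<ge> 2"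
    and "open \<Omega>" and "bounded \<Omega>" and "\<Omega> \<noteq> {}"
    and "young_function A" and "young_function B"
    and "\<forall>u G E. in_W110 \<Omega> u G \<and> in_EA0 A \<Omega> u \<and> weak_symgrad \<Omega> u E \<longrightarrow>
           orlicz_norm B \<Omega> G \<le> ennreal C * orlicz_norm A \<Omega> E"
  shows "\<exists>c>0. \<exists>t0\<ge>0. \<forall>t\<ge>t0.
           ennreal t * (\<integral>\<^sup>+ s\<in>{t0..t}. B s / ennreal (s\<^sup>2) \<partial>lborel) \<le> A (c * t) \<and>
           ennreal t * (\<integral>\<^sup>+ s\<in>{t0..t}. young_conj A s / ennreal (s\<^sup>2) \<partial>lborel) \<le> young_conj B (c * t)"
proof -
  obtain p q :: 'n where pq: "p \<noteq> q" using two_indices_exist[OF assms(1)] by blast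
  obtain c1 t1 where 1: "0 < c1" "0 < t1"
    "\<forall>t\<ge>t1. ennreal t * (\<integral>\<^sup>+s\<in>{t1..t}. B s / ennreal (s\<^sup>2) \<partial>lborel) \<le> A (c1 * t)"
    using first_inequality[OF pq assms(2,4-7)] by blast
  obtain c2 t2 where 2: "0 < c2" "0 < t2"
    "\<forall>t\<ge>t2. ennreal t * (\<integral>\<^sup>+s\<in>{t2..t}. young_conj A s / ennreal (s\<^sup>2) \<partial>lborel) \<le> young_conj B (c2 * t)"
    using second_inequality[OF pq assms(2,4-7)] by blast
  show ?thesis
  proof (rule exI[of _ "max c1 c2"], rule conjI, use 1(1) in simp,
      rule exI[of _ "max t1 t2"], rule conjI, use 1(2) in simp, intro allI impI conjI)
    fix t assume t: "max t1 t2 \<le> t"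
    show "ennreal t * (\<integral>\<^sup>+ s\<in>{max t1 t2..t}. B s / ennreal (s\<^sup>2) \<partial>lborel) \<le> A (max c1 c2 * t)"
      by (rule average_bound_mono[OF 1(3) _ _ _ _ young_mono[OF assms(5)] t]) (use 1 in auto)
    show "ennreal t * (\<integral>\<^sup>+ s\<in>{max t1 t2..t}. young_conj A s / ennreal (s\<^sup>2) \<partial>lborel) \<le> young_conj B (max c1 c2 * t)"
      by (rule average_bound_mono[OF 2(3) _ _ _ _ young_conj_mono t]) (use 2 in auto)
  qed
qed

end
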